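(* Let $p$ be a prime with $p\ne2,11$. Then $$\sum_{n=0}^{p-1}\binom{2n}{n}\frac{A'_n}{4^n}\equiv\begin{cases}x^2\pmod p&\text{if }\big(\frac{p}{11}\big)=1\text{ and }4p=x^2+11y^2\ (x,y\in\mathbb{Z}),\\0\pmod p&\text{if }\big(\frac{p}{11}\big)=-1.\end{cases}$$
   Context: For $n\ge0$, $A'_n=\sum_{k=0}^n\binom{n}{k}^2\binom{n+k}{k}$ (Apéry numbers for $\zeta(2)$). $\big(\frac{p}{11}\big)$ is the Legendre symbol. Congruences between rationals with denominators prime to $p$ are taken in the ring of such rationals. *)

theory Defs
  imports "HOL-Number_Theory.Number_Theory"
begin

text \<open>The Apery numbers for \<open>\<zeta>(2)\<close>.\<close>

definition apery2 :: "nat \<Rightarrow> nat" where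
  "apery2 n = (\<Sum>k=0..n. (n choose k)^2 * ((n + k) choose k))"

text \<open>The ring of rationals whose denominator in lowest terms is prime to \<open>p\<close>.\<close>

definition p_integral :: "nat \<Rightarrow> rat set" where
  "p_integral p = {r. coprime (snd (quotient_of r)) (int p)}"

text \<open>Congruence modulo \<open>p\<close> in that ring: both sides belong to the ring and their difference
  lies in the ideal generated by \<open>p\<close>.\<close>

definition rat_cong :: "rat \<Rightarrow> rat \<Rightarrow> nat \<Rightarrow> bool" where
  "rat_cong r s p \<longleftrightarrow>
     r \<in> p_integral p \<and> s \<in> p_integral p \<and> (\<exists>t\<in>p_integral p. r - s = of_nat p * t)"

end

theory Submission
  imports
    Defs
    "HOL-Computational_Algebra.Computational_Algebra"
    "HOL-Algebra.Algebraic_Closure_Type"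
begin

text \<open>
  Modulo \<open>p\<close>, the factor \<open>C(2n, n) / 4\<^sup>n\<close> is \<open>(-1)\<^sup>n C((p - 1) / 2, n)\<close>, and inverting the binomial sum
  turns the left-hand side into the sum of \<open>C(2k, k)\<^sup>2 C(3k, k) / 64\<^sup>k\<close>. By Clausen's identity this is the square
  of the sum of \<open>C(2k, k) C(3k, k) c\<^sup>k\<close>, where \<open>c - 27 c\<^sup>2 = 1 / 64\<close>, i.e. \<open>216 c = 4 + \<surd>-11\<close>. The latter
  is the Hasse invariant of \<open>y\<^sup>2 = 4 X\<^sup>3 + (X + c)\<^sup>2\<close>, a twist of \<open>y\<^sup>2 = x\<^sup>3 - 264 x + 1694\<close>, which has complex
  multiplication by \<open>\<int>[\<alpha>]\<close>, \<open>\<alpha> = (1 - \<surd>-11) / 2\<close>.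

  Let \<open>H\<close> be the Hasse invariant and \<open>\<Pi>\<close> the Frobenius endomorphism. For an endomorphism \<open>\<delta>\<close> acting on the
  invariant differential by \<open>c \<noteq> 0\<close>, a residue computation gives \<open>deg (\<Pi> + \<delta>) - deg \<delta> = c H\<close> modulo \<open>p\<close>.
  If \<open>-11\<close> is not a square modulo \<open>p\<close>, take \<open>\<delta> = 1\<close> and \<open>\<delta> = \<alpha>\<close>: both \<open>H\<close> and \<open>\<alpha> H\<close> lie in the prime
  field, so \<open>H = 0\<close>. If \<open>4 p = x\<^sup>2 + 11 y\<^sup>2\<close>, then \<open>p\<close> is the norm of some \<open>\<gamma>\<close> in \<open>\<int>[\<alpha>]\<close> that kills the
  differential; having degree \<open>p\<close>, it is \<open>\<Pi>\<close> up to sign. Choose \<open>\<delta>\<close> such that \<open>\<gamma>, \<delta>\<close> is a basis of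
  \<open>\<int>[\<alpha>]\<close>. As the degree is the norm form, \<open>\<plusminus>c H\<close> is the trace of \<open>\<gamma>\<close> times the conjugate of \<open>\<delta>\<close>, which
  reduces to \<open>x c\<close>; so \<open>H = \<plusminus>x\<close>.
\<close>

hide_const (open) Divisibility.prime Divisibility.irreducible
no_notation Polynomials.var (\<open>X\<index>\<close>)

section \<open>Binomial sums modulo a prime\<close>

text \<open>The ground field is algebraically closed so that coprimality of polynomials becomes
  absence of a common root and divisibility can be proved one root at a time. The obstacle is that
  degrees of endomorphisms must be exact: an error term would ruin a comparison modulo
  \<open>p\<close>. They are obtained from abscissae alone. The unordered pair of abscissae of
  \<open>P1 + P2\<close> and \<open>P1 - P2\<close> is given by three forms in those of
  \<open>P1\<close> and \<open>P2\<close>; over a nonsingular curve these forms have no common zero,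
  so the parallelogram law for degrees holds without error. Points are related to each other only by
  lying on a line, and associativity of addition never occurs. Frobenius has derivative zero, which
  is why a residue computation sees the other summand \<open>\<delta>\<close> only, through its
  factor \<open>c\<close>. For the curve used, \<open>4 a^3 + 27 b^2 = 2^2 * 3^6 * 11^3\<close>; it
  is singular modulo 3, so the general argument excludes \<open>p = 3\<close>.\<close>

lemma of_nat_choose_Suc:
  "of_nat (Suc k) * of_nat (n choose Suc k) = (of_nat n - of_nat k) * (of_nat (n choose k) :: 'a::comm_ring_1)"
proof (cases "k \<le> n")
  case True
  have "Suc k * (n choose Suc k) = (n - k) * (n choose k)"
    by (metis Suc_diff_le True add.commute binomial_absorb_comp binomial_absorption diff_Suc_1 mult.commute plus_1_eq_Suc)
  hence "of_nat (Suc k * (n choose Suc k)) = (of_nat ((n - k) * (n choose k)) :: 'a)" by (simp only:)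
  thus ?thesis using True by (simp only: of_nat_mult of_nat_diff)
qed (simp add: binomial_eq_0)

lemma central_binomial_Suc:
  "Suc n * (2 * Suc n choose Suc n) = 2 * (2 * n + 1) * (2 * n choose n)"
proof -
  have 1: "Suc n * (Suc (2 * n) choose Suc n) = Suc (2 * n) * (2 * n choose n)"
    by (rule Suc_times_binomial)
  have 2: "Suc n * (Suc (Suc (2 * n)) choose Suc n) = Suc (Suc (2 * n)) * (Suc (2 * n) choose n)"
    by (rule Suc_times_binomial)
  have 3: "Suc (2 * n) choose n = Suc (2 * n) choose Suc n"
    using binomial_symmetric[of n "Suc (2 * n)"] by simp
  have "Suc n * (2 * Suc n choose Suc n) = 2 * (Suc n * (Suc (2 * n) choose Suc n))"
    using 2 unfolding 3 by simp
  thus ?thesis unfolding 1 by simp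
qed

lemma field_char_of_nat_neq_0:
  assumes "CHAR('k::field) = p" "0 < n" "n < p"
  shows "(of_nat n :: 'k) \<noteq> 0"
  using assms by (auto simp: of_nat_eq_0_iff_char_dvd dest: dvd_imp_le)

text \<open>Over the rationals \<open>C(2n, n) = (-4)^n C(-1/2, n)\<close>, and \<open>m\<close>
  equals \<open>-1/2\<close> in the field because \<open>2 m = p - 1\<close>. The bound
  \<open>n < p\<close> allows division by \<open>Suc n\<close> in the recursion.\<close>

lemma central_binomial_char:
  assumes "CHAR('k::field) = p" "p = 2 * m + 1" "n < p"
  shows "(of_nat (2 * n choose n) :: 'k) = (- 4) ^ n * of_nat (m choose n)"
  using assms(3)
proof (induction n)
  case (Suc n)
  have m: "2 * (of_nat m :: 'k) = - 1"
    using of_nat_CHAR[where ?'a = 'k] assms(1,2) by (simp add: eq_neg_iff_add_eq_0 add.commute)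
  have "of_nat (Suc n) * (of_nat (2 * Suc n choose Suc n) :: 'k) = 2 * (2 * of_nat n + 1) * of_nat (2 * n choose n)"
    unfolding of_nat_mult[symmetric] central_binomial_Suc by (simp add: algebra_simps)
  also have "\<dots> = 2 * (2 * of_nat n + 1) * ((- 4) ^ n * of_nat (m choose n))"
    using Suc by simp
  also have "\<dots> = (- 4) ^ Suc n * ((of_nat m - of_nat n) * of_nat (m choose n))"
  proof -
    have "2 * (2 * N + 1) * (E * C) = (- 4) * E * ((M - N) * C)" if "2 * M = - 1" for E C M N :: 'k
    proof -
      have "(- 4) * E * ((M - N) * C) = - 2 * (2 * M) * (E * C) + 4 * N * (E * C)"
        by (simp add: algebra_simps)
      thus ?thesis unfolding that by (simp add: algebra_simps)
    qed
    from this[OF m] show ?thesis by (simp add: mult.assoc)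
  qed
  also have "\<dots> = of_nat (Suc n) * ((- 4) ^ Suc n * of_nat (m choose Suc n))"
    by (simp only: of_nat_choose_Suc[symmetric]) (simp add: algebra_simps)
  finally show ?case
    using field_char_of_nat_neq_0[OF assms(1), of "Suc n"] Suc.prems unfolding mult_cancel_left by blast
qed simp

text \<open>The upper index \<open>p - 1 - r\<close> is \<open>-1 - r\<close> in the field, so this
  is upper negation of binomial coefficients.\<close>

lemma binomial_reflect_char:
  assumes "CHAR('k::field) = p" "r < p" "k < p"
  shows "(of_nat ((p - 1 - r) choose k) :: 'k) = (- 1) ^ k * of_nat ((r + k) choose k)"
  using assms(3)
proof (induction k)
  case (Suc k)
  have N: "(of_nat (p - 1 - r) :: 'k) = - 1 - of_nat r"
    using assms of_nat_CHAR[where ?'a = 'k] by (simp add: of_nat_diff)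
  have "of_nat (Suc k) * (of_nat ((p - 1 - r) choose Suc k) :: 'k)
        = (- 1 - of_nat r - of_nat k) * ((- 1) ^ k * of_nat ((r + k) choose k))"
    unfolding of_nat_choose_Suc N using Suc by simp
  also have "\<dots> = (- 1) ^ Suc k * of_nat (Suc (r + k) * ((r + k) choose k))"
    by (simp add: algebra_simps)
  also have "\<dots> = of_nat (Suc k) * ((- 1) ^ Suc k * of_nat ((r + Suc k) choose Suc k))"
    unfolding Suc_times_binomial[symmetric] by (simp add: algebra_simps)
  finally show ?case
    using field_char_of_nat_neq_0[OF assms(1), of "Suc k"] Suc.prems unfolding mult_cancel_left by blast
qed simp

section \<open>Finite differences and the binomial transform of the Apery numbers\<close>

lemma sum_choose_Suc:
  fixes g :: "nat \<Rightarrow> int"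
  shows "(\<Sum>j\<le>Suc N. of_nat (Suc N choose j) * g j) = (\<Sum>j\<le>N. of_nat (N choose j) * (g j + g (Suc j)))"
proof -
  have "(\<Sum>j\<le>Suc N. of_nat (Suc N choose j) * g j)
      = g 0 + (\<Sum>j\<le>N. of_nat (N choose Suc j) * g (Suc j)) + (\<Sum>j\<le>N. of_nat (N choose j) * g (Suc j))"
    unfolding sum.atMost_Suc_shift by (simp add: algebra_simps sum.distrib)
  also have "g 0 + (\<Sum>j\<le>N. of_nat (N choose Suc j) * g (Suc j)) = (\<Sum>j\<le>Suc N. of_nat (N choose j) * g j)"
    unfolding sum.atMost_Suc_shift by simp
  finally show ?thesis by (simp add: algebra_simps sum.distrib)
qed

text \<open>Up to the sign \<open>(-1)^N\<close> this is the \<open>N\<close>-th finite difference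
  of \<open>C(x + L, M)\<close> at \<open>x = 0\<close>; by Pascal's rule each difference lowers
  \<open>M\<close> by one.\<close>

lemma alternating_sum_choose:
  "(\<Sum>j\<le>N. of_nat (N choose j) * ((- 1) ^ j * int ((j + L) choose M)))
     = (if N \<le> M then (- 1) ^ N * int (L choose (M - N)) else 0)"
proof (induction N arbitrary: L M)
  case (Suc N)
  have "(\<Sum>j\<le>Suc N. of_nat (Suc N choose j) * ((- 1) ^ j * int ((j + L) choose M)))
      = (\<Sum>j\<le>N. of_nat (N choose j) * ((- 1) ^ j * (int ((j + L) choose M) - int ((Suc j + L) choose M))))"
    unfolding sum_choose_Suc by (simp add: algebra_simps)
  also have "\<dots> = (if Suc N \<le> M then (- 1) ^ Suc N * int (L choose (M - Suc N)) else 0)"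
  proof (cases M)
    case 0
    then show ?thesis by simp
  next
    case (Suc M')
    have "(\<Sum>j\<le>N. of_nat (N choose j) * ((- 1) ^ j * (int ((j + L) choose M) - int ((Suc j + L) choose M))))
       = - (\<Sum>j\<le>N. of_nat (N choose j) * ((- 1) ^ j * int ((j + L) choose M')))"
      unfolding sum_negf[symmetric] by (intro sum.cong refl) (simp add: Suc)
    then show ?thesis unfolding Suc.IH using Suc by auto
  qed
  finally show ?case .
qed auto

text \<open>For \<open>m = (p - 1) / 2\<close> the left side is the sum of the theorem modulo
  \<open>p\<close>. Regrouping the binomials leaves \<open>n\<close> only in
  \<open>C(m - k, n - k)\<close> and \<open>C(n + k, 2 k)\<close>, so for fixed \<open>k\<close> the
  sum over \<open>n\<close> is a finite difference of order \<open>m - k\<close>.\<close>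

lemma apery_binomial_transform:
  "(\<Sum>n\<le>m. int (m choose n) * ((- 1) ^ n * int (apery2 n)))
     = (- 1) ^ m * (\<Sum>k\<le>m. int (m choose k) * int (2 * k choose k) * int (2 * k choose (m - k)))"
proof -
  have A: "int (apery2 n) = (\<Sum>k\<le>m. int ((n choose k)^2 * ((n + k) choose k)))" if "n \<le> m" for n
  proof -
    have "apery2 n = (\<Sum>k\<le>m. (n choose k)^2 * ((n + k) choose k))"
      unfolding apery2_def by (rule sum.mono_neutral_left) (use that in \<open>auto simp: binomial_eq_0\<close>)
    thus ?thesis by simp
  qed
  have B: "int (m choose n) * int ((n choose k)^2 * ((n + k) choose k)) =
     int (m choose k) * int (2 * k choose k) * (int ((m - k) choose (n - k)) * int ((n + k) choose (2 * k)))"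
    if "k \<le> n" "n \<le> m" for n k
  proof -
    have "(m choose n) * (n choose k) = (m choose k) * ((m - k) choose (n - k))"
      using that by (simp add: choose_mult)
    moreover have "(n + k choose k) * (n choose k) = (n + k choose (2 * k)) * (2 * k choose k)"
      using choose_mult[of k "2 * k" "n + k"] that by (simp add: mult_2)
    ultimately have "(m choose n) * ((n choose k)^2 * ((n + k) choose k)) =
      (m choose k) * (2 * k choose k) * (((m - k) choose (n - k)) * ((n + k) choose (2 * k)))"
      by (metis (no_types, lifting) mult.assoc mult.commute power2_eq_square)
    thus ?thesis by (metis of_nat_mult)
  qed
  have "(\<Sum>n\<le>m. int (m choose n) * ((- 1) ^ n * int (apery2 n)))
      = (\<Sum>n\<le>m. \<Sum>k\<le>m. (- 1) ^ n * (int (m choose n) * int ((n choose k)^2 * ((n + k) choose k))))"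
    by (intro sum.cong refl) (simp add: A sum_distrib_left mult_ac)
  also have "\<dots> = (\<Sum>k\<le>m. \<Sum>n\<le>m. (- 1) ^ n * (int (m choose n) * int ((n choose k)^2 * ((n + k) choose k))))"
    by (rule sum.swap)
  also have "\<dots> = (\<Sum>k\<le>m. (- 1) ^ m * (int (m choose k) * int (2 * k choose k) * int (2 * k choose (m - k))))"
  proof (intro sum.cong refl)
    fix k assume "k \<in> {..m}"
    hence k: "k \<le> m" by simp
    let ?c = "int (m choose k) * int (2 * k choose k)"
    have "(\<Sum>n\<le>m. (- 1) ^ n * (int (m choose n) * int ((n choose k)^2 * ((n + k) choose k))))
        = (\<Sum>n\<in>{k..m}. (- 1) ^ n * (int (m choose n) * int ((n choose k)^2 * ((n + k) choose k))))"
      by (rule sum.mono_neutral_right) (auto simp: binomial_eq_0)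
    also have "\<dots> = (\<Sum>n\<in>{k..m}. ?c * ((- 1) ^ n * (int ((m - k) choose (n - k)) * int ((n + k) choose (2 * k)))))"
    proof (intro sum.cong refl)
      fix n assume "n \<in> {k..m}"
      hence "k \<le> n" "n \<le> m" by auto
      thus "(- 1) ^ n * (int (m choose n) * int ((n choose k)^2 * ((n + k) choose k)))
          = ?c * ((- 1) ^ n * (int ((m - k) choose (n - k)) * int ((n + k) choose (2 * k))))"
        by (simp only: B mult.left_commute[of "(- 1) ^ n"])
    qed
    also have "\<dots> = (\<Sum>j\<le>m - k. ?c * ((- 1) ^ (j + k) * (int ((m - k) choose j) * int ((j + 2 * k) choose (2 * k)))))"
      by (rule sum.reindex_bij_witness[of _ "\<lambda>j. j + k" "\<lambda>n. n - k"]) (use k in \<open>auto simp: mult_2 add.assoc\<close>)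
    also have "\<dots> = ?c * (- 1) ^ k * (\<Sum>j\<le>m - k. int ((m - k) choose j) * ((- 1) ^ j * int ((j + 2 * k) choose (2 * k))))"
      by (simp add: sum_distrib_left power_add mult_ac)
    also have "\<dots> = ?c * (- 1) ^ k * ((- 1) ^ (m - k) * int (2 * k choose (m - k)))"
      unfolding alternating_sum_choose
      by (auto simp: binomial_symmetric[symmetric] binomial_eq_0)
    also have "\<dots> = (- 1) ^ m * (?c * int (2 * k choose (m - k)))"
    proof -
      have "(- 1) ^ k * (- 1) ^ (m - k) = ((- 1) ^ m :: int)"
        using k by (simp flip: power_add)
      moreover have "c * u * (w * d) = (u * w) * (c * d)" for c d u w :: int
        by simp
      ultimately show ?thesis by simp
    qed
    finally show "(\<Sum>n\<le>m. (- 1) ^ n * (int (m choose n) * int ((n choose k)^2 * ((n + k) choose k))))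
      = (- 1) ^ m * (?c * int (2 * k choose (m - k)))" .
  qed
  finally show ?thesis by (simp add: sum_distrib_left)
qed

section \<open>Clausen's identity\<close>

text \<open>The multinomials \<open>(3 i)! / i!^3\<close>, which are the coefficients of
  \<open>2F1(1/3, 2/3; 1; 27 z)\<close>.\<close>

definition hasse_coeff :: "nat \<Rightarrow> nat" where
  "hasse_coeff i = (2 * i choose i) * (3 * i choose i)"

lemma hasse_coeff_fact: "hasse_coeff i * fact i ^ 3 = fact (3 * i)"
proof -
  have "(2 * i choose i) * (fact i * fact i) = (fact (2 * i) :: nat)"
    using binomial_fact_lemma[of i "2 * i"] by (simp add: mult_ac)
  moreover have "(3 * i choose i) * (fact i * fact (2 * i)) = (fact (3 * i) :: nat)"
    using binomial_fact_lemma[of i "3 * i"] by (simp add: mult_ac)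
  ultimately show ?thesis
    unfolding hasse_coeff_def power3_eq_cube by (metis (no_types, lifting) mult.assoc mult.commute)
qed

lemma hasse_coeff_Suc:
  "Suc i ^ 2 * hasse_coeff (Suc i) = 3 * (3 * i + 1) * (3 * i + 2) * hasse_coeff i"
proof -
  have f: "(fact (3 * Suc i) :: nat) = (3 * i + 3) * (3 * i + 2) * (3 * i + 1) * fact (3 * i)"
    by (simp add: numeral_3_eq_3 algebra_simps)
  have "hasse_coeff (Suc i) * (Suc i * fact i) ^ 3 = (3 * i + 3) * (3 * i + 2) * (3 * i + 1) * (hasse_coeff i * fact i ^ 3)"
    using hasse_coeff_fact[of "Suc i"] unfolding f hasse_coeff_fact[of i] fact_Suc of_nat_id .
  hence "(Suc i * fact i ^ 3) * (Suc i ^ 2 * hasse_coeff (Suc i))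
      = (Suc i * fact i ^ 3) * (3 * (3 * i + 1) * (3 * i + 2) * hasse_coeff i)"
    by (simp only: power_mult_distrib power2_eq_square power3_eq_cube)
      (simp add: algebra_simps)
  thus ?thesis by (simp only: mult_cancel1) simp
qed

text \<open>The coefficients of \<open>3F2(1/3, 1/2, 2/3; 1, 1; 108 z)\<close>.\<close>

definition clausen_coeff :: "nat \<Rightarrow> nat" where
  "clausen_coeff k = (2 * k choose k) * hasse_coeff k"

lemma clausen_coeff_Suc:
  "Suc k ^ 3 * clausen_coeff (Suc k) = 6 * (2 * k + 1) * (3 * k + 1) * (3 * k + 2) * clausen_coeff k"
proof -
  have "Suc k ^ 3 * clausen_coeff (Suc k)
    = (Suc k * (2 * Suc k choose Suc k)) * (Suc k ^ 2 * hasse_coeff (Suc k))"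
    by (simp only: clausen_coeff_def power2_eq_square power3_eq_cube mult_ac)
  also have "\<dots> = 6 * (2 * k + 1) * (3 * k + 1) * (3 * k + 2) * clausen_coeff k"
    unfolding central_binomial_Suc hasse_coeff_Suc clausen_coeff_def
    by (simp add: algebra_simps)
  finally show ?thesis .
qed

lemma hasse_fps_ode:
  fixes w :: "rat fps"
  defines "w \<equiv> Abs_fps (\<lambda>i. of_nat (hasse_coeff i))"
  shows "(fps_X - 27 * fps_X ^ 2) * fps_deriv (fps_deriv w) + (1 - 54 * fps_X) * fps_deriv w = 6 * w"
proof (rule fps_ext)
  fix n
  have r: "(of_nat n + 1) ^ 2 * w $ Suc n = 3 * (3 * of_nat n + 1) * (3 * of_nat n + 2) * w $ n"
    using arg_cong[OF hasse_coeff_Suc[of n], of "of_nat :: nat \<Rightarrow> rat"]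
    by (simp add: w_def algebra_simps power2_eq_square)
  \<comment> \<open>Multiplication by powers of \<open>fps_X\<close> shifts indices below zero for
    the first coefficients, hence the separate cases.\<close>
  consider "n = 0" | "n = 1" | k where "n = Suc (Suc k)"
    by (metis One_nat_def not0_implies_Suc)
  thus "((fps_X - 27 * fps_X ^ 2) * fps_deriv (fps_deriv w) + (1 - 54 * fps_X) * fps_deriv w) $ n = (6 * w) $ n"
    using r
    by cases (simp_all add: ring_distribs mult.assoc fps_X_power_mult_nth numeral_fps_const
        fps_mult_left_const_nth of_nat_diff, simp_all add: algebra_simps power2_eq_square)
qed

lemma clausen_fps_ode:
  fixes v :: "rat fps"
  defines "v \<equiv> Abs_fps (\<lambda>i. of_nat (clausen_coeff i))"
  shows "(fps_X ^ 2 - 108 * fps_X ^ 3) * fps_deriv (fps_deriv (fps_deriv v))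
    + (3 * fps_X - 486 * fps_X ^ 2) * fps_deriv (fps_deriv v) + (1 - 348 * fps_X) * fps_deriv v - 12 * v = 0"
proof (rule fps_ext)
  fix n
  have r: "(of_nat n + 1) ^ 3 * v $ Suc n = 6 * (2 * of_nat n + 1) * (3 * of_nat n + 1) * (3 * of_nat n + 2) * v $ n"
    using arg_cong[OF clausen_coeff_Suc[of n], of "of_nat :: nat \<Rightarrow> rat"]
    by (simp add: v_def algebra_simps power3_eq_cube)
  consider "n = 0" | "n = 1" | "n = 2" | k where "n = Suc (Suc (Suc k))"
    by (metis One_nat_def Suc_1 not0_implies_Suc)
  thus "((fps_X ^ 2 - 108 * fps_X ^ 3) * fps_deriv (fps_deriv (fps_deriv v))
    + (3 * fps_X - 486 * fps_X ^ 2) * fps_deriv (fps_deriv v) + (1 - 348 * fps_X) * fps_deriv v - 12 * v) $ n = 0 $ n"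
    using r
    by cases (simp_all add: ring_distribs mult.assoc fps_X_power_mult_nth numeral_fps_const
        fps_mult_left_const_nth of_nat_diff, simp_all add: algebra_simps power3_eq_cube eval_nat_numeral)
qed

text \<open>The exponent 0 is triple at the origin: the coefficient at index \<open>k\<close> of the
  equation expresses \<open>(k + 1)^3\<close> times the coefficient \<open>k + 1\<close> of
  \<open>D\<close> through earlier ones, so a solution is determined by its constant term.\<close>

lemma symmetric_square_unique:
  fixes D :: "rat fps"
  assumes "(fps_X ^ 2 - 54 * fps_X ^ 3 + 729 * fps_X ^ 4) * fps_deriv (fps_deriv (fps_deriv D))
    + (3 * fps_X - 243 * fps_X ^ 2 + 4374 * fps_X ^ 3) * fps_deriv (fps_deriv D)
    + (1 - 186 * fps_X + 5022 * fps_X ^ 2) * fps_deriv D - (12 - 648 * fps_X) * D = 0"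
    and "D $ 0 = 0"
  shows "D = 0"
proof -
  have "D $ n = 0" for n
  proof (induction n rule: less_induct)
    case (less n)
    show ?case
    proof (cases n)
      case 0
      then show ?thesis using assms(2) by simp
    next
      case (Suc k)
      have IH: "D $ j = 0" if "j \<le> k" for j using less Suc that by simp
      consider "k = 0" | "k = 1" | "k = 2" | "k = 3" | j where "k = Suc (Suc (Suc (Suc j)))"
        by (metis One_nat_def Suc_1 numeral_3_eq_3 not0_implies_Suc)
      hence "(of_nat k + 1) ^ 3 * D $ Suc k = 0"
        using arg_cong[OF assms(1), of "\<lambda>F. F $ k"]
        by cases
          (simp_all add: IH ring_distribs mult.assoc fps_X_power_mult_nth numeral_fps_const
            fps_mult_left_const_nth of_nat_diff eval_nat_numeral, (simp_all add: algebra_simps eval_nat_numeral)?)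
      thus ?thesis unfolding Suc
        by (metis add.commute mult_eq_0_iff of_nat_Suc of_nat_eq_0_iff old.nat.distinct(2) power_not_zero)
    qed
  qed
  thus ?thesis by (simp add: fps_eq_iff)
qed

text \<open>Both sides have constant term 1 and solve one third-order equation: on the left it is
  the symmetric square of the equation of \<open>w\<close>, on the right the pullback of the
  equation of \<open>v\<close>. They match because \<open>P = X - 27 X^2\<close> satisfies
  \<open>P'^2 = 1 - 108 P\<close>, which absorbs the singularity of the latter at
  \<open>1/108\<close>.\<close>

lemma clausen_fps:
  fixes w v :: "rat fps"
  defines "w \<equiv> Abs_fps (\<lambda>i. of_nat (hasse_coeff i))"
  defines "v \<equiv> Abs_fps (\<lambda>i. of_nat (clausen_coeff i))"
  shows "w ^ 2 = v oo (fps_X - 27 * fps_X ^ 2)"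
proof -
  define P :: "rat fps" where "P = fps_X - 27 * fps_X ^ 2"
  define P' :: "rat fps" where "P' = 1 - 54 * fps_X"
  have P0: "P $ 0 = 0" by (simp add: P_def)
  have P27: "P' ^ 2 = 1 - 108 * P"
    by (simp add: P_def P'_def power2_eq_square algebra_simps)
  have dP: "fps_deriv P = P'"
    by (simp add: P_def P'_def fps_deriv_power)
  have dP': "fps_deriv P' = - 54"
    by (simp add: P'_def)
  define w1 where "w1 = fps_deriv w"
  define w2 where "w2 = fps_deriv w1"
  define w3 where "w3 = fps_deriv w2"
  have W1: "fps_deriv (w ^ 2) = 2 * w * w1"
    by (simp add: w1_def power2_eq_square)
  have W2: "fps_deriv (fps_deriv (w ^ 2)) = 2 * w1 ^ 2 + 2 * w * w2"
    unfolding W1 by (simp add: w1_def w2_def power2_eq_square algebra_simps)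
  have W3: "fps_deriv (fps_deriv (fps_deriv (w ^ 2))) = 6 * w1 * w2 + 2 * w * w3"
    unfolding W2 by (simp add: w1_def w2_def w3_def power2_eq_square algebra_simps)
  have o2: "P * w2 + P' * w1 = 6 * w"
    using hasse_fps_ode unfolding w1_def w2_def P_def P'_def w_def .
  have o3: "P * w3 + 2 * P' * w2 - 60 * w1 = 0"
    using arg_cong[OF o2, of fps_deriv]
    by (simp add: dP dP' flip: w1_def w2_def w3_def) (simp add: algebra_simps)
  \<comment> \<open>A combination of the equation of \<open>w\<close>, its derivative, and
    \<open>P'^2 = 1 - 108 P\<close>.\<close>
  have L1: "P ^ 2 * (6 * w1 * w2 + 2 * w * w3) + 3 * P * P' * (2 * w1 ^ 2 + 2 * w * w2)
      + (1 - 186 * P) * (2 * w * w1) - 12 * P' * w ^ 2 = 0"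
  proof -
    have "P ^ 2 * (6 * w1 * w2 + 2 * w * w3) + 3 * P * P' * (2 * w1 ^ 2 + 2 * w * w2)
        + (1 - 186 * P) * (2 * w * w1) - 12 * P' * w ^ 2
      = 2 * P * w * (P * w3 + 2 * P' * w2 - 60 * w1) + (6 * P * w1 + 2 * P' * w) * (P * w2 + P' * w1 - 6 * w)
        - 2 * w * w1 * (P' ^ 2 - (1 - 108 * P))"
      by (simp add: algebra_simps power2_eq_square)
    thus ?thesis unfolding o3 o2 P27 by simp
  qed
  define v0 where "v0 = v oo P"
  define v1 where "v1 = fps_deriv v oo P"
  define v2 where "v2 = fps_deriv (fps_deriv v) oo P"
  define v3 where "v3 = fps_deriv (fps_deriv (fps_deriv v)) oo P"
  have V1: "fps_deriv v0 = P' * v1"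
    by (simp add: v0_def v1_def fps_compose_deriv[OF P0] dP)
  have V2: "fps_deriv (fps_deriv v0) = - 54 * v1 + P' ^ 2 * v2"
    unfolding V1 by (simp add: v1_def v2_def fps_compose_deriv[OF P0] dP dP' power2_eq_square algebra_simps)
  have V3: "fps_deriv (fps_deriv (fps_deriv v0)) = - 162 * P' * v2 + P' ^ 3 * v3"
    unfolding V2 by (simp add: v1_def v2_def v3_def fps_compose_deriv[OF P0] dP dP' power2_eq_square
        power3_eq_cube algebra_simps)
  have XP: "fps_X oo P = P" by (simp add: P0)
  have "((fps_X ^ 2 - 108 * fps_X ^ 3) * fps_deriv (fps_deriv (fps_deriv v))
    + (3 * fps_X - 486 * fps_X ^ 2) * fps_deriv (fps_deriv v) + (1 - 348 * fps_X) * fps_deriv v - 12 * v) oo P = 0 oo P"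
    using clausen_fps_ode unfolding v_def by (rule arg_cong)
  hence "(P ^ 2 - 108 * P ^ 3) * v3 + (3 * P - 486 * P ^ 2) * v2 + (1 - 348 * P) * v1 - 12 * v0 = 0"
    by (simp add: fps_compose_add_distrib fps_compose_sub_distrib fps_compose_mult_distrib[OF P0]
        fps_compose_power[OF P0, symmetric] XP numeral_fps_const flip: v0_def v1_def v2_def v3_def)
  note o4 = this
  have L2: "P ^ 2 * (- 162 * P' * v2 + P' ^ 3 * v3) + 3 * P * P' * (- 54 * v1 + P' ^ 2 * v2)
      + (1 - 186 * P) * (P' * v1) - 12 * P' * v0 = 0"
  proof -
    have "P ^ 2 * (- 162 * P' * v2 + P' ^ 3 * v3) + 3 * P * P' * (- 54 * v1 + P' ^ 2 * v2)
        + (1 - 186 * P) * (P' * v1) - 12 * P' * v0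
      = P' * ((P ^ 2 - 108 * P ^ 3) * v3 + (3 * P - 486 * P ^ 2) * v2 + (1 - 348 * P) * v1 - 12 * v0)
        + (P ^ 2 * P' * v3 + 3 * P * P' * v2) * (P' ^ 2 - (1 - 108 * P))"
      by (simp add: algebra_simps power2_eq_square power3_eq_cube)
    thus ?thesis unfolding o4 P27 by simp
  qed
  define D where "D = w ^ 2 - v0"
  have main: "P ^ 2 * fps_deriv (fps_deriv (fps_deriv D)) + 3 * P * P' * fps_deriv (fps_deriv D)
      + (1 - 186 * P) * fps_deriv D - 12 * P' * D = 0"
  proof -
    have "P ^ 2 * fps_deriv (fps_deriv (fps_deriv D)) + 3 * P * P' * fps_deriv (fps_deriv D)
      + (1 - 186 * P) * fps_deriv D - 12 * P' * D
      = (P ^ 2 * (6 * w1 * w2 + 2 * w * w3) + 3 * P * P' * (2 * w1 ^ 2 + 2 * w * w2)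
        + (1 - 186 * P) * (2 * w * w1) - 12 * P' * w ^ 2)
       - (P ^ 2 * (- 162 * P' * v2 + P' ^ 3 * v3) + 3 * P * P' * (- 54 * v1 + P' ^ 2 * v2)
        + (1 - 186 * P) * (P' * v1) - 12 * P' * v0)"
    proof -
      have d1: "fps_deriv D = fps_deriv (w ^ 2) - fps_deriv v0"
        and d2: "fps_deriv (fps_deriv D) = fps_deriv (fps_deriv (w ^ 2)) - fps_deriv (fps_deriv v0)"
        and d3: "fps_deriv (fps_deriv (fps_deriv D))
          = fps_deriv (fps_deriv (fps_deriv (w ^ 2))) - fps_deriv (fps_deriv (fps_deriv v0))"
        by (simp_all only: D_def fps_deriv_sub)
      show ?thesis unfolding d3 unfolding d2 unfolding d1 unfolding W3 V3
        unfolding W2 V2 unfolding W1 V1 D_def by (simp add: algebra_simps)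
    qed
    thus ?thesis unfolding L1 L2 by simp
  qed
  have e1: "P ^ 2 = fps_X ^ 2 - 54 * fps_X ^ 3 + 729 * fps_X ^ 4"
    unfolding P_def by (simp add: algebra_simps power2_eq_square power3_eq_cube power4_eq_xxxx)
  have e2: "3 * P * P' = 3 * fps_X - 243 * fps_X ^ 2 + 4374 * fps_X ^ 3"
    unfolding P_def P'_def by (simp add: algebra_simps power2_eq_square power3_eq_cube power4_eq_xxxx)
  have e3: "1 - 186 * P = 1 - 186 * fps_X + 5022 * fps_X ^ 2"
    unfolding P_def by (simp add: algebra_simps power2_eq_square power3_eq_cube power4_eq_xxxx)
  have e4: "12 * P' = 12 - 648 * fps_X"
    unfolding P'_def by (simp add: algebra_simps power2_eq_square power3_eq_cube power4_eq_xxxx)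
  have D0: "D $ 0 = 0"
    by (simp add: D_def v0_def w_def v_def power2_eq_square hasse_coeff_def clausen_coeff_def)
  have "D = 0"
    using main D0 unfolding e1 e2 e3 e4 by (rule symmetric_square_unique)
  thus ?thesis by (simp add: D_def v0_def P_def)
qed

lemma of_int_coeff_power:
  "of_int (coeff ([:0, 1, - 27:] ^ k) n) = (coeff ([:0, 1, - 27:] ^ k) n :: 'a::comm_ring_1)"
proof (induction k arbitrary: n)
  case (Suc k)
  then show ?case by (simp add: coeff_pCons split: nat.split)
qed simp

lemma clausen_coeff_identity:
  "(\<Sum>i\<le>n. int (hasse_coeff i) * int (hasse_coeff (n - i)))
    = (\<Sum>k\<le>n. int (clausen_coeff k) * coeff ([:0, 1, - 27:] ^ k) n)"
proof -
  define P :: "rat fps" where "P = fps_X - 27 * fps_X ^ 2"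
  have P: "P = fps_of_poly [:0, 1, - 27:]"
    by (simp add: P_def fps_of_poly_pCons numeral_fps_const algebra_simps power2_eq_square)
  have c: "(P ^ k) $ n = of_int (coeff ([:0, 1, - 27:] ^ k) n)" for k
    unfolding P fps_of_poly_power[symmetric] by (simp add: of_int_coeff_power)
  have "of_int (\<Sum>i\<le>n. int (hasse_coeff i) * int (hasse_coeff (n - i)))
      = ((Abs_fps (\<lambda>i. of_nat (hasse_coeff i)) :: rat fps) ^ 2) $ n"
    by (simp add: power2_eq_square fps_mult_nth atLeast0AtMost)
  also have "\<dots> = of_int (\<Sum>k\<le>n. int (clausen_coeff k) * coeff ([:0, 1, - 27:] ^ k) n)"
    unfolding clausen_fps P_def[symmetric] by (simp add: fps_compose_nth atLeast0AtMost c)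
  finally show ?thesis unfolding of_int_eq_iff .
qed

lemma hasse_coeff_char:
  assumes "CHAR('k::field) = p" "prime p" "p \<le> 3 * i" "i < p"
  shows "(of_nat (hasse_coeff i) :: 'k) = 0"
proof -
  have "p dvd hasse_coeff i * fact i ^ 3"
    unfolding hasse_coeff_fact using assms by (simp add: prime_dvd_fact_iff)
  hence "p dvd hasse_coeff i"
    using assms by (simp add: prime_dvd_mult_iff prime_dvd_power_iff prime_dvd_fact_iff)
  thus ?thesis using assms by (simp add: of_nat_eq_0_iff_char_dvd)
qed

text \<open>Truncating a power series identity is legitimate here because
  \<open>hasse_coeff i\<close> vanishes in the field for \<open>p/3 \<le> i < p\<close>. Both sides
  are then polynomials in \<open>c\<close> of degree below \<open>p\<close>, and in that range their
  coefficients are those of the integral identity.\<close>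

lemma clausen_char:
  fixes c :: "'k::field"
  assumes "CHAR('k) = p" "prime p"
  shows "(\<Sum>i<p. of_nat (hasse_coeff i) * c ^ i) ^ 2 = (\<Sum>k<p. of_nat (clausen_coeff k) * (c - 27 * c ^ 2) ^ k)"
proof -
  define A :: "'k poly" where "A = (\<Sum>i<p. monom (of_nat (hasse_coeff i)) i)"
  define Q :: "'k poly" where "Q = [:0, 1, - 27:]"
  define B :: "'k poly" where "B = (\<Sum>k<p. smult (of_nat (clausen_coeff k)) (Q ^ k))"
  have p: "p > 1" using assms prime_gt_1_nat by blast
  have cA: "coeff A i = (if i < p then of_nat (hasse_coeff i) else 0)" for i
    unfolding A_def by (simp add: coeff_sum if_distrib cong: if_cong)
  have dA: "degree A \<le> (p - 1) div 3"
  proof (rule degree_le, safe)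
    fix i assume "(p - 1) div 3 < i"
    hence "p \<le> 3 * i" by linarith
    thus "coeff A i = 0" using hasse_coeff_char[OF assms, of i] by (simp add: cA)
  qed
  have dA2: "degree (A ^ 2) < p"
    using dA degree_mult_le[of A A] p unfolding power2_eq_square by linarith
  have dB: "degree B < p"
  proof -
    have "degree B \<le> p - 1"
      unfolding B_def
    proof (rule degree_sum_le)
      fix k assume k: "k \<in> {..<p}"
      show "degree (smult (of_nat (clausen_coeff k)) (Q ^ k)) \<le> p - 1"
      proof (cases "p \<le> 3 * k")
        case True
        hence "(of_nat (clausen_coeff k) :: 'k) = 0"
          using hasse_coeff_char[OF assms, of k] k by (simp add: clausen_coeff_def)
        thus ?thesis by simp
      next
        case False
        have "degree (Q ^ k) \<le> degree Q * k" by (rule degree_power_le)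
        moreover have "degree Q \<le> 2" by (simp add: Q_def)
        ultimately have "degree (Q ^ k) \<le> 2 * k"
          by (meson le_trans mult_le_mono1)
        moreover have "degree (smult (of_nat (clausen_coeff k)) (Q ^ k)) \<le> degree (Q ^ k)"
          by (rule degree_smult_le)
        ultimately show ?thesis using False by linarith
      qed
    qed simp
    thus ?thesis using p by linarith
  qed
  have "A ^ 2 = B"
  proof (rule poly_eqI)
    fix n
    show "coeff (A ^ 2) n = coeff B n"
    proof (cases "n < p")
      case True
      have "coeff (A ^ 2) n = of_int (\<Sum>i\<le>n. int (hasse_coeff i) * int (hasse_coeff (n - i)))"
        using True by (simp add: power2_eq_square coeff_mult cA less_imp_diff_less)
      also have "\<dots> = (\<Sum>k\<le>n. of_nat (clausen_coeff k) * coeff (Q ^ k) n)"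
        unfolding clausen_coeff_identity by (simp add: of_int_coeff_power Q_def)
      also have "\<dots> = (\<Sum>k<p. of_nat (clausen_coeff k) * coeff (Q ^ k) n)"
      proof (rule sum.mono_neutral_left)
        show "\<forall>k\<in>{..<p} - {..n}. of_nat (clausen_coeff k) * coeff (Q ^ k) n = 0"
        proof
          fix k assume "k \<in> {..<p} - {..n}"
          hence k: "n < k" by simp
          have "Q = monom 1 1 * [:1, - 27:]" by (simp add: Q_def monom_altdef)
          hence "Q ^ k = monom 1 k * [:1, - 27:] ^ k"
            by (simp only: power_mult_distrib monom_power) simp
          thus "of_nat (clausen_coeff k) * coeff (Q ^ k) n = 0"
            using k by (simp add: coeff_monom_mult)
        qed
      qed (use True in auto)
      also have "\<dots> = coeff B n" by (simp add: B_def coeff_sum)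
      finally show ?thesis .
    next
      case False
      then show ?thesis using dA2 dB by (simp add: coeff_eq_0)
    qed
  qed
  hence "poly (A ^ 2) c = poly B c" by simp
  thus ?thesis
    by (simp add: A_def B_def Q_def poly_sum poly_monom poly_power algebra_simps power2_eq_square)
qed

section \<open>The sum as a squared Hasse invariant\<close>

lemma coeff_linear_power_choose:
  "coeff ([:a, b:] ^ n) i = of_nat (n choose i) * b ^ i * (a :: 'a::comm_ring_1) ^ (n - i)"
proof (cases "i \<le> n")
  case False
  hence "degree ([:a, b:] ^ n) < i"
    using degree_power_le[of "[:a, b:]" n] by (simp split: if_splits)
  thus ?thesis using False by (simp add: coeff_eq_0 binomial_eq_0)
qed (rule coeff_linear_poly_power)

lemma fermat_char:
  assumes "CHAR('k::field) = p" "prime p" "(of_int z :: 'k) \<noteq> 0"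
  shows "(of_int z :: 'k) ^ (p - 1) = 1"
proof -
  define y where "y = nat (z mod int p)"
  have "p > 0" using assms prime_gt_0_nat by blast
  hence "[int y = z] (mod int p)" by (simp add: y_def cong_def)
  hence y: "(of_int z :: 'k) = of_nat y"
    using of_int_eq_iff_cong_CHAR[of "int y" z, where ?'a = 'k] assms(1) by simp
  hence "\<not> p dvd y" using assms by (simp add: of_nat_eq_0_iff_char_dvd)
  hence "[y ^ (p - 1) = 1] (mod p)" using assms(2) by (intro fermat_theorem)
  hence "(of_nat (y ^ (p - 1)) :: 'k) = of_nat 1"
    using of_nat_eq_iff_cong_CHAR[where ?'a = 'k] assms(1) by blast
  thus ?thesis by (simp add: y)
qed

text \<open>The transformed sum is reversed by replacing \<open>k\<close> with \<open>m - k\<close>: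
  since \<open>2 (m - k) = p - 1 - 2 k\<close>, reflection then turns \<open>C(2 (m - k), k)\<close>
  into \<open>C(3 k, k)\<close> up to sign. The powers of \<open>-4\<close> combine to
  \<open>64^k\<close> because \<open>4^m = 2^(p - 1) = 1\<close>.\<close>

lemma apery_sum_clausen:
  assumes p: "CHAR('k::field) = p" "prime p" "p = 2 * m + 1"
  shows "(\<Sum>n<p. of_nat (2 * n choose n) * of_nat (apery2 n) / 4 ^ n)
    = (\<Sum>k<p. of_nat (clausen_coeff k) * (1 / 64 :: 'k) ^ k)"
proof -
  have two: "(2 :: 'k) \<noteq> 0"
    using field_char_of_nat_neq_0[OF p(1), of 2] prime_gt_1_nat[OF p(2)] p(3) by (cases "m = 0") auto
  hence four: "(4 :: 'k) \<noteq> 0" by (metis mult_2 mult_eq_0_iff numeral_Bit0)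
  have "(2 :: 'k) ^ (2 * m) = 1"
    using fermat_char[OF p(1,2), of 2] two p(3) by simp
  hence fm: "(4 :: 'k) ^ m = 1" by (simp add: power_mult)
  have "(\<Sum>n<p. of_nat (2 * n choose n) * of_nat (apery2 n) / (4 :: 'k) ^ n)
    = (\<Sum>n<p. (- 1) ^ n * of_nat (m choose n) * of_nat (apery2 n))"
  proof (intro sum.cong refl)
    fix n assume "n \<in> {..<p}"
    hence n: "n < p" by simp
    have "(- 4 :: 'k) ^ n = (- 1) ^ n * 4 ^ n" by (simp flip: power_mult_distrib)
    thus "of_nat (2 * n choose n) * of_nat (apery2 n) / (4 :: 'k) ^ n
      = (- 1) ^ n * of_nat (m choose n) * of_nat (apery2 n)"
      unfolding central_binomial_char[OF p(1,3) n] using four by simp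
  qed
  also have "\<dots> = (\<Sum>n\<le>m. (- 1) ^ n * of_nat (m choose n) * of_nat (apery2 n))"
    by (rule sum.mono_neutral_right) (use p(3) in \<open>auto simp: binomial_eq_0\<close>)
  also have "\<dots> = of_int (\<Sum>n\<le>m. int (m choose n) * ((- 1) ^ n * int (apery2 n)))"
    by (simp add: mult_ac)
  also have "\<dots> = (\<Sum>k\<le>m. (- 1) ^ m * (of_nat (m choose k) * of_nat (2 * k choose k) * of_nat (2 * k choose (m - k))))"
    unfolding apery_binomial_transform by (simp add: sum_distrib_left)
  also have "\<dots> = (\<Sum>k\<le>m. (- 1) ^ m * (of_nat (m choose k) * of_nat (2 * (m - k) choose (m - k)) * of_nat (2 * (m - k) choose k)))"
    by (rule sum.reindex_bij_witness[of _ "\<lambda>k. m - k" "\<lambda>k. m - k"]) (auto simp flip: binomial_symmetric)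
  also have "\<dots> = (\<Sum>k\<le>m. of_nat (clausen_coeff k) * (1 / 64) ^ k)"
  proof (intro sum.cong refl)
    fix k assume "k \<in> {..m}"
    hence k: "k \<le> m" by simp
    define M :: 'k where "M = of_nat (m choose k)"
    define T :: 'k where "T = of_nat (3 * k choose k)"
    have a: "of_nat (2 * k choose k) = (- 4) ^ k * M"
      unfolding M_def using k p(3) by (intro central_binomial_char[OF p(1,3)]) auto
    have b: "of_nat (2 * (m - k) choose (m - k)) = (- 4) ^ (m - k) * M"
      unfolding M_def binomial_symmetric[OF k]
      using k p(3) by (intro central_binomial_char[OF p(1,3)]) auto
    have "p - 1 - 2 * k = 2 * (m - k)" using p(3) k by simp
    hence c: "of_nat (2 * (m - k) choose k) = (- 1) ^ k * T"
      using binomial_reflect_char[OF p(1), of "2 * k" k] k p(3) unfolding T_def by simp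
    have "(- 4 :: 'k) ^ m = (- 1) ^ m"
      using power_mult_distrib[of "- 1 :: 'k" 4 m] fm by simp
    hence d: "(- 4 :: 'k) ^ (m - k) * (- 4) ^ k = (- 1) ^ m"
      using k by (simp flip: power_add)
    have e: "(- 4 :: 'k) ^ k * (- 4) ^ k * (- 4) ^ k * (- 1) ^ k = 64 ^ k"
      by (simp flip: power_mult_distrib)
    have s: "(- 1 :: 'k) ^ m * (- 1) ^ m = 1"
      by (simp flip: power_mult_distrib)
    have g: "(64 :: 'k) ^ k \<noteq> 0"
    proof -
      have "(64 :: 'k) = 4 * 4 * 4" by simp
      thus ?thesis using four by (metis mult_eq_0_iff power_not_zero)
    qed
    have "((- 1) ^ m * (M * ((- 4) ^ (m - k) * M) * ((- 1) ^ k * T))) * 64 ^ k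
      = (- 1) ^ m * ((- 4) ^ (m - k) * (- 4) ^ k) * ((- 1) ^ k * (- 1) ^ k) * (((- 4) ^ k * M) * ((- 4) ^ k * M) * T)"
      unfolding e[symmetric] by (simp only: mult_ac)
    also have "\<dots> = ((- 4) ^ k * M) * ((- 4) ^ k * M) * T"
      unfolding d s by (simp flip: power_mult_distrib)
    also have "\<dots> = of_nat (clausen_coeff k)"
      unfolding a[symmetric] T_def clausen_coeff_def hasse_coeff_def by (simp add: mult_ac)
    finally have "((- 1) ^ m * (M * ((- 4) ^ (m - k) * M) * ((- 1) ^ k * T))) = of_nat (clausen_coeff k) / 64 ^ k"
      using g by (simp add: field_simps)
    thus "(- 1) ^ m * (of_nat (m choose k) * of_nat (2 * (m - k) choose (m - k)) * of_nat (2 * (m - k) choose k))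
      = of_nat (clausen_coeff k) * (1 / 64 :: 'k) ^ k"
      unfolding b c M_def[symmetric] by (simp add: power_divide)
  qed
  also have "\<dots> = (\<Sum>k<p. of_nat (clausen_coeff k) * (1 / 64) ^ k)"
  proof (rule sum.mono_neutral_left)
    show "\<forall>k\<in>{..<p} - {..m}. of_nat (clausen_coeff k) * (1 / 64 :: 'k) ^ k = 0"
      using hasse_coeff_char[OF p(1,2)] p(3) by (auto simp: clausen_coeff_def)
  qed (use p(3) in auto)
  finally show ?thesis .
qed

text \<open>The coefficient of \<open>X^(p - 1)\<close> in \<open>f^((p - 1) / 2)\<close> is the
  Hasse invariant of \<open>y^2 = f(X)\<close>. Here \<open>f = 4 X^3 + (X + c)^2\<close> is raised
  to the power \<open>m\<close> by the binomial theorem in these two summands.\<close>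

lemma hasse_coeff_poly:
  fixes c :: "'k::field"
  assumes p: "CHAR('k::field) = p" "prime p" "p = 2 * m + 1"
  shows "coeff ([:c ^ 2, 2 * c, 1, 4:] ^ m) (p - 1) = (\<Sum>i<p. of_nat (hasse_coeff i) * c ^ i)"
proof -
  have "[:c ^ 2, 2 * c, 1, 4:] = monom 4 3 + [:c, 1:] ^ 2"
    by (simp add: monom_altdef power2_eq_square eval_nat_numeral)
  hence "[:c ^ 2, 2 * c, 1, 4:] ^ m = (\<Sum>j\<le>m. of_nat (m choose j) * monom 4 3 ^ j * ([:c, 1:] ^ 2) ^ (m - j))"
    by (simp only: binomial_ring)
  also have "\<dots> = (\<Sum>j\<le>m. smult (of_nat (m choose j)) (monom (4 ^ j) (3 * j) * [:c, 1:] ^ (2 * (m - j))))"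
    by (intro sum.cong refl) (simp add: monom_power power_mult of_nat_poly mult.assoc)
  finally have "coeff ([:c ^ 2, 2 * c, 1, 4:] ^ m) (p - 1)
     = (\<Sum>j\<le>m. of_nat (m choose j) * coeff (monom (4 ^ j) (3 * j) * [:c, 1:] ^ (2 * (m - j))) (2 * m))"
    using p(3) by (simp add: coeff_sum)
  also have "\<dots> = (\<Sum>j\<le>m. of_nat (hasse_coeff j) * c ^ j)"
  proof (intro sum.cong refl)
    fix j assume "j \<in> {..m}"
    hence j: "j \<le> m" by simp
    have "coeff (monom (4 ^ j) (3 * j) * [:c, 1:] ^ (2 * (m - j))) (2 * m) = 4 ^ j * (of_nat (2 * (m - j) choose j) * c ^ j)"
    proof (cases "3 * j \<le> 2 * m")
      case True
      have "2 * (m - j) choose (2 * m - 3 * j) = 2 * (m - j) choose j"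
        using True j binomial_symmetric[of j "2 * (m - j)"] by (simp add: diff_mult_distrib2 algebra_simps)
      moreover have "2 * (m - j) - (2 * m - 3 * j) = j" using True j by simp
      ultimately show ?thesis using True by (simp add: coeff_monom_mult coeff_linear_power_choose)
    next
      case False
      then show ?thesis by (simp add: coeff_monom_mult binomial_eq_0)
    qed
    moreover have "p - 1 - 2 * j = 2 * (m - j)" using p(3) j by simp
    hence "(of_nat (2 * (m - j) choose j) :: 'k) = (- 1) ^ j * of_nat (3 * j choose j)"
      using binomial_reflect_char[OF p(1), of "2 * j" j] j p(3) by simp
    moreover have "(of_nat (2 * j choose j) :: 'k) = (4 ^ j * (- 1) ^ j) * of_nat (m choose j)"
      using central_binomial_char[OF p(1,3), of j] j p(3) by (simp flip: power_mult_distrib)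
    ultimately show "of_nat (m choose j) * coeff (monom (4 ^ j) (3 * j) * [:c, 1:] ^ (2 * (m - j))) (2 * m)
      = of_nat (hasse_coeff j) * c ^ j"
      by (simp add: hasse_coeff_def)
  qed
  also have "\<dots> = (\<Sum>j<p. of_nat (hasse_coeff j) * c ^ j)"
  proof (rule sum.mono_neutral_left)
    show "\<forall>k\<in>{..<p} - {..m}. of_nat (hasse_coeff k) * c ^ k = 0"
      using hasse_coeff_char[OF p(1,2)] p(3) by auto
  qed (use p(3) in auto)
  finally show ?thesis .
qed

section \<open>Hasse invariants under a change of model\<close>

lemma choose_char_0:
  assumes p: "CHAR('k::field) = p" "prime p" "p \<le> i" "i < 2 * p - 1"
  shows "(of_nat (i choose (p - 1)) :: 'k) = 0"
proof -
  have "fact (p - 1) * fact (i - (p - 1)) * (i choose (p - 1)) = fact i"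
    by (rule binomial_fact_lemma) (use p(3) in simp)
  moreover have "p dvd fact i" using p by (simp add: prime_dvd_fact_iff)
  ultimately have "p dvd fact (p - 1) * fact (i - (p - 1)) * (i choose (p - 1))" by simp
  hence "p dvd (i choose (p - 1))"
    using p(3,4) prime_gt_0_nat[OF p(2)] by (auto simp: prime_dvd_mult_iff[OF p(2)] prime_dvd_fact_iff[OF p(2)])
  thus ?thesis using p(1) by (simp add: of_nat_eq_0_iff_char_dvd)
qed

lemma pcompose_monom_power: "pcompose (monom a i) q = smult a (q ^ i)" for a :: "'k::field"
  by (induction i arbitrary: a) (simp_all add: monom_0 pcompose_const monom_Suc pcompose_pCons)

text \<open>Among the powers of a linear polynomial up to exponent \<open>2 p - 2\<close>, only the
  one with exponent \<open>p - 1\<close> can have a nonzero coefficient at \<open>p - 1\<close>. An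
  affine substitution therefore only scales a Hasse invariant.\<close>

lemma coeff_pcompose_linear:
  fixes g :: "'k::field poly"
  assumes p: "CHAR('k) = p" "prime p" "degree g < 2 * p - 1"
  shows "coeff (pcompose g [:r, q:]) (p - 1) = q ^ (p - 1) * coeff g (p - 1)"
proof -
  have "pcompose g [:r, q:] = pcompose (\<Sum>i\<le>degree g. monom (coeff g i) i) [:r, q:]"
    by (simp only: poly_as_sum_of_monoms)
  also have "\<dots> = (\<Sum>i\<le>degree g. smult (coeff g i) ([:r, q:] ^ i))"
    by (simp add: pcompose_sum pcompose_monom_power)
  finally have "coeff (pcompose g [:r, q:]) (p - 1)
    = (\<Sum>i\<le>degree g. coeff g i * coeff ([:r, q:] ^ i) (p - 1))"
    by (simp add: coeff_sum)
  also have "\<dots> = (\<Sum>i\<le>degree g. if i = p - 1 then q ^ (p - 1) * coeff g (p - 1) else 0)"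
  proof (intro sum.cong refl)
    fix i assume "i \<in> {..degree g}"
    hence i: "i < 2 * p - 1" using p(3) by simp
    consider "i < p - 1" | "i = p - 1" | "p \<le> i" by linarith
    thus "coeff g i * coeff ([:r, q:] ^ i) (p - 1) = (if i = p - 1 then q ^ (p - 1) * coeff g (p - 1) else 0)"
      by cases (use i choose_char_0[OF p(1,2), of i] in \<open>auto simp: coeff_linear_power_choose binomial_eq_0\<close>)
  qed
  also have "\<dots> = q ^ (p - 1) * coeff g (p - 1)"
    by (auto simp: coeff_eq_0)
  finally show ?thesis .
qed

lemma numeral_char_neq_0:
  assumes "CHAR('k::field) = p" "prime p" "p \<notin> {2, 3, 11}"
  shows "(2 :: 'k) \<noteq> 0" "(3 :: 'k) \<noteq> 0" "(11 :: 'k) \<noteq> 0"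
proof -
  have "(of_nat q :: 'k) \<noteq> 0" if "prime q" "q \<in> {2, 3, 11}" for q
    using that assms primes_dvd_imp_eq[of p q] by (auto simp: of_nat_eq_0_iff_char_dvd)
  from this[of 2] this[of 3] this[of 11] show "(2 :: 'k) \<noteq> 0" "(3 :: 'k) \<noteq> 0" "(11 :: 'k) \<noteq> 0"
    by simp_all
qed

text \<open>A model with \<open>j = -2^15\<close>, the \<open>j\<close>-invariant belonging to the
  ring of integers of discriminant -11.\<close>

definition cm_cubic :: "'k::comm_ring_1 poly" where
  "cm_cubic = [:1694, - 264, 0, 1:]"

lemma apery_sum_hasse:
  fixes s :: "'k::field"
  assumes p: "CHAR('k) = p" "prime p" "p = 2 * m + 1" "p \<notin> {2, 3, 11}" and s: "s ^ 2 = - 11"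
  shows "(\<Sum>n<p. of_nat (2 * n choose n) * of_nat (apery2 n) / 4 ^ n)
    = (- s * (1 + s) / 1584) ^ (p - 1) * (coeff (cm_cubic ^ m) (p - 1)) ^ 2"
proof -
  note nz = numeral_char_neq_0[OF p(1,2,4)]
  have "(216 :: 'k) = 2 ^ 3 * 3 ^ 3" "(1584 :: 'k) = 2 ^ 4 * 3 ^ 2 * 11" "(64 :: 'k) = 2 ^ 6"
    "(12 :: 'k) = 2 ^ 2 * 3" "(144 :: 'k) = 2 ^ 4 * 3 ^ 2" "(20736 :: 'k) = 2 ^ 8 * 3 ^ 4" "(1728 :: 'k) = 2 ^ 6 * 3 ^ 3" "(114048 :: 'k) = 2 ^ 7 * 3 ^ 4 * 11" by simp_all
  hence nz': "(216 :: 'k) \<noteq> 0" "(1584 :: 'k) \<noteq> 0" "(64 :: 'k) \<noteq> 0" "(12 :: 'k) \<noteq> 0" "(144 :: 'k) \<noteq> 0" "(20736 :: 'k) \<noteq> 0" "(1728 :: 'k) \<noteq> 0" "(114048 :: 'k) \<noteq> 0"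
    using nz by (metis mult_eq_0_iff power_not_zero)+
  \<comment> \<open>A root of \<open>27 c^2 - c + 1/64\<close>, whose discriminant is
    \<open>-11/16\<close>.\<close>
  define c where "c = (4 + s) / 216"
  \<comment> \<open>The twist between the two models: \<open>x = (X + 1/12) / d\<close> removes the
    quadratic term of \<open>4 X^3 + (X + c)^2\<close>, and \<open>d\<close> is found by matching
    the other coefficients with -264 and 1694.\<close>
  define d where "d = - s * (1 + s) / 1584"
  have ss: "s * s = - 11" using s by (simp add: power2_eq_square)
  have ss': "s * (s * z) = - 11 * z" for z unfolding mult.assoc[symmetric] ss ..
  have c216: "216 * c = 4 + s" using nz' by (simp add: c_def)
  have "(216 * 216 * 64) * (c - 27 * c ^ 2) = 64 * 216 * (216 * c) - 64 * 27 * (216 * c) ^ 2"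
    by (simp add: algebra_simps power2_eq_square)
  also have "\<dots> = 216 * 216" unfolding c216 by (simp add: algebra_simps power2_eq_square ss)
  finally have "(216 * 216) * (64 * (c - 27 * c ^ 2)) = (216 * 216) * 1" by (simp only: mult.assoc mult_1_right)
  hence "64 * (c - 27 * c ^ 2) = 1" using nz' by (simp only: mult_cancel_left mult_eq_0_iff) auto
  hence c: "c - 27 * c ^ 2 = 1 / 64"
    using nz' by (simp only: nonzero_eq_divide_eq[OF nz'(3)] mult.commute)
  have cancel: "y = z" if "x * y = x * z" "x \<noteq> 0" for x y z :: 'k
    using that by simp
  have d1584: "1584 * d = - s * (1 + s)" using nz' by (simp add: d_def)
  have d0: "d \<noteq> 0"
  proof
    assume "d = 0"
    hence "s * (1 + s) = 0" using d1584 by simp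
    moreover have "s \<noteq> 0" using ss nz by auto
    ultimately have "s = - 1" by (simp add: add_eq_0_iff)
    hence "(12 :: 'k) = 0" using ss by simp
    thus False using nz' by simp
  qed
  have "1584 * 1584 * (114048 * d ^ 2) = 114048 * (1584 * d) ^ 2"
    by (simp add: power2_eq_square)
  also have "\<dots> = 1584 * 1584 * (5 - s)"
    unfolding d1584 by (simp add: algebra_simps power2_eq_square ss ss')
  finally have d2: "114048 * d ^ 2 = 5 - s"
    by (rule cancel) (use nz' in \<open>simp only: mult_eq_0_iff; simp\<close>)
  have "1584 * (114048 * d ^ 3) = (1584 * d) * (114048 * d ^ 2)"
    by (simp add: power2_eq_square power3_eq_cube)
  also have "\<dots> = 44 - 16 * s"
    unfolding d1584 d2 by (simp add: algebra_simps ss ss')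
  finally have d3: "1584 * (114048 * d ^ 3) = 44 - 16 * s" .
  have f1: "2 * c = 1 / 12 - 1056 * d ^ 2"
  proof -
    have "114048 * 216 * (2 * c) = 114048 * 216 * (1 / 12 - 1056 * d ^ 2)"
    proof -
      have "114048 * 216 * (1 / 12 - 1056 * d ^ 2) = 114048 * 18 * (12 * (1 / 12)) - 1056 * 216 * (114048 * d ^ 2)"
        by (simp add: algebra_simps)
      also have "\<dots> = 228096 * (216 * c)" unfolding c216 d2 using nz' by (simp add: algebra_simps)
      finally show ?thesis by simp
    qed
    thus ?thesis
      by (rule cancel) (use nz' in \<open>simp only: mult_eq_0_iff; simp\<close>)
  qed
  have nz432: "(432 :: 'k) \<noteq> 0"
  proof -
    have "(432 :: 'k) = 2 * 216" by simp
    thus ?thesis using nz nz' by (metis mult_eq_0_iff)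
  qed
  have f0: "c ^ 2 = 1 / 432 - 88 * d ^ 2 + 6776 * d ^ 3"
  proof -
    define w :: 'k where "w = 1 / 432"
    have w: "432 * w = 1" using nz432 by (simp add: w_def)
    have "1584 * 114048 * 216 * 216 * (w - 88 * d ^ 2 + 6776 * d ^ 3)
      = 1584 * 114048 * 108 * (432 * w) - 88 * 1584 * 216 * 216 * (114048 * d ^ 2) + 6776 * 216 * 216 * (1584 * (114048 * d ^ 3))"
      by (simp add: algebra_simps)
    also have "\<dots> = 1584 * 114048 * (216 * c) ^ 2"
      unfolding c216 d2 d3 w by (simp add: algebra_simps power2_eq_square ss)
    also have "\<dots> = 1584 * 114048 * 216 * 216 * c ^ 2"
      by (simp add: power2_eq_square)
    finally have "1584 * 114048 * 216 * 216 * c ^ 2 = 1584 * 114048 * 216 * 216 * (w - 88 * d ^ 2 + 6776 * d ^ 3)"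
      by (rule sym)
    thus ?thesis unfolding w_def
      by (rule cancel) (use nz' in \<open>simp only: mult_eq_0_iff; simp\<close>)
  qed
  have f: "[:c ^ 2, 2 * c, 1, 4:] = smult (4 * d ^ 3) (pcompose cm_cubic [:1 / (12 * d), 1 / d:])"
    unfolding f0 f1 using d0 nz nz' nz432
    by (simp add: cm_cubic_def pcompose_pCons field_simps power2_eq_square power3_eq_cube)
  have deg: "degree (cm_cubic ^ m :: 'k poly) < 2 * p - 1"
    using p(3) degree_power_le[of "cm_cubic :: 'k poly" m] by (simp add: cm_cubic_def)
  have "[:c ^ 2, 2 * c, 1, 4:] ^ m = smult ((4 * d ^ 3) ^ m) (pcompose (cm_cubic ^ m) [:1 / (12 * d), 1 / d:])"
  proof -
    have "pcompose (q ^ i) r = pcompose q r ^ i" for q r :: "'k poly" and i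
      by (induction i) (simp_all add: pcompose_mult pcompose_1)
    thus ?thesis unfolding f by (simp add: smult_power)
  qed
  hence "(\<Sum>i<p. of_nat (hasse_coeff i) * c ^ i) = (4 * d ^ 3) ^ m * ((1 / d) ^ (p - 1) * coeff (cm_cubic ^ m) (p - 1))"
    using hasse_coeff_poly[OF p(1-3), of c] coeff_pcompose_linear[OF p(1,2) deg] by simp
  hence "(\<Sum>i<p. of_nat (hasse_coeff i) * c ^ i) ^ 2
      = ((4 * d ^ 3) ^ m * (1 / d) ^ (p - 1)) ^ 2 * coeff (cm_cubic ^ m) (p - 1) ^ 2"
    by (simp add: power_mult_distrib)
  \<comment> \<open>All scalings collapse to \<open>d^(p - 1)\<close>, which is 1 as soon as
    \<open>d\<close> lies in the prime field.\<close>
  also have "((4 * d ^ 3) ^ m * (1 / d) ^ (p - 1)) ^ 2 = d ^ (p - 1)"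
  proof -
    have "(4 :: 'k) ^ (p - 1) = 2 ^ (p - 1) * 2 ^ (p - 1)" by (simp flip: power_mult_distrib)
    also have "\<dots> = 1" using fermat_char[OF p(1,2), of 2] nz by simp
    finally have "(4 :: 'k) ^ (p - 1) = 1" .
    hence "((4 * d ^ 3) ^ m) ^ 2 = d ^ (3 * (p - 1))"
      using p(3) by (simp add: power_mult_distrib flip: power_mult) (simp add: mult.commute)
    thus ?thesis using d0 p(3)
      by (simp add: power_mult_distrib power_divide flip: power_mult) (simp add: field_simps flip: power_add)
  qed
  finally show ?thesis
    unfolding apery_sum_clausen[OF p(1-3)] clausen_char[OF p(1,2), of c, unfolded c] d_def .
qed

section \<open>Heights on the Kummer line\<close>

text \<open>At a root of \<open>D\<close> one of \<open>S\<close>, \<open>G\<close> is nonzero, so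
  the equations make it a root of \<open>X\<close>; the linear factor cancels and the degree of
  \<open>D\<close> drops. Used in both directions, this shows that two proportional triples without
  a common root differ by a unit.\<close>

lemma common_factor_dvd:
  fixes D S G X Y Z :: "'k::alg_closed_field poly"
  assumes "D \<noteq> 0" and "\<And>r. poly D r \<noteq> 0 \<or> poly S r \<noteq> 0 \<or> poly G r \<noteq> 0"
    and "D * Y = S * X" "D * Z = G * X"
  shows "D dvd X"
  using assms
proof (induction "degree D" arbitrary: D X)
  case 0
  then show ?case by (metis is_unit_iff_degree dvd_trans one_dvd)
next
  case (Suc n)
  then obtain r where r: "poly D r = 0"
    using alg_closed_imp_poly_has_root[of D] by auto
  have "poly S r * poly X r = 0" "poly G r * poly X r = 0"
    using r arg_cong[OF Suc.prems(3), of "\<lambda>q. poly q r"] arg_cong[OF Suc.prems(4), of "\<lambda>q. poly q r"] by simp_all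
  hence "poly X r = 0" using Suc.prems(2)[of r] r by auto
  with r obtain D' X' where D': "D = [:- r, 1:] * D'" and X': "X = [:- r, 1:] * X'"
    by (metis dvdE poly_eq_0_iff_dvd)
  have l: "[:- r, 1:] \<noteq> (0 :: 'k poly)" by simp
  have "[:- r, 1:] * (D' * Y) = [:- r, 1:] * (S * X')" "[:- r, 1:] * (D' * Z) = [:- r, 1:] * (G * X')"
    using Suc.prems(3,4) unfolding D' X' by (simp_all only: mult_ac)
  hence "D' * Y = S * X'" "D' * Z = G * X'" using l mult_left_cancel by blast+
  moreover have "D' \<noteq> 0" using Suc.prems(1) D' by auto
  moreover have "n = degree D'"
    using Suc.hyps(2) \<open>D' \<noteq> 0\<close> unfolding D' by (subst (asm) degree_mult_eq) auto
  moreover have "poly D' q \<noteq> 0 \<or> poly S q \<noteq> 0 \<or> poly G q \<noteq> 0" for q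
    using Suc.prems(2)[of q] unfolding D' by auto
  ultimately have "D' dvd X'" using Suc.hyps(1) by blast
  thus ?case unfolding D' X' by (rule mult_dvd_mono[OF dvd_refl])
qed

definition no_common_root :: "'k::comm_ring_1 poly \<Rightarrow> 'k poly \<Rightarrow> bool" where
  "no_common_root u v \<longleftrightarrow> (\<forall>r. poly u r \<noteq> 0 \<or> poly v r \<noteq> 0)"

lemma ex_lowest_terms:
  fixes a b :: "'k::field poly"
  assumes "b \<noteq> 0"
  shows "\<exists>u v. v \<noteq> 0 \<and> no_common_root u v \<and> a * v = u * b"
  using assms
proof (induction "degree b" arbitrary: a b rule: less_induct)
  case less
  show ?case
  proof (cases "no_common_root a b")
    case True
    then show ?thesis using less.prems by auto
  next
    case False
    then obtain r where "poly a r = 0" "poly b r = 0" by (auto simp: no_common_root_def)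
    then obtain a' b' where a': "a = [:- r, 1:] * a'" and b': "b = [:- r, 1:] * b'"
      by (metis dvdE poly_eq_0_iff_dvd)
    have "b' \<noteq> 0" using less.prems b' by auto
    hence "degree b' < degree b" unfolding b' by (subst degree_mult_eq) auto
    from less.hyps[OF this \<open>b' \<noteq> 0\<close>, of a'] obtain u v
      where "v \<noteq> 0" "no_common_root u v" "a' * v = u * b'" by blast
    thus ?thesis unfolding a' b' by (metis mult.assoc mult.left_commute)
  qed
qed

text \<open>For points \<open>P\<^sub>1, P\<^sub>2\<close> of \<open>y\<^sup>2 = x\<^sup>3 + a x + b\<close> with \<open>x(P\<^sub>i) = u\<^sub>i / v\<^sub>i\<close>, the abscissae of
  \<open>P\<^sub>1 + P\<^sub>2\<close> and \<open>P\<^sub>1 - P\<^sub>2\<close> are the roots of \<open>D X\<^sup>2 - S X + G\<close>.\<close>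

definition kummer_D :: "'a::comm_ring_1 \<Rightarrow> 'a \<Rightarrow> 'a \<Rightarrow> 'a \<Rightarrow> 'a" where
  "kummer_D u1 v1 u2 v2 = (u1 * v2 - u2 * v1) ^ 2"

definition kummer_S :: "'a::comm_ring_1 \<Rightarrow> 'a \<Rightarrow> 'a \<Rightarrow> 'a \<Rightarrow> 'a \<Rightarrow> 'a \<Rightarrow> 'a" where
  "kummer_S a b u1 v1 u2 v2 = 2 * ((u1 * v2 + u2 * v1) * (u1 * u2 + a * (v1 * v2)) + 2 * b * (v1 * v2) ^ 2)"

definition kummer_G :: "'a::comm_ring_1 \<Rightarrow> 'a \<Rightarrow> 'a \<Rightarrow> 'a \<Rightarrow> 'a \<Rightarrow> 'a \<Rightarrow> 'a" where
  "kummer_G a b u1 v1 u2 v2 = (u1 * u2 - a * (v1 * v2)) ^ 2 - 4 * b * (v1 * v2) * (u1 * v2 + u2 * v1)"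

lemmas kummer_defs = kummer_D_def kummer_S_def kummer_G_def

text \<open>If all three forms vanish at finite points, then both abscissae equal some root
  \<open>x\<close> of \<open>x^3 + a x + b\<close>, and \<open>G\<close> gives a zero of
  \<open>(x^2 - a)^2 - 8 b x\<close>, the numerator of the duplication formula. An explicit
  combination of these two polynomials is the discriminant.\<close>

lemma kummer_base_point_free:
  fixes u1 :: "'k::field"
  assumes "u1 \<noteq> 0 \<or> v1 \<noteq> 0" "u2 \<noteq> 0 \<or> v2 \<noteq> 0" "4 * a ^ 3 + 27 * b ^ 2 \<noteq> 0" "(2 :: 'k) \<noteq> 0"
  shows "kummer_D u1 v1 u2 v2 \<noteq> 0 \<or> kummer_S a b u1 v1 u2 v2 \<noteq> 0 \<or> kummer_G a b u1 v1 u2 v2 \<noteq> 0"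
proof (rule ccontr)
  assume "\<not> ?thesis"
  hence D: "u1 * v2 = u2 * v1" and S: "kummer_S a b u1 v1 u2 v2 = 0" and G: "kummer_G a b u1 v1 u2 v2 = 0"
    by (simp_all add: kummer_D_def)
  show False
  proof (cases "v1 = 0")
    case True
    hence "v2 = 0" using D assms(1) by auto
    thus False using True assms G by (auto simp: kummer_G_def)
  next
    case False
    define x where "x = u1 / v1"
    have u1: "u1 = x * v1" using False by (simp add: x_def)
    hence u2: "u2 = x * v2" using D False by (simp add: mult.commute mult.left_commute)
    hence v2: "v2 \<noteq> 0" using assms(2) by auto
    have "kummer_S a b u1 v1 u2 v2 = 2 * 2 * (v1 ^ 2 * v2 ^ 2) * (x ^ 3 + a * x + b)"
      unfolding kummer_S_def u1 u2 by (simp add: algebra_simps power2_eq_square power3_eq_cube)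
    moreover have "2 * 2 * (v1 ^ 2 * v2 ^ 2) \<noteq> 0"
      using False v2 assms(4) by (metis mult_eq_0_iff power_not_zero)
    ultimately have f: "x ^ 3 + a * x + b = 0" using S by (metis mult_eq_0_iff)
    have "kummer_G a b u1 v1 u2 v2 = (v1 ^ 2 * v2 ^ 2) * ((x ^ 2 - a) ^ 2 - 8 * b * x)"
      unfolding kummer_G_def u1 u2 by (simp add: algebra_simps power2_eq_square)
    hence q: "(x ^ 2 - a) ^ 2 - 8 * b * x = 0" using G False v2 by simp
    have "4 * a ^ 3 + 27 * b ^ 2 = (3 * x ^ 2 + 4 * a) * ((x ^ 2 - a) ^ 2 - 8 * b * x)
        - (3 * x ^ 3 - 5 * a * x - 27 * b) * (x ^ 3 + a * x + b)"
      by (simp add: algebra_simps power2_eq_square power3_eq_cube)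
    thus False using f q assms(3) by simp
  qed
qed

text \<open>Controls the forms at infinity, where absence of common roots says nothing: as both
  abscissae have a pole there, \<open>(u1 u2)^2\<close> dominates.\<close>

lemma kummer_degrees:
  fixes u1 :: "'k::field poly"
  assumes "degree v1 < degree u1" "degree v2 < degree u2"
  shows "degree (kummer_G [:a:] [:b:] u1 v1 u2 v2) = 2 * (degree u1 + degree u2)"
    and "degree (kummer_S [:a:] [:b:] u1 v1 u2 v2) < 2 * (degree u1 + degree u2)"
proof -
  define d where "d = degree u1 + degree u2"
  have nz: "u1 \<noteq> 0" "u2 \<noteq> 0" using assms by auto
  have uu: "degree (u1 * u2) = d" unfolding d_def using nz by (rule degree_mult_eq)
  have vv: "degree (v1 * v2) < d"
    using degree_mult_le[of v1 v2] assms unfolding d_def by linarith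
  have cst: "degree ([:c:] * q) \<le> degree q" for c :: 'k and q :: "'k poly"
    by (simp add: degree_smult_le)
  have avv: "degree ([:a:] * (v1 * v2)) < d" using cst[of a "v1 * v2"] vv by linarith
  have w1: "degree (u1 * u2 - [:a:] * (v1 * v2)) = d" "degree (u1 * u2 + [:a:] * (v1 * v2)) = d"
    using avv uu degree_add_eq_left[of "[:a:] * (v1 * v2)" "u1 * u2"]
      degree_add_eq_left[of "- ([:a:] * (v1 * v2))" "u1 * u2"] by simp_all
  hence nz1: "u1 * u2 - [:a:] * (v1 * v2) \<noteq> 0" using assms unfolding d_def by auto
  have uv: "degree (u1 * v2 + u2 * v1) < d"
    using degree_mult_le[of u1 v2] degree_mult_le[of u2 v1] assms unfolding d_def
    by (intro degree_add_less) linarith+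
  have sq: "degree ((u1 * u2 - [:a:] * (v1 * v2)) ^ 2) = 2 * d"
    using w1 nz1 by (simp add: degree_power_eq)
  have "degree (4 * [:b:] * (v1 * v2) * (u1 * v2 + u2 * v1)) \<le> degree (4 * [:b:]) + degree (v1 * v2) + degree (u1 * v2 + u2 * v1)"
    by (meson add_le_mono1 degree_mult_le le_trans)
  moreover have "degree (4 * [:b:]) = 0" by (simp add: numeral_poly)
  ultimately have small: "degree (4 * [:b:] * (v1 * v2) * (u1 * v2 + u2 * v1)) < 2 * d"
    using vv uv by linarith
  show "degree (kummer_G [:a:] [:b:] u1 v1 u2 v2) = 2 * (degree u1 + degree u2)"
    unfolding kummer_G_def d_def[symmetric]
    using degree_add_eq_left[of "- (4 * [:b:] * (v1 * v2) * (u1 * v2 + u2 * v1))" "(u1 * u2 - [:a:] * (v1 * v2)) ^ 2"]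
      small sq by simp
  have "degree ((u1 * v2 + u2 * v1) * (u1 * u2 + [:a:] * (v1 * v2))) < 2 * d"
    using degree_mult_le[of "u1 * v2 + u2 * v1" "u1 * u2 + [:a:] * (v1 * v2)"] uv w1 by linarith
  moreover have "degree (2 * [:b:] * (v1 * v2) ^ 2) < 2 * d"
  proof -
    have "degree (2 * [:b:] * (v1 * v2) ^ 2) \<le> degree (2 * [:b:]) + degree ((v1 * v2) ^ 2)"
      by (rule degree_mult_le)
    moreover have "degree (2 * [:b:]) = 0" by (simp add: numeral_poly)
    moreover have "degree ((v1 * v2) ^ 2) \<le> degree (v1 * v2) * 2" by (rule degree_power_le)
    ultimately show ?thesis using vv by linarith
  qed
  ultimately have "degree ((u1 * v2 + u2 * v1) * (u1 * u2 + [:a:] * (v1 * v2)) + 2 * [:b:] * (v1 * v2) ^ 2) < 2 * d"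
    by (rule degree_add_less)
  moreover have "degree (2 * q) \<le> degree q" for q :: "'k poly"
    using cst[of 2 q] by (simp add: numeral_poly)
  ultimately show "degree (kummer_S [:a:] [:b:] u1 v1 u2 v2) < 2 * (degree u1 + degree u2)"
    unfolding kummer_S_def d_def[symmetric] by (meson le_less_trans)
qed

lemma kummer_no_common_root:
  fixes u1 :: "'k::field poly"
  assumes "no_common_root u1 v1" "no_common_root u2 v2" "4 * a ^ 3 + 27 * b ^ 2 \<noteq> 0" "(2 :: 'k) \<noteq> 0"
  shows "poly (kummer_D u1 v1 u2 v2) r \<noteq> 0 \<or> poly (kummer_S [:a:] [:b:] u1 v1 u2 v2) r \<noteq> 0
    \<or> poly (kummer_G [:a:] [:b:] u1 v1 u2 v2) r \<noteq> 0"
proof -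
  have "poly (kummer_D u1 v1 u2 v2) r = kummer_D (poly u1 r) (poly v1 r) (poly u2 r) (poly v2 r)"
    "poly (kummer_S [:a:] [:b:] u1 v1 u2 v2) r = kummer_S a b (poly u1 r) (poly v1 r) (poly u2 r) (poly v2 r)"
    "poly (kummer_G [:a:] [:b:] u1 v1 u2 v2) r = kummer_G a b (poly u1 r) (poly v1 r) (poly u2 r) (poly v2 r)"
    by (simp_all add: kummer_defs)
  thus ?thesis
    using kummer_base_point_free[of "poly u1 r" "poly v1 r" "poly u2 r" "poly v2 r" a b] assms
    by (simp add: no_common_root_def)
qed

text \<open>The triples \<open>(D, S, G)\<close> and \<open>(v3 v4, u3 v4 + u4 v3, u3 u4)\<close>
  are proportional and neither has a common root, so they agree up to a unit and their degrees can
  be compared.\<close>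

lemma height_parallelogram:
  fixes u1 v1 u2 v2 u3 v3 u4 v4 :: "'k::alg_closed_field poly"
  defines "D \<equiv> kummer_D u1 v1 u2 v2"
  assumes nr: "no_common_root u1 v1" "no_common_root u2 v2" "no_common_root u3 v3" "no_common_root u4 v4"
    and disc: "4 * a ^ 3 + 27 * b ^ 2 \<noteq> 0" "(2 :: 'k) \<noteq> 0"
    and deg: "degree v1 < degree u1" "degree v2 < degree u2" "degree v3 < degree u3"
    and nz: "D \<noteq> 0" "v3 \<noteq> 0" "v4 \<noteq> 0"
    and S: "D * (u3 * v4 + u4 * v3) = kummer_S [:a:] [:b:] u1 v1 u2 v2 * (v3 * v4)"
    and G: "D * (u3 * u4) = kummer_G [:a:] [:b:] u1 v1 u2 v2 * (v3 * v4)"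
  shows "degree u3 + degree u4 = 2 * (degree u1 + degree u2)" "degree v4 < degree u4"
proof -
  let ?S = "kummer_S [:a:] [:b:] u1 v1 u2 v2" and ?G = "kummer_G [:a:] [:b:] u1 v1 u2 v2"
  have "D dvd v3 * v4"
    by (rule common_factor_dvd[OF nz(1) _ S G])
      (use kummer_no_common_root[OF nr(1,2) disc] in \<open>simp add: D_def\<close>)
  moreover have "v3 * v4 dvd D"
  proof (rule common_factor_dvd)
    show "v3 * v4 * ?S = (u3 * v4 + u4 * v3) * D" "v3 * v4 * ?G = u3 * u4 * D"
      using S G by (simp_all only: mult_ac)
    show "poly (v3 * v4) r \<noteq> 0 \<or> poly (u3 * v4 + u4 * v3) r \<noteq> 0 \<or> poly (u3 * u4) r \<noteq> 0" for r
      using nr(3,4) unfolding no_common_root_def by (cases "poly v3 r = 0"; cases "poly v4 r = 0") auto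
  qed (use nz in simp)
  ultimately obtain e where e: "v3 * v4 = D * e" "e dvd 1"
    by (metis dvd_def dvd_mult_cancel_left mult.right_neutral nz(1) mult_dvd_mono)
  have "e \<noteq> 0" using e(2) by auto
  hence "degree e = 0" using e(2) by (simp add: is_unit_iff_degree)
  have uu: "u3 * u4 = ?G * e" using G nz(1) unfolding e(1) by (simp add: mult.left_commute)
  have uv: "u3 * v4 + u4 * v3 = ?S * e" using S nz(1) unfolding e(1) by (simp add: mult.left_commute)
  have dG: "degree ?G = 2 * (degree u1 + degree u2)" and dS: "degree ?S < 2 * (degree u1 + degree u2)"
    using kummer_degrees[OF deg(1,2)] by auto
  have "?G \<noteq> 0" using dG deg by auto
  hence "degree (u3 * u4) = 2 * (degree u1 + degree u2)"
    unfolding uu using dG \<open>e \<noteq> 0\<close> \<open>degree e = 0\<close> by (simp add: degree_mult_eq)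
  moreover have "u3 * u4 \<noteq> 0" unfolding uu using \<open>?G \<noteq> 0\<close> \<open>e \<noteq> 0\<close> by simp
  ultimately show *: "degree u3 + degree u4 = 2 * (degree u1 + degree u2)"
    by (metis degree_mult_eq mult_eq_0_iff)
  have "u3 \<noteq> 0" "u4 \<noteq> 0" using \<open>u3 * u4 \<noteq> 0\<close> by auto
  \<comment> \<open>Otherwise \<open>u3 v4\<close> would give the middle form a degree that
    \<open>S\<close> is known to stay below.\<close>
  show "degree v4 < degree u4"
  proof (rule ccontr)
    assume "\<not> degree v4 < degree u4"
    hence le: "degree u4 \<le> degree v4" by simp
    have "degree (u4 * v3) < degree (u3 * v4)"
      using le deg(3) nz \<open>u3 \<noteq> 0\<close> \<open>u4 \<noteq> 0\<close> by (simp add: degree_mult_eq)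
    hence "degree (?S * e) = degree u3 + degree v4"
      unfolding uv[symmetric] using nz \<open>u3 \<noteq> 0\<close> by (simp add: degree_add_eq_left degree_mult_eq)
    moreover have "degree (?S * e) \<le> degree ?S"
      using degree_mult_le[of ?S e] \<open>degree e = 0\<close> by simp
    ultimately show False using dS * le by linarith
  qed
qed

text \<open>The degenerate case of equal abscissae: one of \<open>P1 + P2\<close>,
  \<open>P1 - P2\<close> is the point at infinity, counted with height 0, and the other has abscissa
  \<open>G / S\<close>.\<close>

lemma height_duplication:
  fixes u1 :: "'k::alg_closed_field poly"
  assumes nr: "no_common_root u1 v1" "no_common_root u2 v2" "no_common_root u3 v3"
    and disc: "4 * a ^ 3 + 27 * b ^ 2 \<noteq> 0" "(2 :: 'k) \<noteq> 0"
    and deg: "degree v1 < degree u1" "degree v2 < degree u2"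
    and nz: "u3 \<noteq> 0"
    and D: "kummer_D u1 v1 u2 v2 = 0"
    and SG: "u3 * kummer_S [:a:] [:b:] u1 v1 u2 v2 = v3 * kummer_G [:a:] [:b:] u1 v1 u2 v2"
  shows "degree u3 = 2 * (degree u1 + degree u2)"
proof -
  let ?S = "kummer_S [:a:] [:b:] u1 v1 u2 v2" and ?G = "kummer_G [:a:] [:b:] u1 v1 u2 v2"
  have dG: "degree ?G = 2 * (degree u1 + degree u2)"
    using kummer_degrees[OF deg] by auto
  hence "?G \<noteq> 0" using deg by auto
  have "?G dvd u3"
  proof (rule common_factor_dvd)
    show "?G * v3 = ?S * u3" "?G * 0 = 0 * u3" using SG by (simp_all only: mult_ac mult_zero_left mult_zero_right)
    show "poly ?G r \<noteq> 0 \<or> poly ?S r \<noteq> 0 \<or> poly 0 r \<noteq> 0" for r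
      using kummer_no_common_root[OF nr(1,2) disc, of r] D by auto
  qed fact
  moreover have "u3 dvd ?G"
  proof (rule common_factor_dvd)
    show "u3 * ?S = v3 * ?G" "u3 * 0 = 0 * ?G" using SG by simp_all
    show "poly u3 r \<noteq> 0 \<or> poly v3 r \<noteq> 0 \<or> poly 0 r \<noteq> 0" for r
      using nr(3) by (auto simp: no_common_root_def)
  qed fact
  ultimately have "degree u3 = degree ?G"
    using \<open>?G \<noteq> 0\<close> nz by (intro antisym dvd_imp_degree_le)
  thus ?thesis using dG by simp
qed

section \<open>Endomorphisms as points over the rational function field\<close>

text \<open>The rational function field is used inside the field of Laurent series, which has a derivation.\<close>

definition emb :: "'k::field poly \<Rightarrow> 'k fls" where
  "emb q = fps_to_fls (fps_of_poly q)"

lemma emb_simps [simp]: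
  "emb 0 = 0" "emb 1 = 1" "emb (p + q) = emb p + emb q" "emb (p - q) = emb p - emb q"
  "emb (- p) = - emb p" "emb (p * q) = emb p * emb q" "emb (p ^ n) = emb p ^ n"
  by (simp_all add: emb_def fps_of_poly_add fps_of_poly_diff fps_of_poly_uminus fps_of_poly_mult
      fps_of_poly_power fls_times_fps_to_fls fps_to_fls_power)

lemma emb_numeral [simp]: "emb (numeral n) = numeral n"
  by (simp add: emb_def)

lemma emb_const_1 [simp]: "emb [:1:] = 1"
  by (metis emb_simps(2) one_pCons)

lemma emb_eq_iff [simp]: "emb p = emb q \<longleftrightarrow> p = q"
  by (simp add: emb_def)

lemma emb_eq_0_iff [simp]: "emb p = 0 \<longleftrightarrow> p = 0"
  using emb_eq_iff[of p 0] by (simp del: emb_eq_iff)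

lemma deriv_emb: "fls_deriv (emb p) = emb (pderiv p)"
  by (simp add: emb_def fls_deriv_fps_to_fls fps_of_poly_pderiv)

lemma deriv_const_emb [simp]: "fls_deriv (emb [:c:]) = 0"
  by (simp add: deriv_emb pderiv_pCons)

lemma emb_const_numeral [simp]: "emb [:numeral n:] = numeral n" "emb [:- numeral n:] = - numeral n"
proof -
  show a: "emb [:numeral n:] = numeral n"
    using emb_numeral[of n] by (simp add: numeral_poly del: emb_numeral)
  have b: "[:- numeral n:] = - [:numeral n:]" by simp
  show "emb [:- numeral n:] = - numeral n" unfolding b emb_simps a ..
qed

lemma emb_cubic: "emb ([:b, a, 0, 1:]) = emb [:0, 1:] ^ 3 + emb [:a:] * emb [:0, 1:] + emb [:b:]"
proof -
  have "[:b, a, 0, 1:] = [:0, 1:] ^ 3 + [:a:] * [:0, 1:] + [:b:]" by (simp add: eval_nat_numeral)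
  hence "emb [:b, a, 0, 1:] = emb ([:0, 1:] ^ 3 + [:a:] * [:0, 1:] + [:b:])" by (rule arg_cong)
  thus ?thesis by (simp only: emb_simps)
qed

section \<open>Rational functions among the Laurent series\<close>

definition ratfun :: "'k::field fls \<Rightarrow> bool" where
  "ratfun x \<longleftrightarrow> (\<exists>q d. d \<noteq> 0 \<and> x * emb d = emb q)"

lemma ratfun_emb [intro]: "ratfun (emb p)"
  unfolding ratfun_def by (intro exI[of _ p] exI[of _ 1]) simp

lemma ratfun_add:
  assumes "ratfun x" "ratfun y"
  shows "ratfun (x + y)"
proof -
  obtain q d q' d' where qd: "d \<noteq> 0" "x * emb d = emb q" "d' \<noteq> 0" "y * emb d' = emb q'"
    using assms by (auto simp: ratfun_def)
  have "(x + y) * emb (d * d') = (x * emb d) * emb d' + (y * emb d') * emb d"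
    by (simp add: algebra_simps)
  also have "\<dots> = emb (q * d' + q' * d)" by (simp add: qd)
  finally show ?thesis unfolding ratfun_def using qd(1,3) by (metis mult_eq_0_iff)
qed

lemma ratfun_mult:
  assumes "ratfun x" "ratfun y"
  shows "ratfun (x * y)"
proof -
  obtain q d q' d' where qd: "d \<noteq> 0" "x * emb d = emb q" "d' \<noteq> 0" "y * emb d' = emb q'"
    using assms by (auto simp: ratfun_def)
  have "(x * y) * emb (d * d') = (x * emb d) * (y * emb d')" by simp
  also have "\<dots> = emb (q * q')" by (simp add: qd)
  finally show ?thesis unfolding ratfun_def using qd(1,3) by (metis mult_eq_0_iff)
qed

lemma ratfun_diff: "ratfun x \<Longrightarrow> ratfun y \<Longrightarrow> ratfun (x - y)"
  using ratfun_add[OF _ ratfun_mult[OF ratfun_emb[of "- 1"]], of x y] by simp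

lemma ratfun_power: "ratfun x \<Longrightarrow> ratfun (x ^ i)"
  by (induction i) (use ratfun_emb[of 1] in \<open>auto intro: ratfun_mult\<close>)

lemma ratfun_divide:
  assumes "ratfun x" "ratfun y"
  shows "ratfun (x / y)"
proof (cases "y = 0")
  case True
  thus ?thesis using ratfun_emb[of 0] by simp
next
  case False
  obtain q d where "d \<noteq> 0" "y * emb d = emb q" using assms by (auto simp: ratfun_def)
  hence "q \<noteq> 0" "(1 / y) * emb q = emb d" using False by (auto simp: field_simps)
  hence "ratfun (1 / y)" unfolding ratfun_def by blast
  thus ?thesis using ratfun_mult[OF assms(1), of "1 / y"] by simp
qed

lemma ratfun_lowest_terms:
  assumes "ratfun x"
  shows "\<exists>u v. v \<noteq> 0 \<and> no_common_root u v \<and> x * emb v = emb u"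
proof -
  obtain q d where qd: "d \<noteq> 0" "x * emb d = emb q" using assms by (auto simp: ratfun_def)
  then obtain u v where uv: "v \<noteq> 0" "no_common_root u v" "q * v = u * d" using ex_lowest_terms by blast
  have "x * emb v * emb d = emb (q * v)" using qd(2) by (simp add: mult_ac)
  hence "x * emb v = emb u" unfolding uv(3) using qd(1) by simp
  thus ?thesis using uv by blast
qed

text \<open>Three points of \<open>F y\<^sup>2 = x\<^sup>3 + a x + b\<close> on a line \<open>y = l x + n\<close>, tangency included: the last
  three equations say that \<open>x\<^sub>1, x\<^sub>2, x\<^sub>3\<close> are the roots of \<open>X\<^sup>3 + a X + b - F (l X + n)\<^sup>2\<close>.\<close>

definition collinear3 :: "'f::field \<Rightarrow> 'f \<Rightarrow> 'f \<Rightarrow> 'f \<times> 'f \<Rightarrow> 'f \<times> 'f \<Rightarrow> 'f \<times> 'f \<Rightarrow> 'f \<Rightarrow> 'f \<Rightarrow> bool" where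
  "collinear3 F a b P1 P2 P3 l n \<longleftrightarrow>
     snd P1 = l * fst P1 + n \<and> snd P2 = l * fst P2 + n \<and> snd P3 = l * fst P3 + n \<and>
     F * l ^ 2 = fst P1 + fst P2 + fst P3 \<and>
     fst P1 * fst P2 + fst P1 * fst P3 + fst P2 * fst P3 = a - 2 * F * l * n \<and>
     fst P1 * fst P2 * fst P3 = F * n ^ 2 - b"

section \<open>Lines, chords and the invariant differential\<close>

lemma collinear3_rotate: "collinear3 F a b P1 P2 P3 l n \<Longrightarrow> collinear3 F a b P2 P3 P1 l n"
  by (simp add: collinear3_def algebra_simps)

lemma collinear3_swap: "collinear3 F a b P1 P2 P3 l n \<Longrightarrow> collinear3 F a b P2 P1 P3 l n"
  by (simp add: collinear3_def algebra_simps)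

lemma collinear3_neg:
  "collinear3 F a b (x1, y1) (x2, y2) (x3, y3) l n
    \<Longrightarrow> collinear3 F a b (x1, - y1) (x2, - y2) (x3, - y3) (- l) (- n)"
  by (simp add: collinear3_def)

text \<open>The elementary symmetric functions of the abscissae satisfy
  \<open>(e2 - a)^2 = 4 e1 (e3 + b)\<close>, both sides being \<open>4 F^2 l^2 n^2\<close>. Read as
  a quadratic in \<open>x3\<close>, this is the Kummer relation.\<close>

lemma collinear3_kummer:
  assumes "collinear3 F a b (x1, y1) (x2, y2) (x3, y3) l n"
  shows "kummer_D x1 1 x2 1 * x3 ^ 2 - kummer_S a b x1 1 x2 1 * x3 + kummer_G a b x1 1 x2 1 = 0"
proof -
  have c: "F * l ^ 2 = x1 + x2 + x3" "x1 * x2 + x1 * x3 + x2 * x3 - a = - 2 * F * l * n"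
    "x1 * x2 * x3 + b = F * n ^ 2"
    using assms by (simp_all add: collinear3_def)
  have "kummer_D x1 1 x2 1 * x3 ^ 2 - kummer_S a b x1 1 x2 1 * x3 + kummer_G a b x1 1 x2 1
     = (x1 * x2 + x1 * x3 + x2 * x3 - a) ^ 2 - 4 * (x1 + x2 + x3) * (x1 * x2 * x3 + b)"
    unfolding kummer_defs by (simp add: algebra_simps power2_eq_square)
  also have "\<dots> = 0"
    unfolding c(2,3) unfolding c(1)[symmetric] by (simp add: algebra_simps power2_eq_square)
  finally show ?thesis .
qed

lemma collinear3_chord:
  assumes c1: "F * y1 ^ 2 = x1 ^ 3 + a * x1 + b" and c2: "F * y2 ^ 2 = x2 ^ 3 + a * x2 + b"
    and ne: "x1 \<noteq> x2"
  defines "l \<equiv> (y2 - y1) / (x2 - x1)"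
  shows "collinear3 F a b (x1, y1) (x2, y2) (F * l ^ 2 - x1 - x2, y1 + l * (F * l ^ 2 - x1 - x2 - x1)) l (y1 - l * x1)"
proof -
  define n where "n = y1 - l * x1"
  define d where "d = x2 - x1"
  have d: "d \<noteq> 0" using ne by (simp add: d_def)
  have ld: "l * d = y2 - y1" using d by (simp add: l_def d_def)
  have y1: "y1 = l * x1 + n" by (simp add: n_def)
  have y2: "y2 = l * x2 + n" using ld by (simp add: n_def d_def algebra_simps)
  define x3 where "x3 = F * l ^ 2 - x1 - x2"
  have "d * (x1 * x2 + x1 * x3 + x2 * x3 - (a - 2 * F * l * n))
      = (F * y2 ^ 2 - (x2 ^ 3 + a * x2 + b)) - (F * y1 ^ 2 - (x1 ^ 3 + a * x1 + b))"
    unfolding y1 y2 d_def x3_def by (simp add: algebra_simps power2_eq_square power3_eq_cube)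
  hence e2: "x1 * x2 + x1 * x3 + x2 * x3 = a - 2 * F * l * n" using c1 c2 d by simp
  have "x1 * x2 * x3 - (F * n ^ 2 - b) = x1 * (x1 * x2 + x1 * x3 + x2 * x3 - (a - 2 * F * l * n))
      - (F * y1 ^ 2 - (x1 ^ 3 + a * x1 + b))"
    unfolding y1 x3_def by (simp add: algebra_simps power2_eq_square power3_eq_cube)
  hence e3: "x1 * x2 * x3 = F * n ^ 2 - b" using e2 c1 by simp
  have e1: "F * l ^ 2 = x1 + x2 + x3" by (simp add: x3_def)
  have y3: "y1 + l * (x3 - x1) = l * x3 + n" by (simp add: n_def algebra_simps)
  show ?thesis
    unfolding n_def[symmetric] x3_def[symmetric] collinear3_def fst_conv snd_conv
    using y1 y2 e1 e2 e3 y3 by blast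
qed

lemma collinear3_on_curve:
  assumes "collinear3 F a b P1 P2 (x3, y3) l n"
  shows "F * y3 ^ 2 = x3 ^ 3 + a * x3 + b"
proof -
  obtain x1 y1 x2 y2 where P: "P1 = (x1, y1)" "P2 = (x2, y2)" by fastforce
  have c: "y3 = l * x3 + n" "F * l ^ 2 = x1 + x2 + x3" "x1 * x2 + x1 * x3 + x2 * x3 = a - 2 * F * l * n"
    "x1 * x2 * x3 = F * n ^ 2 - b"
    using assms by (simp_all add: collinear3_def P)
  have "F * y3 ^ 2 = (F * l ^ 2) * x3 ^ 2 + (2 * F * l * n) * x3 + F * n ^ 2"
    unfolding c(1) by (simp add: algebra_simps power2_eq_square)
  also have "2 * F * l * n = a - (x1 * x2 + x1 * x3 + x2 * x3)" using c(3) by simp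
  also have "F * n ^ 2 = x1 * x2 * x3 + b" using c(4) by simp
  finally show ?thesis unfolding c(2) by (simp add: algebra_simps power2_eq_square power3_eq_cube)
qed

lemma collinear3_slope:
  assumes "collinear3 F a b (x1, y1) (x2, y2) (x3, y3) l n" "x1 \<noteq> x2"
  shows "l = (y2 - y1) / (x2 - x1)" "x3 = F * l ^ 2 - x1 - x2" "y3 = y1 + l * (x3 - x1)"
  using assms by (auto simp: collinear3_def field_simps)

text \<open>Replacing \<open>y2\<close> by \<open>- y2\<close> passes to the chord through the
  opposite point. The cross term \<open>2 F y1 y2\<close> cancels in the sum, and the product
  involves only \<open>F y1^2\<close> and \<open>F y2^2\<close>, which the curve equations
  eliminate.\<close>

lemma chord_sum_prod:
  assumes c1: "F * y1 ^ 2 = x1 ^ 3 + a * x1 + b" and c2: "F * y2 ^ 2 = x2 ^ 3 + a * x2 + b"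
    and ne: "x1 \<noteq> (x2 :: 'f::field)"
    and x3: "x3 = F * ((y2 - y1) / (x2 - x1)) ^ 2 - x1 - x2"
    and x4: "x4 = F * ((- y2 - y1) / (x2 - x1)) ^ 2 - x1 - x2"
  shows "kummer_D x1 1 x2 1 * (x3 + x4) = kummer_S a b x1 1 x2 1"
    and "kummer_D x1 1 x2 1 * (x3 * x4) = kummer_G a b x1 1 x2 1"
proof -
  define d where "d = x2 - x1"
  have d: "d \<noteq> 0" using ne by (simp add: d_def)
  have D: "kummer_D x1 1 x2 1 = d ^ 2" by (simp add: kummer_D_def d_def power2_eq_square algebra_simps)
  have X3: "d ^ 2 * x3 = F * (y2 - y1) ^ 2 - (x1 + x2) * d ^ 2"
    using d unfolding x3 d_def[symmetric] by (simp add: field_simps)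
  have X4: "d ^ 2 * x4 = F * (y2 + y1) ^ 2 - (x1 + x2) * d ^ 2"
  proof -
    have "(- y2 - y1) ^ 2 = (y2 + y1) ^ 2" by (simp add: power2_eq_square algebra_simps)
    thus ?thesis using d unfolding x4 d_def[symmetric] by (simp add: field_simps)
  qed
  have "d ^ 2 * (x3 + x4) = 2 * (F * y1 ^ 2) + 2 * (F * y2 ^ 2) - 2 * (x1 + x2) * d ^ 2"
    unfolding distrib_left X3 X4 by (simp add: algebra_simps power2_eq_square)
  also have "\<dots> = kummer_S a b x1 1 x2 1"
    unfolding c1 c2 kummer_S_def d_def by (simp add: algebra_simps power2_eq_square power3_eq_cube)
  finally show "kummer_D x1 1 x2 1 * (x3 + x4) = kummer_S a b x1 1 x2 1" unfolding D .
  have "d ^ 2 * (d ^ 2 * (x3 * x4)) = (d ^ 2 * x3) * (d ^ 2 * x4)" by simp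
  also have "\<dots> = (F * y2 ^ 2 - F * y1 ^ 2) ^ 2 - (x1 + x2) * d ^ 2 * (2 * (F * y1 ^ 2) + 2 * (F * y2 ^ 2))
      + ((x1 + x2) * d ^ 2) ^ 2"
    unfolding X3 X4 by (simp add: algebra_simps power2_eq_square)
  also have "\<dots> = d ^ 2 * kummer_G a b x1 1 x2 1"
    unfolding c1 c2 kummer_G_def d_def by (simp add: algebra_simps power2_eq_square power3_eq_cube)
  finally have "d ^ 2 * (x3 * x4) = kummer_G a b x1 1 x2 1"
    using d by (metis mult_left_cancel power_not_zero)
  thus "kummer_D x1 1 x2 1 * (x3 * x4) = kummer_G a b x1 1 x2 1" unfolding D .
qed

text \<open>Additivity of the action on the invariant differential \<open>dx / y\<close>: collinear
  points have sum zero, whence the factor \<open>- (c1 + c2)\<close>. The twist \<open>F\<close>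
  varies with \<open>t\<close>; the terms with its derivative cancel at the end.\<close>

lemma chord_deriv:
  fixes F :: "'k::field fls"
  assumes col: "collinear3 F a b (x1, y1) (x2, y2) (x3, y3) l n"
    and ne: "x1 \<noteq> x2" and y0: "y1 \<noteq> 0" "y2 \<noteq> 0"
    and da: "fls_deriv a = 0" "fls_deriv b = 0"
    and d1: "fls_deriv x1 = c1 * y1" and d2: "fls_deriv x2 = c2 * y2"
  shows "fls_deriv x3 = - (c1 + c2) * y3"
proof -
  define F' where "F' = fls_deriv F"
  define l' where "l' = fls_deriv l"
  have K: "2 * F * fls_deriv y = (3 * x ^ 2 + a) * c - F' * y"
    if "F * y ^ 2 = x ^ 3 + a * x + b" "fls_deriv x = c * y" "y \<noteq> 0" for x y c
  proof -
    have "fls_deriv (F * y ^ 2) = fls_deriv (x ^ 3 + a * x + b)" using that(1) by simp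
    hence "y * (2 * F * fls_deriv y) = y * ((3 * x ^ 2 + a) * c - F' * y)"
      using that(2) by (simp add: power2_eq_square power3_eq_cube da F'_def algebra_simps)
    thus ?thesis using that(3) by simp
  qed
  have oc: "F * y1 ^ 2 = x1 ^ 3 + a * x1 + b" "F * y2 ^ 2 = x2 ^ 3 + a * x2 + b"
    using collinear3_on_curve[OF collinear3_rotate[OF col]]
      collinear3_on_curve[OF collinear3_rotate[OF collinear3_rotate[OF col]]] by simp_all
  note K1 = K[OF oc(1) d1 y0(1)] and K2 = K[OF oc(2) d2 y0(2)]
  have y: "y1 = l * x1 + n" "y2 = l * x2 + n" "y3 = l * x3 + n" and e1: "F * l ^ 2 = x1 + x2 + x3"
    and e2: "x1 * x2 + x1 * x3 + x2 * x3 = a - 2 * F * l * n"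
    using col by (simp_all add: collinear3_def)
  have L: "l' * (x2 - x1) + l * (c2 * y2 - c1 * y1) = fls_deriv y2 - fls_deriv y1"
  proof -
    have "fls_deriv (l * (x2 - x1)) = fls_deriv (y2 - y1)" unfolding y by (simp add: algebra_simps)
    thus ?thesis by (simp add: d1 d2 l'_def algebra_simps)
  qed
  have x3: "fls_deriv x3 = F' * l ^ 2 + 2 * F * l * l' - c1 * y1 - c2 * y2"
  proof -
    have "fls_deriv x3 = fls_deriv (F * l ^ 2 - x1 - x2)" unfolding e1 by simp
    thus ?thesis by (simp add: d1 d2 l'_def F'_def power2_eq_square algebra_simps)
  qed
  \<comment> \<open>The derivative of
    \<open>X^3 + a X + b - F (l X + n)^2 = (X - x1) (X - x2) (X - x3)\<close>, evaluated at
    \<open>x2\<close> and \<open>x1\<close>.\<close>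
  have V: "3 * x2 ^ 2 + a - 2 * F * l * y2 = (x2 - x1) * (x2 - x3)"
    "3 * x1 ^ 2 + a - 2 * F * l * y1 = (x1 - x2) * (x1 - x3)"
  proof -
    have a: "a = x1 * x2 + x1 * x3 + x2 * x3 + 2 * F * l * n" using e2 by simp
    have q: "2 * F * l * (l * x + n) = 2 * (F * l ^ 2) * x + 2 * F * l * n" for x
      by (simp add: algebra_simps power2_eq_square)
    show "3 * x2 ^ 2 + a - 2 * F * l * y2 = (x2 - x1) * (x2 - x3)"
      "3 * x1 ^ 2 + a - 2 * F * l * y1 = (x1 - x2) * (x1 - x3)"
      unfolding y q e1 unfolding a by (simp_all add: algebra_simps power2_eq_square)
  qed
  have "(x2 - x1) * (2 * F * l * l') = l * (2 * F * (l' * (x2 - x1)))" by (simp add: mult_ac)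
  also have "l' * (x2 - x1) = fls_deriv y2 - fls_deriv y1 - l * (c2 * y2 - c1 * y1)"
    unfolding L[symmetric] by simp
  also have "l * (2 * F * (fls_deriv y2 - fls_deriv y1 - l * (c2 * y2 - c1 * y1)))
     = l * (2 * F * fls_deriv y2 - 2 * F * fls_deriv y1) - 2 * F * l * l * (c2 * y2 - c1 * y1)"
    by (simp add: algebra_simps)
  also have "\<dots> = l * ((3 * x2 ^ 2 + a - 2 * F * l * y2) * c2 - (3 * x1 ^ 2 + a - 2 * F * l * y1) * c1) - F' * l * (y2 - y1)"
    unfolding K1 K2 by (simp add: algebra_simps)
  also have "\<dots> = (x2 - x1) * (l * ((x2 - x3) * c2 + (x1 - x3) * c1) - F' * l ^ 2)"
    unfolding V unfolding y by (simp add: algebra_simps power2_eq_square)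
  finally have "2 * F * l * l' = l * ((x2 - x3) * c2 + (x1 - x3) * c1) - F' * l ^ 2"
    using ne by simp
  thus ?thesis unfolding x3 y by (simp add: algebra_simps)
qed

text \<open>Points of the quadratic twist \<open>f(t) y\<^sup>2 = f(x)\<close> over \<open>k(t)\<close>, i.e. endomorphisms of \<open>y\<^sup>2 = f(x)\<close>, with
  a pole of \<open>x\<close> at infinity: \<open>c\<close> is the action on the invariant differential and \<open>h\<close> the degree.\<close>

definition curve_pt :: "'k::field \<Rightarrow> 'k \<Rightarrow> 'k \<Rightarrow> nat \<Rightarrow> 'k fls \<Rightarrow> 'k fls \<Rightarrow> bool" where
  "curve_pt a b c h x y \<longleftrightarrow> ratfun y \<and> (\<exists>u v. v \<noteq> 0 \<and> no_common_root u v \<and> degree v < degree u \<and> degree u = h \<and>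
     x * emb v = emb u \<and> emb [:b, a, 0, 1:] * y ^ 2 = x ^ 3 + emb [:a:] * x + emb [:b:] \<and>
     fls_deriv x = emb [:c:] * y)"

lemma curve_pt_neg: "curve_pt a b c h x y \<Longrightarrow> curve_pt a b (- c) h x (- y)"
proof -
  have "emb [:- c:] = - emb [:c:]" by (simp flip: emb_simps)
  thus "curve_pt a b c h x y \<Longrightarrow> curve_pt a b (- c) h x (- y)"
    using ratfun_mult[OF ratfun_emb[of "- 1"], of y] by (auto simp: curve_pt_def simp del: emb_simps(6))
qed

lemma curve_pt_y_nonzero:
  assumes "curve_pt a b c h x y"
  shows "y \<noteq> 0"
proof
  assume "y = 0"
  obtain u v where uv: "v \<noteq> 0" "degree v < degree u" "x * emb v = emb u"
    "emb [:b, a, 0, 1:] * y ^ 2 = x ^ 3 + emb [:a:] * x + emb [:b:]"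
    using assms by (auto simp: curve_pt_def)
  have "emb (u ^ 3 + ([:a:] * u * v ^ 2 + [:b:] * v ^ 3)) = (x ^ 3 + emb [:a:] * x + emb [:b:]) * emb v ^ 3"
    by (simp del: mult_pCons_left flip: uv(3)) (simp add: algebra_simps power2_eq_square power3_eq_cube)
  also have "\<dots> = 0" using uv(4) \<open>y = 0\<close> by simp
  finally have z: "u ^ 3 + ([:a:] * u * v ^ 2 + [:b:] * v ^ 3) = 0" by (simp only: emb_eq_0_iff)
  have "degree (u ^ 3) = 3 * degree u" using uv by (intro degree_power_eq) auto
  moreover have "degree ([:a:] * u * v ^ 2) < 3 * degree u"
    using degree_smult_le[of a "u * v ^ 2"] degree_mult_le[of u "v ^ 2"] degree_power_le[of v 2] uv(2)
    by simp
  moreover have "degree ([:b:] * v ^ 3) < 3 * degree u"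
    using degree_smult_le[of b "v ^ 3"] degree_power_le[of v 3] uv(2) by simp
  ultimately have "degree (u ^ 3 + ([:a:] * u * v ^ 2 + [:b:] * v ^ 3)) = 3 * degree u"
    by (subst degree_add_eq_left) (auto intro: degree_add_less)
  thus False using z uv(2) by simp
qed

lemma kummer_homogeneous:
  "kummer_D (x1 * v1) v1 (x2 * v2) v2 = (v1 * v2) ^ 2 * kummer_D x1 1 x2 1"
  "kummer_S a b (x1 * v1) v1 (x2 * v2) v2 = (v1 * v2) ^ 2 * kummer_S a b x1 1 x2 1"
  "kummer_G a b (x1 * v1) v1 (x2 * v2) v2 = (v1 * v2) ^ 2 * kummer_G a b x1 1 x2 1"
  by (simp_all add: kummer_defs algebra_simps power2_eq_square)

lemma emb_kummer:
  "emb (kummer_D u1 v1 u2 v2) = kummer_D (emb u1) (emb v1) (emb u2) (emb v2)"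
  "emb (kummer_S a b u1 v1 u2 v2) = kummer_S (emb a) (emb b) (emb u1) (emb v1) (emb u2) (emb v2)"
  "emb (kummer_G a b u1 v1 u2 v2) = kummer_G (emb a) (emb b) (emb u1) (emb v1) (emb u2) (emb v2)"
  by (simp_all add: kummer_defs)

text \<open>From \<open>P1\<close>, \<open>P2\<close> and \<open>- P1 - P2\<close> to
  \<open>P2 - P1\<close>, the degree being dictated by the parallelogram law. The condition on
  \<open>h3\<close> rules out \<open>x1 = x2\<close>, where the chord is undefined and, by
  \<open>height_duplication\<close>, \<open>h3\<close> would be \<open>2 (h1 + h2)\<close>.\<close>

lemma curve_pt_flip:
  fixes a :: "'k::alg_closed_field"
  assumes pts: "curve_pt a b c1 h1 x1 y1" "curve_pt a b c2 h2 x2 y2" "curve_pt a b c3 h3 x3 y3"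
    and col: "collinear3 (emb [:b, a, 0, 1:]) (emb [:a:]) (emb [:b:]) (x1, y1) (x2, y2) (x3, y3) l n"
    and disc: "4 * a ^ 3 + 27 * b ^ 2 \<noteq> 0" "(2 :: 'k) \<noteq> 0"
    and h: "h3 \<noteq> 2 * (h1 + h2)"
  shows "\<exists>x4 y4 l' n'. curve_pt a b (c2 - c1) (2 * (h1 + h2) - h3) x4 y4 \<and>
    collinear3 (emb [:b, a, 0, 1:]) (emb [:a:]) (emb [:b:]) (x1, y1) (x2, - y2) (x4, y4) l' n'"
proof -
  define F where "F = emb [:b, a, 0, 1:]"
  define A where "A = emb [:a:]"
  define B where "B = emb [:b:]"
  obtain u1 v1 where p1: "v1 \<noteq> 0" "no_common_root u1 v1" "degree v1 < degree u1" "degree u1 = h1"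
    "x1 * emb v1 = emb u1" "F * y1 ^ 2 = x1 ^ 3 + A * x1 + B" "fls_deriv x1 = emb [:c1:] * y1"
    using pts(1) by (auto simp: curve_pt_def F_def A_def B_def)
  obtain u2 v2 where p2: "v2 \<noteq> 0" "no_common_root u2 v2" "degree v2 < degree u2" "degree u2 = h2"
    "x2 * emb v2 = emb u2" "F * y2 ^ 2 = x2 ^ 3 + A * x2 + B" "fls_deriv x2 = emb [:c2:] * y2"
    using pts(2) by (auto simp: curve_pt_def F_def A_def B_def)
  obtain u3 v3 where p3: "v3 \<noteq> 0" "no_common_root u3 v3" "degree v3 < degree u3" "degree u3 = h3"
    "x3 * emb v3 = emb u3" "F * y3 ^ 2 = x3 ^ 3 + A * x3 + B"
    using pts(3) by (auto simp: curve_pt_def F_def A_def B_def)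
  note col = col[folded F_def A_def B_def]
  define V where "V = (emb v1 * emb v2) ^ 2"
  have V: "V \<noteq> 0" using p1(1) p2(1) by (simp add: V_def)
  define D where "D = kummer_D u1 v1 u2 v2"
  define S where "S = kummer_S [:a:] [:b:] u1 v1 u2 v2"
  define G where "G = kummer_G [:a:] [:b:] u1 v1 u2 v2"
  have eD: "emb D = V * kummer_D x1 1 x2 1" and eS: "emb S = V * kummer_S A B x1 1 x2 1"
    and eG: "emb G = V * kummer_G A B x1 1 x2 1"
    unfolding D_def S_def G_def emb_kummer A_def B_def V_def p1(5)[symmetric] p2(5)[symmetric]
    by (rule kummer_homogeneous)+
  have ne: "x1 \<noteq> x2"
  proof
    assume eq: "x1 = x2"
    hence D0: "kummer_D x1 1 x2 1 = 0" by (simp add: kummer_D_def)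
    hence "D = 0" using eD by (simp flip: emb_eq_0_iff)
    have "kummer_S A B x1 1 x2 1 * x3 = kummer_G A B x1 1 x2 1"
      using collinear3_kummer[OF col] D0 by simp
    hence "V * (kummer_S A B x1 1 x2 1 * x3) * emb v3 = V * kummer_G A B x1 1 x2 1 * emb v3" by simp
    hence "emb (u3 * S) = emb (v3 * G)"
      by (simp add: eS eG mult_ac flip: p3(5))
    hence "u3 * S = v3 * G" by (simp only: emb_eq_iff)
    hence "degree u3 = 2 * (degree u1 + degree u2)"
      using p3(3) \<open>D = 0\<close> unfolding S_def G_def D_def
      by (intro height_duplication[OF p1(2) p2(2) p3(2) disc p1(3) p2(3)]) auto
    thus False using h p1(4) p2(4) p3(4) by simp
  qed
  define l' where "l' = (- y2 - y1) / (x2 - x1)"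
  define x4 where "x4 = F * l' ^ 2 - x1 - x2"
  define y4 where "y4 = y1 + l' * (x4 - x1)"
  have col': "collinear3 F A B (x1, y1) (x2, - y2) (x4, y4) l' (y1 - l' * x1)"
    unfolding x4_def y4_def l'_def by (rule collinear3_chord) (use p1(6) p2(6) ne in auto)
  note sp = chord_sum_prod[OF p1(6) p2(6) ne collinear3_slope(2)[OF col ne, unfolded collinear3_slope(1)[OF col ne]]
      x4_def[unfolded l'_def]]
  have Dnz: "kummer_D x1 1 x2 1 \<noteq> 0" using ne by (simp add: kummer_D_def)
  hence "D \<noteq> 0" using eD V by (metis emb_eq_0_iff mult_eq_0_iff)
  \<comment> \<open>The sum of the two abscissae is \<open>S / D\<close>, so this is
    \<open>S / D - x3\<close> in lowest terms.\<close>
  obtain u4 v4 where q4: "v4 \<noteq> 0" "no_common_root u4 v4" "(S * v3 - u3 * D) * v4 = u4 * (D * v3)"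
    using ex_lowest_terms[of "D * v3" "S * v3 - u3 * D"] \<open>D \<noteq> 0\<close> p3(1) by auto
  have x4: "x4 * emb v4 = emb u4"
  proof -
    have "emb D * emb v3 * (x4 * emb v4) = (emb D * (x3 + x4) * emb v3 - x3 * emb v3 * emb D) * emb v4"
      by (simp add: algebra_simps)
    also have "emb D * (x3 + x4) = emb S" unfolding eD eS using sp(1) by (simp add: mult.assoc)
    also have "(emb S * emb v3 - x3 * emb v3 * emb D) * emb v4 = emb ((S * v3 - u3 * D) * v4)"
      by (simp add: p3(5))
    also have "\<dots> = emb D * emb v3 * emb u4" unfolding q4(3) by simp
    finally show ?thesis using \<open>D \<noteq> 0\<close> p3(1) by simp
  qed
  have H1: "D * (u3 * v4 + u4 * v3) = S * (v3 * v4)"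
  proof -
    have "emb (D * (u3 * v4 + u4 * v3)) = V * (kummer_D x1 1 x2 1 * (x3 + x4)) * (emb v3 * emb v4)"
      by (simp add: eD algebra_simps flip: p3(5) x4)
    also have "\<dots> = emb (S * (v3 * v4))" unfolding sp(1) by (simp add: eS)
    finally show ?thesis by (simp only: emb_eq_iff)
  qed
  have H2: "D * (u3 * u4) = G * (v3 * v4)"
  proof -
    have "emb (D * (u3 * u4)) = V * (kummer_D x1 1 x2 1 * (x3 * x4)) * (emb v3 * emb v4)"
      by (simp add: eD algebra_simps flip: p3(5) x4)
    also have "\<dots> = emb (G * (v3 * v4))" unfolding sp(2) by (simp add: eG)
    finally show ?thesis by (simp only: emb_eq_iff)
  qed
  have deg: "degree u3 + degree u4 = 2 * (degree u1 + degree u2)" "degree v4 < degree u4"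
    using height_parallelogram[OF p1(2) p2(2) p3(2) q4(2) disc p1(3) p2(3) p3(3)]
      \<open>D \<noteq> 0\<close> p3(1) q4(1) H1 H2 unfolding D_def S_def G_def by auto
  have "fls_deriv x4 = - (emb [:c1:] + - emb [:c2:]) * y4"
    by (rule chord_deriv[OF col' ne])
      (use curve_pt_y_nonzero[OF pts(1)] curve_pt_y_nonzero[OF pts(2)] p1(7) p2(7) in \<open>auto simp: A_def B_def\<close>)
  also have "- (emb [:c1:] + - emb [:c2:]) = emb [:c2 - c1:]"
    by (simp flip: emb_simps)
  finally have "fls_deriv x4 = emb [:c2 - c1:] * y4" .
  moreover have "F * y4 ^ 2 = x4 ^ 3 + A * x4 + B" using collinear3_on_curve[OF col'] .
  moreover have "degree u4 = 2 * (h1 + h2) - h3" using deg(1) p1(4) p2(4) p3(4) by simp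
  moreover have "ratfun y4"
  proof -
    have "ratfun x1" "ratfun x2" "ratfun x4" "ratfun y1" "ratfun y2"
      using p1(1,5) p2(1,5) q4(1) x4 pts(1,2) by (auto simp: ratfun_def curve_pt_def)
    thus ?thesis unfolding y4_def l'_def
      using ratfun_mult[OF ratfun_emb[of "- 1"], of y2] by (intro ratfun_add ratfun_mult ratfun_divide ratfun_diff) auto
  qed
  ultimately have "curve_pt a b (c2 - c1) (2 * (h1 + h2) - h3) x4 y4"
    unfolding curve_pt_def using q4 x4 deg(2) unfolding F_def A_def B_def
    by (intro conjI exI[of _ u4] exI[of _ v4]) auto
  thus ?thesis using col' unfolding F_def A_def B_def by blast
qed

section \<open>The norm form of \<open>\<int>[\<alpha>]\<close> and superbases\<close>

definition norm11 :: "int \<Rightarrow> int \<Rightarrow> int" where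
  "norm11 m n = m ^ 2 + m * n + 3 * n ^ 2"

lemma norm11_nonneg: "norm11 m n \<ge> 0"
proof -
  have "4 * norm11 m n = (2 * m + n) ^ 2 + 11 * n ^ 2"
    by (simp add: norm11_def algebra_simps power2_eq_square)
  thus ?thesis by (smt (verit) zero_le_power2)
qed

lemma norm11_eq_0: "norm11 m n = 0 \<longleftrightarrow> m = 0 \<and> n = 0"
proof
  assume "norm11 m n = 0"
  moreover have "4 * norm11 m n = (2 * m + n) ^ 2 + 11 * n ^ 2"
    by (simp add: norm11_def algebra_simps power2_eq_square)
  ultimately have "(2 * m + n) ^ 2 = 0 \<and> n ^ 2 = 0" by (smt (verit) zero_le_power2)
  thus "m = 0 \<and> n = 0" by simp
qed (simp add: norm11_def)

text \<open>As \<open>\<alpha>\<close> has trace 1 and norm 3, \<open>norm11 m n\<close> is the norm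
  of \<open>m + n \<alpha>\<close>. That the degree equals the norm is carried along as an
  invariant.\<close>

definition mult_pt :: "'k::field \<Rightarrow> 'k \<Rightarrow> 'k \<Rightarrow> int \<Rightarrow> int \<Rightarrow> 'k fls \<Rightarrow> 'k fls \<Rightarrow> bool" where
  "mult_pt a b \<alpha> m n = curve_pt a b (of_int m + of_int n * \<alpha>) (nat (norm11 m n))"

text \<open>Conway's topograph: neighbouring superbases differ by \<open>superbase_flip\<close>. Following it, degrees of
  multiples are computed from the parallelogram law without a group law on the points.\<close>

definition superbase :: "'k::field \<Rightarrow> 'k \<Rightarrow> 'k \<Rightarrow> int \<Rightarrow> int \<Rightarrow> int \<Rightarrow> int \<Rightarrow> bool" where
  "superbase a b \<alpha> m1 n1 m2 n2 \<longleftrightarrow> \<bar>m1 * n2 - m2 * n1\<bar> = 1 \<and>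
     (\<exists>x1 y1 x2 y2 x3 y3 l n. mult_pt a b \<alpha> m1 n1 x1 y1 \<and> mult_pt a b \<alpha> m2 n2 x2 y2 \<and>
        mult_pt a b \<alpha> (- m1 - m2) (- n1 - n2) x3 y3 \<and>
        collinear3 (emb [:b, a, 0, 1:]) (emb [:a:]) (emb [:b:]) (x1, y1) (x2, y2) (x3, y3) l n)"

lemma superbase_swap:
  assumes "superbase a b \<alpha> m1 n1 m2 n2"
  shows "superbase a b \<alpha> m2 n2 m1 n1"
proof -
  have "- m2 - m1 = - m1 - m2" "- n2 - n1 = - n1 - n2" "\<bar>m2 * n1 - m1 * n2\<bar> = \<bar>m1 * n2 - m2 * n1\<bar>" by auto
  thus ?thesis using assms collinear3_swap unfolding superbase_def by metis
qed

lemma superbase_third: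
  assumes "superbase a b \<alpha> m1 n1 m2 n2"
  shows "superbase a b \<alpha> m1 n1 (- m1 - m2) (- n1 - n2)"
proof -
  obtain x1 y1 x2 y2 x3 y3 l k where p: "\<bar>m1 * n2 - m2 * n1\<bar> = 1" "mult_pt a b \<alpha> m1 n1 x1 y1"
    "mult_pt a b \<alpha> m2 n2 x2 y2" "mult_pt a b \<alpha> (- m1 - m2) (- n1 - n2) x3 y3"
    "collinear3 (emb [:b, a, 0, 1:]) (emb [:a:]) (emb [:b:]) (x1, y1) (x2, y2) (x3, y3) l k"
    using assms unfolding superbase_def by blast
  have "m1 * (- n1 - n2) - (- m1 - m2) * n1 = - (m1 * n2 - m2 * n1)" by (simp add: algebra_simps)
  hence "\<bar>m1 * (- n1 - n2) - (- m1 - m2) * n1\<bar> = 1" using p(1) by simp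
  moreover have "mult_pt a b \<alpha> (- m1 - (- m1 - m2)) (- n1 - (- n1 - n2)) x2 y2" using p(3) by simp
  moreover have "collinear3 (emb [:b, a, 0, 1:]) (emb [:a:]) (emb [:b:]) (x1, y1) (x3, y3) (x2, y2) l k"
    by (rule collinear3_rotate[OF collinear3_swap[OF collinear3_rotate[OF collinear3_rotate[OF p(5)]]], THEN collinear3_rotate, THEN collinear3_rotate])
  ultimately show ?thesis using p(2,4) unfolding superbase_def by blast
qed

lemma superbase_neg:
  assumes "superbase a b \<alpha> m1 n1 m2 n2"
  shows "superbase a b \<alpha> (- m1) (- n1) (- m2) (- n2)"
proof -
  have n: "mult_pt a b \<alpha> (- m) (- n) x (- y)" if "mult_pt a b \<alpha> m n x y" for m n x y
  proof -
    have "norm11 (- m) (- n) = norm11 m n" by (simp add: norm11_def)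
    thus ?thesis using curve_pt_neg[OF that[unfolded mult_pt_def]] by (simp add: mult_pt_def)
  qed
  obtain x1 y1 x2 y2 x3 y3 l k where p: "\<bar>m1 * n2 - m2 * n1\<bar> = 1" "mult_pt a b \<alpha> m1 n1 x1 y1"
    "mult_pt a b \<alpha> m2 n2 x2 y2" "mult_pt a b \<alpha> (- m1 - m2) (- n1 - n2) x3 y3"
    "collinear3 (emb [:b, a, 0, 1:]) (emb [:a:]) (emb [:b:]) (x1, y1) (x2, y2) (x3, y3) l k"
    using assms unfolding superbase_def by blast
  have "\<bar>(- m1) * (- n2) - (- m2) * (- n1)\<bar> = 1" using p(1) by simp
  moreover have "mult_pt a b \<alpha> (- (- m1) - (- m2)) (- (- n1) - (- n2)) x3 (- y3)"
    using n[OF p(4)] by (simp add: algebra_simps)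
  ultimately show ?thesis
    using n[OF p(2)] n[OF p(3)] collinear3_neg[OF p(5)] unfolding superbase_def by blast
qed

lemma superbase_flip:
  fixes a :: "'k::alg_closed_field"
  assumes disc: "4 * a ^ 3 + 27 * b ^ 2 \<noteq> 0" "(2 :: 'k) \<noteq> 0"
    and "superbase a b \<alpha> m1 n1 m2 n2"
  shows "superbase a b \<alpha> m1 n1 (- m2) (- n2)"
proof -
  obtain x1 y1 x2 y2 x3 y3 l k where p: "\<bar>m1 * n2 - m2 * n1\<bar> = 1" "mult_pt a b \<alpha> m1 n1 x1 y1"
    "mult_pt a b \<alpha> m2 n2 x2 y2" "mult_pt a b \<alpha> (- m1 - m2) (- n1 - n2) x3 y3"
    "collinear3 (emb [:b, a, 0, 1:]) (emb [:a:]) (emb [:b:]) (x1, y1) (x2, y2) (x3, y3) l k"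
    using assms(3) unfolding superbase_def by blast
  have par: "norm11 (- m1 - m2) (- n1 - n2) + norm11 (m2 - m1) (n2 - n1) = 2 * (norm11 m1 n1 + norm11 m2 n2)"
    by (simp add: norm11_def algebra_simps power2_eq_square)
  have "norm11 (m2 - m1) (n2 - n1) \<noteq> 0"
  proof
    assume "norm11 (m2 - m1) (n2 - n1) = 0"
    hence "m2 = m1" "n2 = n1" unfolding norm11_eq_0 by auto
    thus False using p(1) by simp
  qed
  note nz = this
  have aux: "nat C \<noteq> 2 * (nat A + nat B) \<and> 2 * (nat A + nat B) - nat C = nat E"
    if h: "C + E = 2 * (A + B)" "E \<noteq> 0" "0 \<le> A" "0 \<le> B" "0 \<le> C" "0 \<le> E" for A B C E :: int
  proof -
    obtain p q r t where "A = int p" "B = int q" "C = int r" "E = int t"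
      using h(3-6) by (metis nonneg_int_cases)
    thus ?thesis using h(1,2) by auto
  qed
  have h: "nat (norm11 (- m1 - m2) (- n1 - n2)) \<noteq> 2 * (nat (norm11 m1 n1) + nat (norm11 m2 n2))"
    and h': "2 * (nat (norm11 m1 n1) + nat (norm11 m2 n2)) - nat (norm11 (- m1 - m2) (- n1 - n2))
      = nat (norm11 (m2 - m1) (n2 - n1))"
    using aux[OF par nz norm11_nonneg norm11_nonneg norm11_nonneg norm11_nonneg] by blast+
  have c: "(of_int m2 + of_int n2 * \<alpha>) - (of_int m1 + of_int n1 * \<alpha>) = of_int (m2 - m1) + of_int (n2 - n1) * \<alpha>"
    by (simp add: algebra_simps)
  obtain x4 y4 l' k' where q: "mult_pt a b \<alpha> (m2 - m1) (n2 - n1) x4 y4"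
    "collinear3 (emb [:b, a, 0, 1:]) (emb [:a:]) (emb [:b:]) (x1, y1) (x2, - y2) (x4, y4) l' k'"
    using curve_pt_flip[OF p(2,3,4)[unfolded mult_pt_def] p(5) disc h] unfolding h' c mult_pt_def by blast
  have "mult_pt a b \<alpha> (- m2) (- n2) x2 (- y2)"
    using curve_pt_neg[OF p(3)[unfolded mult_pt_def]] by (simp add: mult_pt_def norm11_def)
  moreover have "\<bar>m1 * (- n2) - (- m2) * n1\<bar> = 1" using p(1) by (simp add: abs_minus_commute)
  moreover have "- m1 - (- m2) = m2 - m1" "- n1 - (- n2) = n2 - n1" by auto
  ultimately show ?thesis using p(2) q unfolding superbase_def by metis
qed

lemma superbase_add:
  fixes a :: "'k::alg_closed_field"
  assumes disc: "4 * a ^ 3 + 27 * b ^ 2 \<noteq> 0" "(2 :: 'k) \<noteq> 0"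
    and "superbase a b \<alpha> m1 n1 m2 n2"
  shows "superbase a b \<alpha> m1 n1 (m1 + m2) (n1 + n2)"
  using superbase_flip[OF disc superbase_third[OF assms(3)]] by (simp add: add.commute)

text \<open>The subtractive Euclidean algorithm on \<open>(i, j)\<close>: each subtraction is
  compensated by one \<open>superbase_add\<close> on the basis, until one entry is 0 and the other,
  by coprimality, is 1.\<close>

lemma superbase_reach_nat:
  fixes a :: "'k::alg_closed_field"
  assumes disc: "4 * a ^ 3 + 27 * b ^ 2 \<noteq> 0" "(2 :: 'k) \<noteq> 0"
    and "superbase a b \<alpha> m1 n1 m2 n2" "coprime i j"
  shows "\<exists>m n. superbase a b \<alpha> (int i * m1 + int j * m2) (int i * n1 + int j * n2) m n"
  using assms(3,4)
proof (induction "i + j" arbitrary: i j m1 n1 m2 n2 rule: less_induct)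
  case less
  consider "i = 0" | "j = 0" | "0 < j" "j \<le> i" | "0 < i" "i < j" by linarith
  thus ?case
  proof cases
    case 1
    hence "j = 1" using less.prems(2) by simp
    thus ?thesis using 1 superbase_swap[OF less.prems(1)] by auto
  next
    case 2
    hence "i = 1" using less.prems(2) by simp
    thus ?thesis using 2 less.prems(1) by auto
  next
    case 3
    have "coprime (i - j) j" using less.prems(2) 3
      by (metis coprime_diff_one_left_nat coprime_iff_gcd_eq_1 gcd_diff1_nat)
    from less.hyps[OF _ superbase_add[OF disc less.prems(1)] this] 3
    obtain m n where "superbase a b \<alpha> (int (i - j) * m1 + int j * (m1 + m2)) (int (i - j) * n1 + int j * (n1 + n2)) m n"
      by auto
    thus ?thesis using 3 by (auto simp: of_nat_diff algebra_simps)
  next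
    case 4
    have c: "coprime (j - i) i" using less.prems(2) 4
      by (metis coprime_commute coprime_iff_gcd_eq_1 gcd_diff1_nat less_or_eq_imp_le)
    from less.hyps[OF _ superbase_add[OF disc superbase_swap[OF less.prems(1)]] c] 4
    obtain m n where "superbase a b \<alpha> (int (j - i) * m2 + int i * (m2 + m1)) (int (j - i) * n2 + int i * (n2 + n1)) m n"
      by auto
    thus ?thesis using 4 by (auto simp: of_nat_diff algebra_simps)
  qed
qed

lemma superbase_reach:
  fixes a :: "'k::alg_closed_field"
  assumes disc: "4 * a ^ 3 + 27 * b ^ 2 \<noteq> 0" "(2 :: 'k) \<noteq> 0"
    and sb: "superbase a b \<alpha> 1 0 0 1" and cop: "coprime i j"
  shows "\<exists>m n. superbase a b \<alpha> i j m n"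
proof -
  have *: "\<exists>m n. superbase a b \<alpha> i j m n" if "0 \<le> j" "coprime i j" for i j
  proof (cases "0 \<le> i")
    case True
    have "coprime (nat i) (nat j)" using that True by (simp flip: coprime_int_iff)
    from superbase_reach_nat[OF disc sb this] show ?thesis using that True by simp
  next
    case False
    have "superbase a b \<alpha> (- 1) 0 0 1"
      using superbase_neg[OF superbase_flip[OF disc sb]] by simp
    moreover have "coprime (nat (- i)) (nat j)" using that False by (simp flip: coprime_int_iff)
    ultimately show ?thesis using superbase_reach_nat[OF disc, of \<alpha> "- 1" 0 0 1 "nat (- i)" "nat j"] that False by simp
  qed
  show ?thesis
  proof (cases "0 \<le> j")
    case False
    have "coprime (- i) (- j)" using cop by simp
    from *[OF _ this] False obtain m n where "superbase a b \<alpha> (- i) (- j) m n" by auto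
    from superbase_neg[OF this] show ?thesis by auto
  qed (use * cop in blast)
qed

section \<open>The endomorphism of degree three\<close>

text \<open>Velu's formulas for the isogeny with kernel \<open>{\<infinity>, \<plusminus>T}\<close>, \<open>x(T) = 12 - 2 \<alpha>\<close>, in terms of
  \<open>z = x - x(T)\<close>. Scaling by \<open>\<alpha>\<close> identifies the quotient with the curve \<open>y\<^sup>2 = x\<^sup>3 - 264 x + 1694\<close> itself.\<close>

definition isog_num :: "'a::comm_ring_1 \<Rightarrow> 'a \<Rightarrow> 'a" where
  "isog_num \<alpha> z = z ^ 3 + (12 - 2 * \<alpha>) * z ^ 2 + 264 * (1 - \<alpha>) * z - (616 + 704 * \<alpha>)"

definition isog_y_num :: "'a::comm_ring_1 \<Rightarrow> 'a \<Rightarrow> 'a" where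
  "isog_y_num \<alpha> z = z ^ 3 - 264 * (1 - \<alpha>) * z + 2 * (616 + 704 * \<alpha>)"

text \<open>\<open>z'\<close> is the counterpart of \<open>z\<close> for the conjugate
  \<open>1 - \<alpha>\<close>. The first identity puts the image on the curve. The other two serve
  the collinearity of the points of \<open>-1\<close>, \<open>\<alpha>\<close> and
  \<open>1 - \<alpha>\<close>, which have sum zero: one yields the slope of the line, the other the
  sum of the three abscissae.\<close>

lemma isog_identities:
  fixes \<alpha> z :: "'a::comm_ring_1"
  assumes \<alpha>: "\<alpha> * \<alpha> = \<alpha> - 3"
  defines "t \<equiv> z + 12 - 2 * \<alpha>" and "z' \<equiv> z + 2 - 4 * \<alpha>"
  shows "(t ^ 3 - 264 * t + 1694) * isog_y_num \<alpha> z ^ 2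
      = isog_num \<alpha> z ^ 3 - 264 * (\<alpha> - 3) ^ 2 * z ^ 4 * isog_num \<alpha> z + 1694 * (\<alpha> - 3) ^ 3 * z ^ 6" (is ?A)
    and "3 * z' * (isog_y_num \<alpha> z + \<alpha> * (\<alpha> - 3) * z ^ 3)
      = - 2 * \<alpha> * (t - 22) * (isog_num \<alpha> z - (\<alpha> - 3) * t * z ^ 2)" (is ?B)
    and "4 * (t ^ 3 - 264 * t + 1694) * (t - 22) ^ 2
      = isog_num \<alpha> z * z' ^ 2 * (- \<alpha> - 2) + isog_num (1 - \<alpha>) z' * z ^ 2 * (\<alpha> - 3) + 9 * t * z ^ 2 * z' ^ 2" (is ?C)
proof -
  have \<alpha>': "\<alpha> * (\<alpha> * w) = \<alpha> * w - 3 * w" for w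
    unfolding mult.assoc[symmetric] \<alpha> by (simp add: algebra_simps)
  note simps = isog_num_def isog_y_num_def t_def z'_def algebra_simps \<alpha> \<alpha>' eval_nat_numeral
  show ?A by (simp add: simps)
  show ?B by (simp add: simps)
  show ?C by (simp add: simps)
qed

text \<open>The numerator in the quotient rule for \<open>isog_num \<alpha> z / z^2\<close>; it
  makes the isogeny act by \<open>\<alpha>\<close> on the differential.\<close>

lemma isog_num_deriv:
  fixes z :: "'k::field fls"
  assumes "fls_deriv z = 1" "fls_deriv \<alpha> = 0"
  shows "fls_deriv (isog_num \<alpha> z) * z - 2 * isog_num \<alpha> z = isog_y_num \<alpha> z"
  unfolding isog_num_def isog_y_num_def
  by (simp add: assms eval_nat_numeral algebra_simps)

lemma isog_curve_pt:
  fixes \<alpha> :: "'k::field"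
  assumes \<alpha>: "\<alpha> * \<alpha> = \<alpha> - 3" and nz: "(2 :: 'k) \<noteq> 0" "(3 :: 'k) \<noteq> 0" "(11 :: 'k) \<noteq> 0"
  defines "z \<equiv> emb [:- (12 - 2 * \<alpha>), 1:]" and "e \<equiv> emb [:\<alpha>:]"
  shows "curve_pt (- 264) 1694 \<alpha> 3 (isog_num e z / ((e - 3) * z ^ 2)) (isog_y_num e z / (e * (e - 3) * z ^ 3))"
    and "z \<noteq> 0" "e \<noteq> 0" "e \<noteq> 3" "isog_num e z / ((e - 3) * z ^ 2) \<noteq> emb [:0, 1:]"
proof -
  define c where "c = 12 - 2 * \<alpha>"
  define u where "u = isog_num [:\<alpha>:] [:- c, 1:]"
  define v where "v = [:\<alpha> - 3:] * [:- c, 1:] ^ 2"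
  have \<alpha>0: "\<alpha> \<noteq> 0" using \<alpha> nz(2) by auto
  have \<alpha>3: "\<alpha> \<noteq> 3"
  proof
    assume "\<alpha> = 3"
    hence "3 * 3 = (0 :: 'k)" using \<alpha> by simp
    thus False using nz(2) by (metis mult_eq_0_iff)
  qed
  \<comment> \<open>Up to sign the value of the numerator at \<open>z = 0\<close>. Its norm
    \<open>2^6 * 3^3 * 11^3\<close> is nonzero, so nothing cancels against the denominator and the
    degree is exactly 3.\<close>
  have k0: "616 + 704 * \<alpha> \<noteq> 0"
  proof
    assume "616 + 704 * \<alpha> = 0"
    moreover have "(616 + 704 * \<alpha>) * (616 + 704 * (1 - \<alpha>)) = 2 ^ 6 * 3 ^ 3 * 11 ^ 3"
    proof -
      have "(616 + 704 * \<alpha>) * (616 + 704 * (1 - \<alpha>)) = 616 * 616 + 616 * 704 + 704 * 704 * (\<alpha> - \<alpha> * \<alpha>)"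
        by (simp add: algebra_simps)
      thus ?thesis unfolding \<alpha> by simp
    qed
    ultimately have "2 ^ 6 * 3 ^ 3 * 11 ^ 3 = (0 :: 'k)" by simp
    thus False using nz by (metis mult_eq_0_iff power_not_zero)
  qed
  have eu: "emb u = isog_num e z" and ev: "emb v = (e - 3) * z ^ 2"
  proof -
    have "[:\<alpha> - 3:] = [:\<alpha>:] - (3 :: 'k poly)" by (simp add: numeral_poly)
    thus "emb v = (e - 3) * z ^ 2" unfolding v_def c_def z_def e_def by (simp only: emb_simps emb_numeral)
    show "emb u = isog_num e z" unfolding u_def c_def z_def e_def isog_num_def
      by (simp only: emb_simps emb_numeral)
  qed
  show e0: "e \<noteq> 0" using \<alpha>0 by (simp add: e_def)
  have z': "z = emb [:- c, 1:]" by (simp add: z_def c_def)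
  show z0: "z \<noteq> 0" by (simp add: z')
  show e3: "e \<noteq> 3"
  proof
    assume "e = 3"
    hence "emb [:\<alpha>:] = emb 3" by (simp add: e_def)
    hence "[:\<alpha>:] = 3" by (simp only: emb_eq_iff)
    thus False using \<alpha>3 by (simp add: numeral_poly)
  qed
  have v0: "v \<noteq> 0" using \<alpha>3 by (simp add: v_def)
  have pu: "poly u r = isog_num \<alpha> (r - c)" for r by (simp add: u_def isog_num_def algebra_simps)
  have nr: "no_common_root u v"
    unfolding no_common_root_def
  proof
    fix r
    show "poly u r \<noteq> 0 \<or> poly v r \<noteq> 0"
      using k0 \<alpha>3 by (cases "r = c") (auto simp: pu v_def isog_num_def)
  qed
  have du: "degree u = 3"
  proof -
    define Z where "Z = [:- c, 1:]"
    have "12 - 2 * [:\<alpha>:] = [:12 - 2 * \<alpha>:]" "264 * (1 - [:\<alpha>:]) = [:264 * (1 - \<alpha>):]"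
      "616 + 704 * [:\<alpha>:] = [:616 + 704 * \<alpha>:]"
      by (simp_all add: numeral_poly one_pCons)
    hence u: "u = Z ^ 3 + ([:12 - 2 * \<alpha>:] * Z ^ 2 + [:264 * (1 - \<alpha>):] * Z - [:616 + 704 * \<alpha>:])"
      unfolding u_def isog_num_def Z_def[symmetric] by (simp only: algebra_simps)
    have dZ: "degree (Z ^ n) = n" for n by (simp add: Z_def degree_power_eq)
    have "degree ([:12 - 2 * \<alpha>:] * Z ^ 2) \<le> 2" "degree ([:264 * (1 - \<alpha>):] * Z) \<le> 2"
      using degree_mult_le[of "[:12 - 2 * \<alpha>:]" "Z ^ 2"] degree_mult_le[of "[:264 * (1 - \<alpha>):]" Z]
        dZ[of 2] dZ[of 1] by simp_all
    hence "degree ([:12 - 2 * \<alpha>:] * Z ^ 2 + [:264 * (1 - \<alpha>):] * Z - [:616 + 704 * \<alpha>:]) \<le> 2"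
      by (intro degree_diff_le degree_add_le) simp_all
    thus ?thesis unfolding u using dZ[of 3] by (simp add: degree_add_eq_left)
  qed
  have dv: "degree v = 2" using \<alpha>3 by (simp add: v_def degree_power_eq)
  define X where "X = isog_num e z / ((e - 3) * z ^ 2)"
  define Y where "Y = isog_y_num e z / (e * (e - 3) * z ^ 3)"
  have X: "X * emb v = emb u" unfolding X_def eu ev using z0 e3 by simp
  have ee: "e * e = e - 3"
  proof -
    have "[:\<alpha>:] * [:\<alpha>:] = [:\<alpha>:] - (3 :: 'k poly)" using \<alpha> by (simp add: numeral_poly)
    hence "emb ([:\<alpha>:] * [:\<alpha>:]) = emb ([:\<alpha>:] - 3)" by (rule arg_cong)
    thus ?thesis by (simp only: e_def emb_simps emb_numeral)
  qed
  have "[:0, 1:] = [:- c, 1:] + 12 - 2 * [:\<alpha>:]" by (simp add: c_def numeral_poly)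
  hence "emb [:0, 1:] = emb ([:- c, 1:] + 12 - 2 * [:\<alpha>:])" by (rule arg_cong)
  hence T: "emb [:0, 1:] = z + 12 - 2 * e" by (simp only: z' e_def emb_simps emb_numeral)
  have F: "emb [:1694, - 264, 0, 1:] = (z + 12 - 2 * e) ^ 3 - 264 * (z + 12 - 2 * e) + 1694"
    by (simp add: emb_cubic T)
  have curve: "emb [:1694, - 264, 0, 1:] * Y ^ 2 = X ^ 3 + emb [:- 264:] * X + emb [:1694:]"
  proof -
    define N where "N = isog_num e z"
    define M where "M = isog_y_num e z"
    define q where "q = e - 3"
    have q0: "q \<noteq> 0" using e3 by (simp add: q_def)
    have A: "emb [:1694, - 264, 0, 1:] * M ^ 2 = N ^ 3 - 264 * q ^ 2 * z ^ 4 * N + 1694 * q ^ 3 * z ^ 6"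
      using isog_identities(1)[OF ee, of z] unfolding F N_def M_def q_def .
    have Y2: "Y ^ 2 = M ^ 2 / (q ^ 3 * z ^ 6)"
    proof -
      have "(e * q * z ^ 3) ^ 2 = (e * e) * q ^ 2 * z ^ 6" by (simp add: power_mult_distrib power2_eq_square flip: power_mult power_add)
      also have "\<dots> = q ^ 3 * z ^ 6" unfolding ee q_def[symmetric] by (simp add: power2_eq_square power3_eq_cube)
      finally show ?thesis unfolding Y_def M_def[symmetric] q_def[symmetric] by (simp add: power_divide)
    qed
    have X3: "X = N * q ^ 2 * z ^ 4 / (q ^ 3 * z ^ 6)" "X ^ 3 = N ^ 3 / (q ^ 3 * z ^ 6)"
      unfolding X_def N_def[symmetric] q_def[symmetric] using q0 z0
      by (simp_all add: field_simps power_mult_distrib eval_nat_numeral)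
    show ?thesis unfolding Y2 X3(2) unfolding X3(1) emb_const_numeral using A q0 z0
      by (simp add: field_simps)
  qed
  have "ratfun e" "ratfun z" "ratfun (numeral k :: 'k fls)" "ratfun (1 :: 'k fls)" for k
    using ratfun_emb[of "numeral k"] ratfun_emb[of 1] ratfun_emb by (simp_all add: e_def z')
  hence Yrat: "ratfun Y" unfolding Y_def isog_y_num_def
    by (intro ratfun_add ratfun_diff ratfun_mult ratfun_divide ratfun_power)
  have dz: "fls_deriv z = 1" by (simp add: z' deriv_emb pderiv_pCons)
  have de: "fls_deriv e = 0" by (simp add: e_def)
  have deriv: "fls_deriv X = emb [:\<alpha>:] * Y"
  proof -
    have "X * ((e - 3) * z ^ 2) = isog_num e z" unfolding X_def using z0 e3 by simp
    hence "fls_deriv (X * ((e - 3) * z ^ 2)) = fls_deriv (isog_num e z)" by simp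
    hence d: "fls_deriv X * ((e - 3) * z ^ 2) + X * ((e - 3) * (2 * z)) = fls_deriv (isog_num e z)"
      by (simp add: dz de algebra_simps eval_nat_numeral)
    have "fls_deriv X * ((e - 3) * z ^ 3) = fls_deriv (isog_num e z) * z - 2 * (X * ((e - 3) * z ^ 2))"
      unfolding d[symmetric] by (simp add: algebra_simps eval_nat_numeral)
    also have "\<dots> = isog_y_num e z"
      using isog_num_deriv[OF dz de] \<open>X * ((e - 3) * z ^ 2) = isog_num e z\<close> by simp
    also have "\<dots> = e * Y * ((e - 3) * z ^ 3)" unfolding Y_def using e0 e3 z0 by (simp add: field_simps)
    finally show ?thesis using e3 z0 unfolding e_def[symmetric] by simp
  qed
  show "curve_pt (- 264) 1694 \<alpha> 3 (isog_num e z / ((e - 3) * z ^ 2)) (isog_y_num e z / (e * (e - 3) * z ^ 3))"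
    unfolding X_def[symmetric] Y_def[symmetric] curve_pt_def
    using v0 nr du dv X curve deriv Yrat by (intro conjI exI[of _ u] exI[of _ v]) simp_all
  show "isog_num e z / ((e - 3) * z ^ 2) \<noteq> emb [:0, 1:]"
    unfolding X_def[symmetric]
  proof
    assume "X = emb [:0, 1:]"
    hence "emb ([:0, 1:] * v) = emb u" using X by (simp only: emb_simps)
    hence "poly ([:0, 1:] * v) c = poly u c" by (simp only: emb_eq_iff)
    thus False using k0 by (simp add: v_def pu isog_num_def)
  qed
qed

lemma base_curve_pt: "curve_pt a b (1 :: 'k::field) 1 (emb [:0, 1:]) 1"
proof -
  note emb_cubic[of b a]
  moreover have "no_common_root [:0, 1:] (1 :: 'k poly)" by (simp add: no_common_root_def)
  moreover have "fls_deriv (emb [:0, 1 :: 'k:]) = 1" by (simp add: deriv_emb pderiv_pCons)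
  ultimately show ?thesis
    unfolding curve_pt_def using ratfun_emb[of 1]
    by (intro conjI exI[of _ "[:0, 1:]"] exI[of _ 1]) simp_all
qed

lemma cm_disc:
  assumes "(2 :: 'k::field) \<noteq> 0" "(3 :: 'k) \<noteq> 0" "(11 :: 'k) \<noteq> 0"
  shows "4 * (- 264 :: 'k) ^ 3 + 27 * 1694 ^ 2 \<noteq> 0"
proof -
  have "2 ^ 2 * 3 ^ 6 * 11 ^ 3 = (3881196 :: 'k)" by simp
  hence "(3881196 :: 'k) \<noteq> 0" using assms by (metis mult_eq_0_iff power_not_zero)
  thus ?thesis by simp
qed

text \<open>The explicit superbase is \<open>-1\<close>, \<open>\<alpha>\<close>,
  \<open>1 - \<alpha>\<close>; one flip replaces \<open>-1\<close> by \<open>1\<close>. The formulas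
  for \<open>1 - \<alpha>\<close> are those for \<open>\<alpha>\<close>, since both are roots of
  \<open>X^2 - X + 3\<close>.\<close>

lemma superbase_cm:
  fixes \<alpha> :: "'k::alg_closed_field"
  assumes \<alpha>: "\<alpha> * \<alpha> = \<alpha> - 3" and nz: "(2 :: 'k) \<noteq> 0" "(3 :: 'k) \<noteq> 0" "(11 :: 'k) \<noteq> 0"
  shows "superbase (- 264) 1694 \<alpha> 1 0 0 1"
proof -
  define \<beta> where "\<beta> = 1 - \<alpha>"
  have \<beta>: "\<beta> * \<beta> = \<beta> - 3" using \<alpha> by (simp add: \<beta>_def algebra_simps)
  define e where "e = emb [:\<alpha>:]"
  define z where "z = emb [:- (12 - 2 * \<alpha>), 1:]"
  define z' where "z' = emb [:- (12 - 2 * \<beta>), 1:]"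
  define T where "T = emb [:0, 1 :: 'k:]"
  have eb: "emb [:\<beta>:] = 1 - e"
  proof -
    have "[:\<beta>:] = 1 - [:\<alpha>:]" by (simp add: \<beta>_def one_pCons)
    hence "emb [:\<beta>:] = emb (1 - [:\<alpha>:])" by (rule arg_cong)
    thus ?thesis by (simp only: e_def emb_simps)
  qed
  have "[:- (12 - 2 * \<beta>), 1:] = [:- (12 - 2 * \<alpha>), 1:] + 2 - 4 * [:\<alpha>:]" by (simp add: \<beta>_def numeral_poly)
  hence "emb [:- (12 - 2 * \<beta>), 1:] = emb ([:- (12 - 2 * \<alpha>), 1:] + 2 - 4 * [:\<alpha>:])" by (rule arg_cong)
  hence z': "z' = z + 2 - 4 * e" by (simp only: z_def e_def z'_def emb_simps emb_numeral)
  have "[:0, 1:] = [:- (12 - 2 * \<alpha>), 1:] + 12 - 2 * [:\<alpha>:]" by (simp add: numeral_poly)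
  hence "emb [:0, 1:] = emb ([:- (12 - 2 * \<alpha>), 1:] + 12 - 2 * [:\<alpha>:])" by (rule arg_cong)
  hence T: "T = z + 12 - 2 * e" by (simp only: z_def e_def T_def emb_simps emb_numeral)
  have ee: "e * e = e - 3"
  proof -
    have "[:\<alpha>:] * [:\<alpha>:] = [:\<alpha>:] - (3 :: 'k poly)" using \<alpha> by (simp add: numeral_poly)
    hence "emb ([:\<alpha>:] * [:\<alpha>:]) = emb ([:\<alpha>:] - 3)" by (rule arg_cong)
    thus ?thesis by (simp only: e_def emb_simps emb_numeral)
  qed
  define F where "F = emb [:1694, - 264, 0, 1 :: 'k:]"
  have F: "F = T ^ 3 - 264 * T + 1694" by (simp add: F_def T_def emb_cubic)
  define X Y where "X = isog_num e z / ((e - 3) * z ^ 2)" and "Y = isog_y_num e z / (e * (e - 3) * z ^ 3)"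
  define X' Y' where "X' = isog_num (1 - e) z' / ((1 - e - 3) * z' ^ 2)"
    and "Y' = isog_y_num (1 - e) z' / ((1 - e) * (1 - e - 3) * z' ^ 3)"
  note Q = isog_curve_pt[OF \<alpha> nz, folded z_def e_def, folded X_def Y_def T_def]
  note Q' = isog_curve_pt[OF \<beta> nz, folded z'_def, unfolded eb, folded X'_def Y'_def]
  have three: "(3 :: 'k fls) \<noteq> 0"
  proof -
    have "(3 :: 'k poly) \<noteq> 0" using nz by (simp add: numeral_poly)
    hence "emb (3 :: 'k poly) \<noteq> 0" by (simp only: emb_eq_0_iff not_False_eq_True)
    thus ?thesis by simp
  qed
  have P: "curve_pt (- 264) 1694 (- 1) 1 T (- 1)"
    using curve_pt_neg[OF base_curve_pt] by (simp add: T_def)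
  define l where "l = (Y - (- 1)) / (X - T)"
  have col: "collinear3 F (emb [:- 264:]) (emb [:1694:]) (T, - 1) (X, Y)
      (F * l ^ 2 - T - X, - 1 + l * (F * l ^ 2 - T - X - T)) l (- 1 - l * T)"
    unfolding l_def F_def
    by (rule collinear3_chord) (use P Q(1,5) in \<open>auto simp: curve_pt_def\<close>)
  have l: "3 * z * z' * l = - 2 * (T - 22)"
  proof -
    have "3 * z * z' * (Y + 1) = 3 * z' * (isog_y_num e z + e * (e - 3) * z ^ 3) / (e * (e - 3) * z ^ 2)"
      unfolding Y_def using Q(2-4) by (simp add: field_simps eval_nat_numeral)
    also have "3 * z' * (isog_y_num e z + e * (e - 3) * z ^ 3) = - 2 * e * (T - 22) * (isog_num e z - (e - 3) * T * z ^ 2)"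
      using isog_identities(2)[OF ee, of z] unfolding T z' .
    also have "- 2 * e * (T - 22) * (isog_num e z - (e - 3) * T * z ^ 2) / (e * (e - 3) * z ^ 2) = - 2 * (T - 22) * (X - T)"
      unfolding X_def using Q(2-4) by (simp add: field_simps)
    finally show ?thesis unfolding l_def using Q(5) by (simp add: field_simps)
  qed
  have x3: "F * l ^ 2 - T - X = X'"
  proof -
    have "(3 * z * z') ^ 2 * (F * l ^ 2) = F * (3 * z * z' * l) ^ 2" by (simp add: power_mult_distrib)
    also have "\<dots> = 4 * F * (T - 22) ^ 2" unfolding l by (simp add: power2_eq_square algebra_simps)
    also have "\<dots> = isog_num e z * z' ^ 2 * (- e - 2) + isog_num (1 - e) z' * z ^ 2 * (e - 3) + 9 * T * z ^ 2 * z' ^ 2"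
      unfolding F using isog_identities(3)[OF ee, of z] unfolding T z' .
    also have "isog_num e z = X * (e - 3) * z ^ 2" unfolding X_def using Q(2-4) by simp
    also have "isog_num (1 - e) z' = X' * (1 - e - 3) * z' ^ 2" 
    proof -
      have "1 - e - 3 \<noteq> 0" using Q'(4) by (metis right_minus_eq)
      moreover have "w / (k * q) * k * q = w" if "k \<noteq> 0" "q \<noteq> 0" for w k q :: "'k fls" using that by simp
      ultimately show ?thesis unfolding X'_def using Q'(2) by (metis power_not_zero)
    qed
    also have "X * (e - 3) * z ^ 2 * z' ^ 2 * (- e - 2) + X' * (1 - e - 3) * z' ^ 2 * z ^ 2 * (e - 3) + 9 * T * z ^ 2 * z' ^ 2
      = (z ^ 2 * z' ^ 2) * ((X + X') * (e + 6 - e * e) + 9 * T)"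
      by (simp add: algebra_simps)
    also have "\<dots> = (3 * z * z') ^ 2 * (X + X' + T)" unfolding ee by (simp add: power_mult_distrib algebra_simps)
    finally have "F * l ^ 2 = X + X' + T" using Q(2) Q'(2) three by simp
    thus ?thesis by simp
  qed
  have m1: "emb [:- 1 :: 'k:] = - 1"
  proof -
    have "emb [:- 1 :: 'k:] = emb (- 1)" by (rule arg_cong) (simp add: one_pCons)
    thus ?thesis by (simp only: emb_simps)
  qed
  \<comment> \<open>No further polynomial identity is required: the abscissa determines the ordinate
    by differentiation, as \<open>1 - e\<close> is nonzero.\<close>
  have y3: "- 1 + l * (F * l ^ 2 - T - X - T) = Y'"
  proof -
    have "fls_deriv (F * l ^ 2 - T - X) = - (- 1 + e) * (- 1 + l * (F * l ^ 2 - T - X - T))"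
      by (rule chord_deriv[OF col])
        (use P Q(1,5) curve_pt_y_nonzero[OF Q(1)] in \<open>auto simp: curve_pt_def e_def m1\<close>)
    moreover have "fls_deriv X' = (1 - e) * Y'" using Q'(1) unfolding curve_pt_def eb by auto
    ultimately have "(1 - e) * (- 1 + l * (F * l ^ 2 - T - X - T)) = (1 - e) * Y'"
      unfolding x3 by (simp only: minus_add_distrib minus_minus add_uminus_conv_diff)
    thus ?thesis using Q'(3) by simp
  qed
  have "collinear3 F (emb [:- 264:]) (emb [:1694:]) (X, Y) (X', Y') (T, - 1) l (- 1 - l * T)"
    using collinear3_rotate[OF col] unfolding x3[symmetric] y3[symmetric] .
  moreover have "mult_pt (- 264) 1694 \<alpha> 0 1 X Y" "mult_pt (- 264) 1694 \<alpha> 1 (- 1) X' Y'"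
    "mult_pt (- 264) 1694 \<alpha> (- 0 - 1) (- 1 - (- 1)) T (- 1)"
    using Q(1) Q'(1) P by (simp_all add: mult_pt_def norm11_def \<beta>_def)
  ultimately have sb: "superbase (- 264) 1694 \<alpha> 0 1 1 (- 1)"
    unfolding superbase_def F_def by (intro conjI exI) auto
  show ?thesis
    using superbase_swap[OF superbase_flip[OF cm_disc[OF nz] nz(1) superbase_third[OF sb]]] by simp
qed

section \<open>Adding the Frobenius endomorphism\<close>

lemma cubic_separable:
  fixes a b r :: "'k::field"
  assumes "4 * a ^ 3 + 27 * b ^ 2 \<noteq> 0" "poly [:b, a, 0, 1:] r = 0"
  shows "poly (pderiv [:b, a, 0, 1:]) r \<noteq> 0"
proof
  assume "poly (pderiv [:b, a, 0, 1:]) r = 0"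
  hence a2: "3 * r ^ 2 + a = 0" by (simp add: pderiv_pCons algebra_simps power2_eq_square)
  have a1: "r ^ 3 + a * r + b = 0" using assms(2) by (simp add: algebra_simps eval_nat_numeral)
  have "3 * (r ^ 3 + a * r + b) - r * (3 * r ^ 2 + a) = 2 * a * r + 3 * b"
    by (simp add: algebra_simps power2_eq_square power3_eq_cube)
  hence a3: "2 * a * r = - 3 * b" unfolding a1 a2 by (simp add: eq_neg_iff_add_eq_0)
  have "4 * a ^ 2 * (3 * r ^ 2 + a) = 3 * (2 * a * r) ^ 2 + 4 * a ^ 3"
    by (simp add: algebra_simps power2_eq_square power3_eq_cube)
  hence "4 * a ^ 3 + 27 * b ^ 2 = 0" unfolding a2 a3 by (simp add: power2_eq_square add.commute)
  thus False using assms(1) by simp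
qed

definition regular_at :: "'k::field \<Rightarrow> 'k fls \<Rightarrow> bool" where
  "regular_at r x \<longleftrightarrow> (\<exists>q d. poly d r \<noteq> 0 \<and> x * emb d = emb q)"

lemma regular_everywhere_poly:
  fixes x :: "'k::alg_closed_field fls"
  assumes "\<And>r. regular_at r x"
  shows "\<exists>e. x = emb e"
proof -
  obtain q d where qd: "poly d 0 \<noteq> 0" "x * emb d = emb q" using assms[of 0] by (auto simp: regular_at_def)
  hence "ratfun x" unfolding ratfun_def by (metis poly_0)
  then obtain u v where uv: "v \<noteq> 0" "no_common_root u v" and xv: "x * emb v = emb u"
    using ratfun_lowest_terms by blast
  have "poly v r \<noteq> 0" for r
  proof
    assume r: "poly v r = 0"
    obtain q2 d2 where q2: "poly d2 r \<noteq> 0" "x * emb d2 = emb q2" using assms[of r] by (auto simp: regular_at_def)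
    have "emb (u * d2) = emb (q2 * v)" by (simp add: mult_ac flip: xv q2(2))
    hence "u * d2 = q2 * v" by (simp only: emb_eq_iff)
    hence "poly u r * poly d2 r = 0" using r by (metis mult_zero_right poly_mult)
    thus False using q2(1) r uv(2) by (auto simp: no_common_root_def)
  qed
  hence "degree v = 0" using alg_closed_imp_poly_has_root[of v] by blast
  then obtain c where c: "v = [:c:]" by (metis degree_eq_zeroE)
  hence "c \<noteq> 0" using uv(1) by auto
  have "emb [:c:] * emb [:1 / c:] = emb ([:c:] * [:1 / c:])" by (simp only: emb_simps)
  also have "\<dots> = 1" using \<open>c \<noteq> 0\<close> by (simp flip: one_pCons)
  finally have "x = x * (emb [:c:] * emb [:1 / c:])" by simp
  also have "\<dots> = emb (u * [:1 / c:])" using xv unfolding c by (simp only: emb_simps mult.assoc[symmetric])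
  finally show ?thesis by blast
qed

lemma coeff_mult_top:
  fixes P Q :: "'a::comm_semiring_0 poly"
  assumes "degree P \<le> i" "degree Q \<le> j"
  shows "coeff (P * Q) (i + j) = coeff P i * coeff Q j"
proof -
  have "coeff (P * Q) (i + j) = (\<Sum>k\<le>i + j. coeff P k * coeff Q (i + j - k))"
    by (rule coeff_mult)
  also have "\<dots> = (\<Sum>k\<in>{i}. coeff P k * coeff Q (i + j - k))"
  proof (rule sum.mono_neutral_right)
    show "\<forall>k\<in>{..i + j} - {i}. coeff P k * coeff Q (i + j - k) = 0"
    proof
      fix k assume "k \<in> {..i + j} - {i}"
      hence "i < k \<or> j < i + j - k" by auto
      thus "coeff P k * coeff Q (i + j - k) = 0"
        using assms by (auto simp: coeff_eq_0)
    qed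
  qed auto
  finally show ?thesis by simp
qed

text \<open>The logarithmic derivative of the denominator \<open>V\<close> of \<open>x(\<Pi> + \<delta>)\<close>, where \<open>\<Pi>\<close> is the Frobenius map, agrees
  up to a polynomial and the contribution of \<open>\<delta>\<close> with \<open>c\<close> times the slope \<open>l\<close> of the line through \<open>\<Pi>\<close> and
  \<open>\<delta>\<close>. Comparing the coefficients of \<open>1 / t\<close> at infinity gives \<open>deg V\<close> modulo \<open>p\<close>, and that of the slope is
  the Hasse invariant.\<close>

lemma frobenius_add_degree:
  fixes a b c :: "'k::alg_closed_field"
  defines "f \<equiv> [:b, a, 0, 1:]"
  assumes p: "CHAR('k) = p" "p = 2 * m + 1" "0 < m"
    and disc: "4 * a ^ 3 + 27 * b ^ 2 \<noteq> 0" and l0: "c \<noteq> 0"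
    and \<delta>: "V\<delta> \<noteq> 0" "no_common_root U\<delta> V\<delta>" "degree U\<delta> = degree V\<delta> + 1" "x\<delta> * emb V\<delta> = emb U\<delta>"
      "fls_deriv x\<delta> = emb [:c:] * y\<delta>"
    and R: "V \<noteq> 0" "no_common_root U V" "xR * emb V = emb U" "fls_deriv xR = - emb [:c:] * yR"
    and col: "collinear3 (emb f) (emb [:a:]) (emb [:b:]) (emb (monom 1 p), emb (f ^ m)) (x\<delta>, y\<delta>) (xR, yR) l n"
  shows "(of_nat (degree V) :: 'k) = of_nat (degree V\<delta>) + c * coeff (f ^ m) (p - 1)"
proof -
  define \<phi> :: "'k poly" where "\<phi> = monom 1 p"
  define g where "g = f ^ m"
  define L where "L = emb [:c:]"
  have L0: "L \<noteq> 0" using l0 by (simp add: L_def)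
  have p0: "(of_nat p :: 'k) = 0" using of_nat_CHAR[where ?'a = 'k] p(1) by simp
  hence d\<phi>: "pderiv \<phi> = 0" by (simp add: \<phi>_def pderiv_monom)
  define W where "W = U\<delta> - \<phi> * V\<delta>"
  define U1 where "U1 = U - \<phi> * V"
  have y: "emb g = l * emb \<phi> + n" "y\<delta> = l * x\<delta> + n" "yR = l * xR + n"
    and e1: "emb f * l ^ 2 = emb \<phi> + x\<delta> + xR"
    using col unfolding collinear3_def \<phi>_def g_def by auto
  have yR: "yR = emb g + l * (xR - emb \<phi>)" and y\<delta>: "y\<delta> = emb g + l * (x\<delta> - emb \<phi>)"
    by (simp_all add: y algebra_simps)
  \<comment> \<open>The logarithmic derivatives cancel the poles of \<open>L * l\<close> at the
    zeros of \<open>V\<close> and \<open>V\<delta>\<close>; the aim is that only a polynomial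
    remains.\<close>
  define E where "E = emb (pderiv V) / emb V - emb (pderiv V\<delta>) / emb V\<delta> - L * l"
  have degW: "degree W = p + degree V\<delta>" and lcW: "coeff W (p + degree V\<delta>) = - lead_coeff V\<delta>"
  proof -
    have "\<phi> \<noteq> 0" by (simp add: \<phi>_def)
    hence d: "degree (\<phi> * V\<delta>) = p + degree V\<delta>" using \<delta>(1) by (simp add: degree_mult_eq \<phi>_def degree_monom_eq)
    have lt: "degree U\<delta> < p + degree V\<delta>" using \<delta>(3) p by simp
    hence "degree U\<delta> < degree (- (\<phi> * V\<delta>))" using d by simp
    from degree_add_eq_right[OF this] show "degree W = p + degree V\<delta>" unfolding W_def using d by simp
    have "coeff (\<phi> * V\<delta>) (p + degree V\<delta>) = lead_coeff V\<delta>"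
      by (simp add: \<phi>_def coeff_monom_mult)
    thus "coeff W (p + degree V\<delta>) = - lead_coeff V\<delta>" unfolding W_def using lt by (simp add: coeff_eq_0)
  qed
  have W0: "W \<noteq> 0" using degW p by auto
  \<comment> \<open>As \<open>\<phi>\<close> has derivative zero, \<open>X = xR - \<phi>\<close>
    satisfies \<open>X' = - L (g + l X)\<close>. Multiplication by its numerator \<open>U1\<close>
    clears the poles at zeros of \<open>V\<close>; \<open>F2\<close> does the same for
    \<open>V\<delta>\<close>.\<close>
  have F1: "(emb (pderiv V) / emb V - L * l) * emb U1 = emb (pderiv U1) + L * emb g * emb V"
  proof -
    define X where "X = xR - emb \<phi>"
    have X: "X * emb V = emb U1" unfolding X_def U1_def using R(3) by (simp add: algebra_simps)
    have dX: "fls_deriv X = - L * (emb g + l * X)"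
      unfolding X_def using R(4) yR d\<phi> by (simp add: deriv_emb L_def)
    have "emb (pderiv U1) = fls_deriv (X * emb V)" unfolding X by (simp add: deriv_emb)
    also have "\<dots> = - L * (emb g + l * X) * emb V + X * emb (pderiv V)" by (simp add: dX deriv_emb algebra_simps)
    finally have "emb (pderiv U1) + L * emb g * emb V = X * emb (pderiv V) - L * l * (X * emb V)"
      by (simp add: algebra_simps)
    also have "\<dots> = (emb (pderiv V) / emb V - L * l) * (X * emb V)" using R(1) by (simp add: field_simps)
    finally show ?thesis unfolding X by (rule sym)
  qed
  have F2: "(emb (pderiv V\<delta>) / emb V\<delta> + L * l) * emb W = emb (pderiv W) - L * emb g * emb V\<delta>"
  proof -
    define X where "X = x\<delta> - emb \<phi>"
    have X: "X * emb V\<delta> = emb W" unfolding X_def W_def using \<delta>(4) by (simp add: algebra_simps)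
    have dX: "fls_deriv X = L * (emb g + l * X)"
      unfolding X_def using \<delta>(5) y\<delta> d\<phi> by (simp add: deriv_emb L_def)
    have "emb (pderiv W) = fls_deriv (X * emb V\<delta>)" unfolding X by (simp add: deriv_emb)
    also have "\<dots> = L * (emb g + l * X) * emb V\<delta> + X * emb (pderiv V\<delta>)" by (simp add: dX deriv_emb algebra_simps)
    finally have "emb (pderiv W) - L * emb g * emb V\<delta> = X * emb (pderiv V\<delta>) + L * l * (X * emb V\<delta>)"
      by (simp add: algebra_simps)
    also have "\<dots> = (emb (pderiv V\<delta>) / emb V\<delta> + L * l) * (X * emb V\<delta>)" using \<delta>(1) by (simp add: field_simps)
    finally show ?thesis unfolding X by (rule sym)
  qed
  have E1: "E * emb (U1 * V\<delta>) = emb ((pderiv U1 + [:c:] * g * V) * V\<delta> - pderiv V\<delta> * U1)"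
  proof -
    have "E * emb (U1 * V\<delta>) = (emb (pderiv V) / emb V - L * l) * emb U1 * emb V\<delta> - emb (pderiv V\<delta>) * emb U1"
      unfolding E_def using \<delta>(1) by (simp add: field_simps)
    thus ?thesis unfolding F1 by (simp add: L_def del: mult_pCons_left)
  qed
  have E2: "E * emb (V * W) = emb (pderiv V * W - (pderiv W - [:c:] * g * V\<delta>) * V)"
  proof -
    have "E * emb (V * W) = emb (pderiv V) * emb W - (emb (pderiv V\<delta>) / emb V\<delta> + L * l) * emb W * emb V"
      unfolding E_def using R(1) by (simp add: field_simps)
    thus ?thesis unfolding F2 by (simp add: L_def del: mult_pCons_left)
  qed
  \<comment> \<open>Where \<open>\<delta>\<close> takes the value infinity, Frobenius is finite, so
    their sum is finite as well.\<close>
  have star: "poly V r \<noteq> 0" if r: "poly V\<delta> r = 0" for r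
  proof
    assume V: "poly V r = 0"
    define D S G where "D = kummer_D \<phi> 1 U\<delta> V\<delta>" and "S = kummer_S [:a:] [:b:] \<phi> 1 U\<delta> V\<delta>"
      and "G = kummer_G [:a:] [:b:] \<phi> 1 U\<delta> V\<delta>"
    define q where "q = (1 * emb V\<delta>) ^ 2"
    have DSG: "emb D = q * kummer_D (emb \<phi>) 1 x\<delta> 1" "emb S = q * kummer_S (emb [:a:]) (emb [:b:]) (emb \<phi>) 1 x\<delta> 1"
      "emb G = q * kummer_G (emb [:a:]) (emb [:b:]) (emb \<phi>) 1 x\<delta> 1"
      unfolding D_def S_def G_def emb_kummer \<delta>(4)[symmetric] q_def
      using kummer_homogeneous(1)[of "emb \<phi>" 1 x\<delta> "emb V\<delta>"]
        kummer_homogeneous(2,3)[where ?x1.0 = "emb \<phi>" and ?v1.0 = 1 and ?x2.0 = x\<delta> and ?v2.0 = "emb V\<delta>"] by simp_all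
    have "q * (kummer_D (emb \<phi>) 1 x\<delta> 1 * xR ^ 2 - kummer_S (emb [:a:]) (emb [:b:]) (emb \<phi>) 1 x\<delta> 1 * xR
        + kummer_G (emb [:a:]) (emb [:b:]) (emb \<phi>) 1 x\<delta> 1) * emb V ^ 2 = 0"
      using collinear3_kummer[OF col] unfolding \<phi>_def by simp
    hence "emb (D * U ^ 2 - S * U * V + G * V ^ 2) = 0"
      by (simp add: DSG algebra_simps power2_eq_square flip: R(3))
    hence "D * U ^ 2 - S * U * V + G * V ^ 2 = 0" by (simp only: emb_eq_0_iff)
    hence "poly (D * U ^ 2 - S * U * V + G * V ^ 2) r = 0" by simp
    hence "poly D r * poly U r ^ 2 = 0" using V by simp
    moreover have "poly U r \<noteq> 0" using V R(2) by (auto simp: no_common_root_def)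
    ultimately have "poly D r = 0" by simp
    hence "poly U\<delta> r = 0" using r by (simp add: D_def kummer_D_def)
    thus False using r \<delta>(2) by (auto simp: no_common_root_def)
  qed
  have reg: "regular_at r E" for r
  proof -
    consider "poly (V * W) r \<noteq> 0" | "poly (U1 * V\<delta>) r \<noteq> 0" | "poly (V * W) r = 0" "poly (U1 * V\<delta>) r = 0" by blast
    thus ?thesis
    proof cases
      case 1
      thus ?thesis using E2 unfolding regular_at_def by blast
    next
      case 2
      thus ?thesis using E1 unfolding regular_at_def by blast
    next
      case 3
      \<comment> \<open>Neither \<open>E1\<close> nor \<open>E2\<close> applies. In this case
        \<open>V\<close> and \<open>V\<delta>\<close> are both nonzero at \<open>r\<close>, and
        regularity of the slope \<open>l\<close> itself remains to be shown.\<close>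
      have V\<delta>r: "poly V\<delta> r \<noteq> 0"
      proof
        assume z: "poly V\<delta> r = 0"
        hence "poly W r \<noteq> 0" using \<delta>(2) by (auto simp: W_def no_common_root_def)
        thus False using star[OF z] 3(1) by simp
      qed
      hence "poly U1 r = 0" using 3(2) by simp
      hence Vr: "poly V r \<noteq> 0" using R(2) by (auto simp: U1_def no_common_root_def)
      have "(L * l) * (emb W * emb V\<delta>) = (emb (pderiv V\<delta>) / emb V\<delta> + L * l) * emb W * emb V\<delta> - emb (pderiv V\<delta>) * emb W"
        using \<delta>(1) by (simp add: field_simps)
      hence "l * emb ([:c:] * W * V\<delta>) = emb ((pderiv W - [:c:] * g * V\<delta>) * V\<delta> - pderiv V\<delta> * W)"
        unfolding F2 by (simp only: emb_simps L_def mult_ac)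
      moreover have "[:c:] * W * V\<delta> \<noteq> 0" using l0 W0 \<delta>(1) by simp
      ultimately have "ratfun l" unfolding ratfun_def by blast
      then obtain Ln Ld where ln: "Ld \<noteq> 0" "no_common_root Ln Ld" and lL: "l * emb Ld = emb Ln"
        using ratfun_lowest_terms by blast
      \<comment> \<open>\<open>f l^2\<close> is a sum of three abscissae regular at
        \<open>r\<close>, so a pole of \<open>l\<close> would require a double root of
        \<open>f\<close>.\<close>
      have Ldr: "poly Ld r \<noteq> 0"
      proof
        assume z: "poly Ld r = 0"
        hence Lnr: "poly Ln r \<noteq> 0" using ln(2) by (auto simp: no_common_root_def)
        define k where "k = Ln ^ 2 * (V * V\<delta>)"
        have kr: "poly k r \<noteq> 0" using Lnr Vr V\<delta>r by (simp add: k_def)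
        have "emb (f * k) = (emb f * l ^ 2) * emb Ld ^ 2 * emb V * emb V\<delta>"
          unfolding k_def by (simp add: power_mult_distrib mult_ac flip: lL)
        also have "\<dots> = emb (Ld ^ 2 * (\<phi> * V * V\<delta> + U\<delta> * V + U * V\<delta>))"
          unfolding e1 by (simp add: algebra_simps flip: \<delta>(4) R(3))
        finally have fk: "f * k = Ld ^ 2 * (\<phi> * V * V\<delta> + U\<delta> * V + U * V\<delta>)" by (simp only: emb_eq_iff)
        have "poly (f * k) r = 0" unfolding fk using z by simp
        hence fr: "poly f r = 0" using kr by simp
        have "poly (pderiv (f * k)) r = 0" unfolding fk using z by (simp add: pderiv_mult pderiv_power)
        hence "poly (pderiv f) r = 0" using fr kr by (simp add: pderiv_mult)
        thus False using cubic_separable[OF disc] fr unfolding f_def by blast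
      qed
      have "E * emb (V * V\<delta> * Ld) = emb (pderiv V * V\<delta> * Ld - pderiv V\<delta> * V * Ld) - L * (l * emb Ld) * emb V * emb V\<delta>"
        unfolding E_def using R(1) \<delta>(1) by (simp add: field_simps)
      also have "\<dots> = emb (pderiv V * V\<delta> * Ld - pderiv V\<delta> * V * Ld - [:c:] * Ln * V * V\<delta>)"
        unfolding lL L_def by (simp only: emb_simps mult_ac)
      finally show ?thesis unfolding regular_at_def using Vr V\<delta>r Ldr
        by (intro exI[of _ "pderiv V * V\<delta> * Ld - pderiv V\<delta> * V * Ld - [:c:] * Ln * V * V\<delta>"] exI[of _ "V * V\<delta> * Ld"]) simp
    qed
  qed
  then obtain e where e: "E = emb e" using regular_everywhere_poly by blast
  hence "emb (e * (V * W)) = emb (pderiv V * W - (pderiv W - [:c:] * g * V\<delta>) * V)" using E2 by simp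
  hence main: "e * (V * W) = pderiv V * W - (pderiv W - [:c:] * g * V\<delta>) * V" by (simp only: emb_eq_iff)
  \<comment> \<open>Division of \<open>g\<close> by \<open>t^p\<close>, to reduce
    \<open>g * V\<delta>\<close> modulo \<open>W\<close>: the remainder \<open>M\<close> has degree
    below \<open>W\<close>, and its coefficient just below the top of \<open>W\<close> is the Hasse
    invariant times the leading coefficient of \<open>V\<delta>\<close>.\<close>
  define q where "q = poly_shift p g"
  define M where "M = q * U\<delta> + poly_cutoff p g * V\<delta>"
  define dV where "dV = degree V"
  define d\<delta> where "d\<delta> = degree V\<delta>"
  have g: "g = \<phi> * q + poly_cutoff p g"
    by (rule poly_eqI) (simp add: \<phi>_def q_def coeff_monom_mult coeff_poly_shift coeff_poly_cutoff)
  have gM: "g * V\<delta> = M - q * W"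
    by (subst g) (simp add: M_def W_def algebra_simps)
  have degg: "degree g \<le> 3 * m"
    using degree_power_le[of f m] by (simp add: g_def f_def)
  have degq: "degree q \<le> 3 * m - p"
    unfolding q_def by (rule degree_le) (use degg in \<open>auto simp: coeff_poly_shift intro!: coeff_eq_0\<close>)
  have degc: "degree (poly_cutoff p g) \<le> p - 1"
    by (rule degree_le) (auto simp: coeff_poly_cutoff)
  have dqU: "degree (q * U\<delta>) < p - 1 + d\<delta>"
  proof (cases "q = 0")
    case True
    thus ?thesis using p by simp
  next
    case False
    hence "p \<le> 3 * m" using degg unfolding q_def
      by (metis (no_types, lifting) coeff_poly_shift coeff_eq_0 le_add1 le_trans linorder_not_le poly_eqI coeff_0 trans_le_add1 add.commute le_less_trans)
    thus ?thesis using degree_mult_le[of q U\<delta>] degq \<delta>(3) p by (simp add: d\<delta>_def)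
  qed
  have degM: "degree M \<le> p - 1 + d\<delta>"
    unfolding M_def using dqU degree_mult_le[of "poly_cutoff p g" V\<delta>] degc
    by (intro degree_add_le) (simp_all add: d\<delta>_def)
  have lcM: "coeff M (p - 1 + d\<delta>) = coeff g (p - 1) * lead_coeff V\<delta>"
    unfolding M_def using dqU coeff_mult_top[OF degc, of V\<delta> d\<delta>] p
    by (simp add: coeff_eq_0 d\<delta>_def coeff_poly_cutoff)
  have main2: "(e + [:c:] * q) * (V * W) = pderiv V * W - pderiv W * V + [:c:] * M * V"
  proof -
    have "e * (V * W) = pderiv V * W - pderiv W * V + [:c:] * (g * V\<delta>) * V"
      unfolding main by (simp only: algebra_simps)
    thus ?thesis unfolding gM by (simp only: algebra_simps)
  qed
  define Z where "Z = pderiv V * W - pderiv W * V + [:c:] * M * V"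
  have dW: "degree W = Suc (p - 1 + d\<delta>)" using degW p by (simp add: d\<delta>_def)
  have dW': "degree (pderiv W) \<le> p - 1 + d\<delta>"
    by (rule degree_le) (use dW in \<open>auto simp: coeff_pderiv intro!: coeff_eq_0\<close>)
  have top1: "coeff (pderiv W * V) (p - 1 + d\<delta> + dV) = - (of_nat p + of_nat d\<delta>) * lead_coeff V\<delta> * lead_coeff V"
  proof -
    have "Suc (p - 1 + d\<delta>) = p + degree V\<delta>" using p by (simp add: d\<delta>_def)
    hence c: "coeff (pderiv W) (p - 1 + d\<delta>) = of_nat (p + degree V\<delta>) * - lead_coeff V\<delta>"
      unfolding coeff_pderiv using lcW by simp
    have "coeff (pderiv W * V) (p - 1 + d\<delta> + dV) = coeff (pderiv W) (p - 1 + d\<delta>) * coeff V dV"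
      by (rule coeff_mult_top[OF dW']) (simp add: dV_def)
    thus ?thesis unfolding c by (simp add: dV_def d\<delta>_def algebra_simps)
  qed
  have top2: "coeff ([:c:] * M * V) (p - 1 + d\<delta> + dV) = c * coeff g (p - 1) * lead_coeff V\<delta> * lead_coeff V"
  proof -
    have "degree ([:c:] * M) \<le> p - 1 + d\<delta>" using degM degree_smult_le[of c M] by simp
    from coeff_mult_top[OF this, of V dV] show ?thesis using lcM by (simp add: dV_def mult_ac)
  qed
  have top3: "coeff (pderiv V * W) (p - 1 + d\<delta> + dV) = - of_nat dV * lead_coeff V\<delta> * lead_coeff V"
  proof (cases dV)
    case 0
    hence "pderiv V = 0" unfolding dV_def by (metis degree_eq_zeroE pderiv_singleton)
    thus ?thesis using 0 by simp
  next
    case (Suc i)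
    have "degree (pderiv V) \<le> i"
      by (rule degree_le) (use Suc in \<open>auto simp: coeff_pderiv dV_def intro!: coeff_eq_0\<close>)
    from coeff_mult_top[OF this, of W "p + degree V\<delta>"] degW
    have "coeff (pderiv V * W) (i + (p + degree V\<delta>)) = coeff (pderiv V) i * - lead_coeff V\<delta>"
      by (simp add: lcW)
    moreover have "coeff (pderiv V) i = of_nat dV * lead_coeff V"
      unfolding coeff_pderiv Suc[symmetric] by (simp add: dV_def)
    moreover have "i + (p + degree V\<delta>) = p - 1 + d\<delta> + dV" using Suc p by (simp add: d\<delta>_def)
    ultimately show ?thesis by simp
  qed
  have degZ: "degree Z \<le> p - 1 + d\<delta> + dV"
  proof -
    have "degree (pderiv V * W) \<le> p - 1 + d\<delta> + dV"
    proof (cases dV)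
      case 0
      hence "pderiv V = 0" unfolding dV_def by (metis degree_eq_zeroE pderiv_singleton)
      thus ?thesis by simp
    next
      case (Suc i)
      have "degree (pderiv V) \<le> i"
        by (rule degree_le) (use Suc in \<open>auto simp: coeff_pderiv dV_def intro!: coeff_eq_0\<close>)
      thus ?thesis using degree_mult_le[of "pderiv V" W] dW Suc by linarith
    qed
    moreover have "degree (pderiv W * V) \<le> p - 1 + d\<delta> + dV"
      using degree_mult_le[of "pderiv W" V] dW' by (simp add: dV_def)
    moreover have "degree ([:c:] * M * V) \<le> p - 1 + d\<delta> + dV"
      using degree_mult_le[of "[:c:] * M" V] degM degree_smult_le[of c M] by (simp add: dV_def)
    ultimately show ?thesis unfolding Z_def by (intro degree_add_le degree_diff_le)
  qed
  \<comment> \<open>\<open>Z\<close> is a multiple of \<open>V * W\<close> of smaller degree. Its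
    vanishing top coefficient is the asserted relation, with the contribution of \<open>p\<close>
    being zero in the field.\<close>
  have "e + [:c:] * q = 0"
  proof (rule ccontr)
    assume "e + [:c:] * q \<noteq> 0"
    hence "degree ((e + [:c:] * q) * (V * W)) \<ge> degree (V * W)"
      using R(1) W0 by (subst degree_mult_eq) auto
    moreover have "degree (V * W) = dV + Suc (p - 1 + d\<delta>)" using R(1) W0 dW by (simp add: degree_mult_eq dV_def)
    ultimately show False using degZ unfolding main2 Z_def by simp
  qed
  hence "Z = 0" using main2 unfolding Z_def by (metis mult_zero_left)
  hence "coeff Z (p - 1 + d\<delta> + dV) = 0" by simp
  hence "(of_nat d\<delta> + c * coeff g (p - 1) - of_nat dV) * (lead_coeff V\<delta> * lead_coeff V) = 0"
    unfolding Z_def coeff_add coeff_diff top1 top2 top3 using p(1) of_nat_CHAR[where ?'a = 'k]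
    by (simp add: algebra_simps)
  hence "of_nat d\<delta> + c * coeff g (p - 1) - of_nat dV = (0 :: 'k)" using \<delta>(1) R(1) by simp
  thus ?thesis by (simp add: dV_def d\<delta>_def g_def)
qed

section \<open>Recognising the Frobenius endomorphism\<close>

lemma squarefree_dvd:
  fixes f w :: "'k::alg_closed_field poly"
  assumes "f \<noteq> 0" "\<And>r. poly f r = 0 \<Longrightarrow> poly (pderiv f) r \<noteq> 0" "\<And>r. poly f r = 0 \<Longrightarrow> poly w r = 0"
  shows "f dvd w"
  using assms
proof (induction "degree f" arbitrary: f w)
  case 0
  then show ?case by (metis is_unit_iff_degree dvd_trans one_dvd)
next
  case (Suc n)
  then obtain r where r: "poly f r = 0"
    using alg_closed_imp_poly_has_root[of f] by auto
  obtain g v where g: "f = [:- r, 1:] * g" and v: "w = [:- r, 1:] * v"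
    using r Suc.prems(3)[OF r] by (metis dvdE poly_eq_0_iff_dvd)
  have g0: "g \<noteq> 0" using Suc.prems(1) g by auto
  have df: "pderiv f = [:- r, 1:] * pderiv g + g" unfolding g by (simp only: pderiv_mult) (simp add: pderiv_pCons)
  have gr: "poly g r \<noteq> 0" using Suc.prems(2)[OF r] unfolding df by simp
  have "g dvd v"
  proof (rule Suc.hyps(1))
    show "n = degree g" using Suc.hyps(2) g0 unfolding g by (subst (asm) degree_mult_eq) auto
    fix q assume q: "poly g q = 0"
    hence fq: "poly f q = 0" by (simp add: g)
    show "poly (pderiv g) q \<noteq> 0" using Suc.prems(2)[OF fq] q unfolding df by auto
    have "q \<noteq> r" using q gr by auto
    thus "poly v q = 0" using Suc.prems(3)[OF fq] unfolding v by auto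
  qed fact
  thus ?case unfolding g v by (rule mult_dvd_mono[OF dvd_refl])
qed

lemma frobenius_poly:
  fixes P Q :: "'k::field poly"
  assumes "CHAR('k) = p" "prime p"
  shows "(P + Q) ^ p = P ^ p + Q ^ p" "[:c:] ^ p = [:c ^ p:]"
proof -
  show "(P + Q) ^ p = P ^ p + Q ^ p" by (rule freshmans_dream) (use assms in auto)
  show "[:c:] ^ p = [:c ^ p:]" by (rule poly_const_pow)
qed

lemma cubic_frobenius:
  fixes a b :: "'k::field"
  assumes p: "CHAR('k) = p" "prime p" and ab: "a ^ p = a" "b ^ p = b"
  shows "(L ^ 3 + [:a:] * L + [:b:]) ^ p = (L ^ p) ^ 3 + [:a:] * L ^ p + [:b:]"
  unfolding frobenius_poly[OF p] power_mult_distrib ab by (simp flip: power_mult add: mult.commute)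

text \<open>With \<open>f\<close> the cubic, \<open>f * (f^m)^2 = f^p\<close>, and this is
  \<open>f(t^p)\<close> because the coefficients are fixed by the \<open>p\<close>-th power
  map.\<close>

lemma frobenius_on_curve:
  fixes a b :: "'k::field"
  assumes p: "CHAR('k) = p" "prime p" "p = 2 * m + 1" and ab: "a ^ p = a" "b ^ p = b"
  shows "emb [:b, a, 0, 1:] * emb ([:b, a, 0, 1:] ^ m) ^ 2
    = emb (monom 1 p) ^ 3 + emb [:a:] * emb (monom 1 p) + emb [:b:]"
proof -
  have T: "[:b, a, 0, 1:] = [:0, 1:] ^ 3 + [:a:] * [:0, 1:] + [:b:]" by (simp add: eval_nat_numeral)
  have m: "[:0, 1:] ^ p = (monom 1 p :: 'k poly)" by (simp add: monom_altdef)
  have "[:b, a, 0, 1:] * ([:b, a, 0, 1:] ^ m) ^ 2 = [:b, a, 0, 1:] ^ p"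
    unfolding p(3) by (simp only: power_add power_mult power_one_right) (simp only: mult.commute power_mult[symmetric])
  also have "\<dots> = monom 1 p ^ 3 + [:a:] * monom 1 p + [:b:]"
    unfolding T cubic_frobenius[OF p(1,2) ab] m ..
  finally have "emb ([:b, a, 0, 1:] * ([:b, a, 0, 1:] ^ m) ^ 2) = emb (monom 1 p ^ 3 + [:a:] * monom 1 p + [:b:])"
    by (rule arg_cong)
  thus ?thesis by (simp only: emb_simps)
qed

text \<open>Here \<open>x' = 0\<close> makes \<open>x\<close> a fraction of degree one in \<open>t\<^sup>p\<close>, and the curve has no automorphisms
  other than \<open>\<plusminus>1\<close> because \<open>a b \<noteq> 0\<close>.\<close>

lemma frobenius_point:
  fixes a b :: "'k::alg_closed_field"
  assumes p: "CHAR('k) = p" "prime p" "p = 2 * m + 1" and ab: "a ^ p = a" "b ^ p = b" "a \<noteq> 0" "b \<noteq> 0"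
    and disc: "4 * a ^ 3 + 27 * b ^ 2 \<noteq> 0" "(3 :: 'k) \<noteq> 0"
    and pt: "curve_pt a b 0 p x y"
  shows "x = emb (monom 1 p)" "y = emb ([:b, a, 0, 1:] ^ m) \<or> y = - emb ([:b, a, 0, 1:] ^ m)"
proof -
  define f where "f = [:b, a, 0, 1:]"
  have p0: "p > 0" using p(3) by simp
  obtain u v where uv: "v \<noteq> 0" "no_common_root u v" "degree v < degree u" "degree u = p"
    "x * emb v = emb u" "emb f * y ^ 2 = x ^ 3 + emb [:a:] * x + emb [:b:]" "fls_deriv x = 0" "ratfun y"
    using pt by (auto simp: curve_pt_def f_def)
  have "fls_deriv (x * emb v) = fls_deriv (emb u)" using uv(5) by simp
  hence xv': "x * emb (pderiv v) = emb (pderiv u)" using uv(7) by (simp add: deriv_emb)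
  have "emb (u * pderiv v) = emb (v * pderiv u)" by (simp add: mult_ac flip: uv(5) xv')
  hence uv': "u * pderiv v = v * pderiv u" by (simp only: emb_eq_iff)
  have u0: "u \<noteq> 0" using uv(3) by auto
  \<comment> \<open>A polynomial dividing its derivative, of smaller degree, has derivative zero. So
    \<open>u\<close> and \<open>v\<close> involve only powers of \<open>t^p\<close>, and degree
    \<open>p\<close> leaves \<open>v\<close> constant.\<close>
  have "u dvd pderiv u"
    by (rule common_factor_dvd[OF u0 _ uv', of 0 0]) (use uv(2) in \<open>auto simp: no_common_root_def\<close>)
  moreover have "degree (pderiv u) < degree u"
    using uv(3) degree_le[of "degree u - 1" "pderiv u"]
    by (metis (no_types, lifting) Suc_pred' coeff_eq_0 coeff_pderiv less_Suc_eq_le less_nat_zero_code linorder_not_le mult_zero_right not_gr_zero Suc_less_eq)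
  ultimately have du: "pderiv u = 0" by (metis dvd_imp_degree_le linorder_not_le)
  hence dv: "pderiv v = 0" using uv' u0 by simp
  have coef0: "coeff q i = 0" if "pderiv q = 0" "0 < i" "i < p" for q :: "'k poly" and i
  proof -
    have "of_nat (Suc (i - 1)) * coeff q (Suc (i - 1)) = 0"
      using that(1) by (metis coeff_0 coeff_pderiv)
    moreover have "(of_nat i :: 'k) \<noteq> 0" using field_char_of_nat_neq_0[OF p(1)] that by blast
    ultimately show ?thesis using that(2) by simp
  qed
  have "v = [:coeff v 0:]"
  proof (rule poly_eqI)
    fix i
    consider "i = 0" | "0 < i" "i < p" | "p \<le> i" "0 < i" using p0 by linarith
    thus "coeff v i = coeff [:coeff v 0:] i"
      using coef0[OF dv, of i] uv(3,4) by cases (auto simp: coeff_eq_0 coeff_pCons split: nat.split)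
  qed
  then obtain c where c: "v = [:c:]" by blast
  have c0: "c \<noteq> 0" using uv(1) c by auto
  define A where "A = coeff u p / c"
  define B where "B = coeff u 0 / c"
  have A0: "A \<noteq> 0" using u0 uv(4) c0 by (auto simp: A_def)
  have u: "u = [:c:] * (monom A p + [:B:])"
  proof (rule poly_eqI)
    fix i
    consider "i = 0" | "0 < i" "i < p" | "i = p" | "p < i" by linarith
    thus "coeff u i = coeff ([:c:] * (monom A p + [:B:])) i"
      using coef0[OF du, of i] uv(4) c0 p0
      by cases (auto simp: A_def B_def coeff_eq_0 coeff_pCons split: nat.split)
  qed
  \<comment> \<open>Taking \<open>p\<close>-th roots of the coefficients writes the abscissa as
    \<open>L^p\<close> with \<open>L\<close> linear.\<close>
  obtain \<alpha> \<beta> where ab': "\<alpha> ^ p = A" "\<beta> ^ p = B" using nth_root_exists[OF p0] by metis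
  define L where "L = [:\<beta>, \<alpha>:]"
  have \<alpha>0: "\<alpha> \<noteq> 0" using ab'(1) A0 p0 by auto
  have Lp: "L ^ p = monom A p + [:B:]"
  proof -
    have "L = [:\<alpha>:] * [:0, 1:] + [:\<beta>:]" by (simp add: L_def)
    hence "L ^ p = [:\<alpha> ^ p:] * [:0, 1:] ^ p + [:\<beta> ^ p:]"
      by (simp only: frobenius_poly[OF p(1,2)] power_mult_distrib)
    thus ?thesis by (simp add: ab' monom_altdef)
  qed
  have x: "x = emb (L ^ p)"
  proof -
    have "x * emb [:c:] = emb [:c:] * emb (L ^ p)" using uv(5) unfolding u c Lp by (simp only: emb_simps)
    moreover have "emb [:c:] \<noteq> 0" using c0 by simp
    ultimately show ?thesis by simp
  qed
  define h where "h = L ^ 3 + [:a:] * L + [:b:]"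
  have fy: "emb f * y ^ 2 = emb (h ^ p)"
    unfolding uv(6) x h_def cubic_frobenius[OF p(1,2) ab(1,2)] by (simp only: emb_simps)
  have dL: "degree (L ^ 3) = 3" using \<alpha>0 by (simp add: L_def degree_power_eq)
  have "degree ([:a:] * L + [:b:]) < 3"
    using degree_mult_le[of "[:a:]" L] by (intro degree_add_less) (auto simp: L_def)
  hence dh: "degree h = 3" unfolding h_def add.assoc using dL by (simp add: degree_add_eq_left)
  hence h0: "h \<noteq> 0" by auto
  have df: "degree f = 3" by (simp add: f_def)
  have f0: "f \<noteq> 0" by (simp add: f_def)
  \<comment> \<open>With \<open>h = f(L)\<close> one has \<open>f y^2 = h^p\<close>, so
    \<open>w\<close> is a square root of \<open>f h\<close>. As \<open>f\<close> is squarefree and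
    of the same degree as \<open>h\<close>, the two are proportional.\<close>
  define w where "w = emb f * y / emb h ^ m"
  have "ratfun w" unfolding w_def using uv(8) by (intro ratfun_divide ratfun_mult ratfun_power ratfun_emb)
  then obtain q d where qd: "d \<noteq> 0" "no_common_root q d" "w * emb d = emb q" using ratfun_lowest_terms by blast
  have "emb h ^ (2 * m) = (emb h ^ m) ^ 2" by (simp add: mult.commute flip: power_mult)
  hence "w ^ 2 = emb f * (emb f * y ^ 2) / emb h ^ (2 * m)"
    by (simp add: w_def power2_eq_square)
  also have "\<dots> = emb f * emb h" unfolding fy emb_simps p(3) using h0 by (simp add: field_simps)
  finally have w2: "w ^ 2 = emb f * emb h" .
  have "emb (q ^ 2) = emb (d ^ 2 * (f * h))" by (simp add: power_mult_distrib w2 flip: qd(3))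
  hence q2: "q ^ 2 = d ^ 2 * (f * h)" by (simp only: emb_eq_iff)
  have "poly d r \<noteq> 0" for r
  proof
    assume r: "poly d r = 0"
    hence "poly (q ^ 2) r = 0" unfolding q2 by simp
    thus False using r qd(2) by (simp add: no_common_root_def)
  qed
  hence "degree d = 0" using alg_closed_imp_poly_has_root[of d] by blast
  then obtain k where k: "d = [:k:]" by (metis degree_eq_zeroE)
  hence k0: "k \<noteq> 0" using qd(1) by auto
  have "f dvd q"
  proof (rule squarefree_dvd[OF f0])
    show "poly (pderiv f) r \<noteq> 0" if "poly f r = 0" for r
      using cubic_separable[OF disc(1)] that unfolding f_def by blast
    show "poly q r = 0" if "poly f r = 0" for r
    proof -
      have "poly (q ^ 2) r = 0" unfolding q2 using that by simp
      thus ?thesis by simp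
    qed
  qed
  then obtain e where e: "q = f * e" by blast
  have "f * (f * e ^ 2) = f * (d ^ 2 * h)" using q2 unfolding e by (simp add: power2_eq_square mult_ac)
  hence fe: "f * e ^ 2 = d ^ 2 * h" using f0 by simp
  have e0: "e \<noteq> 0" using fe h0 qd(1) f0 by auto
  have "degree (f * e ^ 2) = 3 + 2 * degree e" using e0 f0 df by (simp add: degree_mult_eq degree_power_eq)
  moreover have "degree (d ^ 2 * h) = 3" using qd(1) h0 dh \<open>degree d = 0\<close> by (simp add: degree_mult_eq degree_power_eq)
  ultimately have "degree e = 0" using fe by simp
  then obtain k' where k': "e = [:k':]" by (metis degree_eq_zeroE)
  define \<epsilon> where "\<epsilon> = k' ^ 2 / k ^ 2"
  have "[:k ^ 2:] * h = [:k' ^ 2:] * f" using fe unfolding k k' by (simp add: power2_eq_square mult_ac)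
  hence kh: "k ^ 2 * coeff h i = k' ^ 2 * coeff f i" for i
    by (metis coeff_smult mult_pCons_left smult_0_left pCons_0_0 add.right_neutral mult_zero_left)
  have hf: "coeff h i = \<epsilon> * coeff f i" for i
    using kh[of i] k0 by (simp add: \<epsilon>_def field_simps)
  have hcoef: "h = [:\<beta> ^ 3 + a * \<beta> + b, 3 * \<beta> ^ 2 * \<alpha> + a * \<alpha>, 3 * \<beta> * \<alpha> ^ 2, \<alpha> ^ 3:]"
    by (simp add: h_def L_def eval_nat_numeral algebra_simps)
  have c3: "\<alpha> ^ 3 = \<epsilon>" using hf[of 3] unfolding hcoef f_def by (simp add: eval_nat_numeral)
  have "3 * \<beta> * \<alpha> ^ 2 = 0" using hf[of 2] unfolding hcoef f_def by (simp add: eval_nat_numeral)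
  hence \<beta>0: "\<beta> = 0" using disc(2) \<alpha>0 by simp
  have "a * \<alpha> = \<epsilon> * a" using hf[of 1] unfolding hcoef f_def by (simp add: \<beta>0)
  hence "\<alpha> = \<epsilon>" using ab(3) by simp
  moreover have "b = \<epsilon> * b" using hf[of 0] unfolding hcoef f_def by (simp add: \<beta>0)
  hence "\<epsilon> = 1" using ab(4) by simp
  ultimately have "\<alpha> = 1" by simp
  hence L: "L = [:0, 1:]" by (simp add: L_def \<beta>0)
  show x': "x = emb (monom 1 p)" unfolding x L by (simp add: monom_altdef)
  have "emb f * y ^ 2 = emb f * emb (f ^ m) ^ 2"
    using uv(6) frobenius_on_curve[OF p ab(1,2)] unfolding x' f_def by simp
  hence "y ^ 2 = emb (f ^ m) ^ 2" using f0 by simp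
  thus "y = emb ([:b, a, 0, 1:] ^ m) \<or> y = - emb ([:b, a, 0, 1:] ^ m)"
    unfolding f_def by (simp only: power2_eq_iff)
qed

text \<open>For \<open>c \<noteq> 0\<close> the map is unramified at infinity, so the pole of
  \<open>x\<close> there is simple. Degrees are compared in \<open>f N^2 = c^2 v G\<close>, where
  the Wronskian \<open>N = u' v - u v'\<close> has degree at most
  \<open>degree u + degree v - 1\<close>.\<close>

lemma curve_pt_separable_degree:
  fixes a b c :: "'k::field"
  assumes "c \<noteq> 0" "x * emb v = emb u" "v \<noteq> 0" "degree v < degree u"
    "emb [:b, a, 0, 1:] * y ^ 2 = x ^ 3 + emb [:a:] * x + emb [:b:]" "fls_deriv x = emb [:c:] * y"
  shows "degree u = degree v + 1"
proof -
  define f where "f = [:b, a, 0, 1:]"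
  define G where "G = u ^ 3 + ([:a:] * u * v ^ 2 + [:b:] * v ^ 3)"
  define N where "N = pderiv u * v - u * pderiv v"
  have u0: "u \<noteq> 0" using assms(4) by auto
  have "fls_deriv (x * emb v) = fls_deriv (emb u)" using assms(2) by simp
  hence d: "emb [:c:] * y * emb v + x * emb (pderiv v) = emb (pderiv u)"
    using assms(6) by (simp add: deriv_emb add.commute)
  have N: "emb N = emb [:c:] * y * emb v ^ 2"
    unfolding N_def emb_simps d[symmetric] assms(2)[symmetric] by (simp add: algebra_simps power2_eq_square)
  have G: "emb G = (x ^ 3 + emb [:a:] * x + emb [:b:]) * emb v ^ 3"
    unfolding G_def emb_simps assms(2)[symmetric] by (simp add: algebra_simps power2_eq_square power3_eq_cube)
  have "emb (f * N ^ 2) = emb [:c:] ^ 2 * (emb f * y ^ 2) * emb v ^ 4"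
    unfolding emb_simps N by (simp add: power_mult_distrib eval_nat_numeral mult_ac)
  also have "\<dots> = emb ([:c:] ^ 2 * (v * G))"
    unfolding emb_simps G assms(5)[folded f_def] by (simp add: eval_nat_numeral mult_ac)
  finally have eq: "f * N ^ 2 = [:c:] ^ 2 * (v * G)" by (simp only: emb_eq_iff)
  have dG: "degree G = 3 * degree u"
  proof -
    have "degree (u ^ 3) = 3 * degree u" using u0 by (intro degree_power_eq) auto
    moreover have "degree ([:a:] * u * v ^ 2) < 3 * degree u"
      using degree_smult_le[of a "u * v ^ 2"] degree_mult_le[of u "v ^ 2"] degree_power_le[of v 2] assms(4)
      by simp
    moreover have "degree ([:b:] * v ^ 3) < 3 * degree u"
      using degree_smult_le[of b "v ^ 3"] degree_power_le[of v 3] assms(4) by simp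
    ultimately show ?thesis unfolding G_def
      by (subst degree_add_eq_left) (auto intro: degree_add_less)
  qed
  hence G0: "G \<noteq> 0" using assms(4) by auto
  have "[:c:] ^ 2 \<noteq> 0" "degree ([:c:] ^ 2) = 0" using assms(1) by (simp_all add: power2_eq_square)
  hence d1: "degree (f * N ^ 2) = degree v + 3 * degree u"
    unfolding eq using assms(3) G0 dG by (simp add: degree_mult_eq)
  have dp: "degree (pderiv q) \<le> degree q - 1" for q :: "'k poly"
    by (rule degree_le) (auto simp: coeff_pderiv coeff_eq_0)
  have "degree N \<le> degree u + degree v - 1"
  proof -
    have "degree (pderiv u * v) \<le> degree u + degree v - 1"
      using degree_mult_le[of "pderiv u" v] dp[of u] assms(4) by simp
    moreover have "degree (u * pderiv v) \<le> degree u + degree v - 1"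
    proof (cases "degree v = 0")
      case True
      hence "pderiv v = 0" by (metis degree_eq_zeroE pderiv_singleton)
      thus ?thesis by simp
    next
      case False
      thus ?thesis using degree_mult_le[of u "pderiv v"] dp[of v] by simp
    qed
    ultimately show ?thesis unfolding N_def by (rule degree_diff_le)
  qed
  moreover have "degree (f * N ^ 2) \<le> 3 + 2 * degree N"
    using degree_mult_le[of f "N ^ 2"] degree_power_le[of N 2] by (simp add: f_def)
  ultimately have "degree v + 3 * degree u \<le> 3 + 2 * (degree u + degree v - 1)" using d1 by simp
  thus ?thesis using assms(4) by simp
qed

section \<open>The Hasse invariant\<close>

lemma fermat_char_power:
  assumes "CHAR('k::field) = p" "prime p"
  shows "(of_int z :: 'k) ^ p = of_int z"
proof (cases "(of_int z :: 'k) = 0")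
  case True
  thus ?thesis using prime_gt_0_nat[OF assms(2)] by simp
next
  case False
  have "(of_int z :: 'k) ^ p = of_int z ^ (p - 1) * of_int z"
    using prime_gt_0_nat[OF assms(2)] by (metis power_minus_mult)
  thus ?thesis using fermat_char[OF assms False] by simp
qed

text \<open>\<open>2 i + j\<close> is the trace of \<open>i + j \<alpha>\<close>. The point of
  \<open>i + j \<alpha>\<close> is Frobenius only up to sign, hence the squares.\<close>

lemma hasse_square_split:
  fixes \<alpha> :: "'k::alg_closed_field"
  assumes p: "CHAR('k) = p" "prime p" "p = 2 * m + 1" "p \<notin> {2, 3, 11}"
    and \<alpha>: "\<alpha> * \<alpha> = \<alpha> - 3" and ij: "norm11 i j = int p" "of_int i + of_int j * \<alpha> = 0"
  shows "coeff (cm_cubic ^ m) (p - 1) ^ 2 = (of_int (2 * i + j) ^ 2 :: 'k)"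
proof -
  note nz = numeral_char_neq_0[OF p(1,2,4)]
  note disc = cm_disc[OF nz]
  define H :: 'k where "H = coeff (cm_cubic ^ m) (p - 1)"
  \<comment> \<open>\<open>frobenius_point\<close> needs \<open>1694 = 2 * 7 * 11^2\<close> to be
    nonzero. The prime 7 is not a norm, since neither 28 nor 28 - 11 is a square.\<close>
  have p7: "p \<noteq> 7"
  proof
    assume "p = 7"
    hence e: "(2 * i + j) ^ 2 + 11 * j ^ 2 = 28"
      using ij(1) by (simp add: norm11_def algebra_simps power2_eq_square)
    have "\<bar>j\<bar> < 2"
    proof (rule ccontr)
      assume "\<not> \<bar>j\<bar> < 2"
      hence "2 ^ 2 \<le> \<bar>j\<bar> ^ 2" by (intro power_mono) auto
      thus False using e zero_le_power2[of "2 * i + j"] by simp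
    qed
    hence "j = 0 \<or> j = 1 \<or> j = - 1" by linarith
    hence "(2 * i + j) ^ 2 = 28 \<or> (2 * i + j) ^ 2 = 17" using e by auto
    moreover have "x ^ 2 \<noteq> 28 \<and> x ^ 2 \<noteq> 17" for x :: int
    proof -
      define y where "y = \<bar>x\<bar>"
      have "y ^ 2 \<noteq> 28 \<and> y ^ 2 \<noteq> 17"
      proof (cases "y \<le> 5")
        case True
        hence "y \<in> {0, 1, 2, 3, 4, 5}" by (auto simp: y_def)
        thus ?thesis by auto
      next
        case False
        hence "6 ^ 2 \<le> y ^ 2" by (intro power_mono) auto
        thus ?thesis by auto
      qed
      thus ?thesis by (simp add: y_def)
    qed
    ultimately show False by blast
  qed
  have b0: "(1694 :: 'k) \<noteq> 0"
  proof
    assume "(1694 :: 'k) = 0"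
    hence "(of_nat 1694 :: 'k) = 0" by simp
    hence "p dvd 2 * 7 * (11 * 11)" using p(1) by (simp only: of_nat_eq_0_iff_char_dvd) simp
    hence "p dvd 2 \<or> p dvd 7 \<or> p dvd 11" using p(2) by (simp only: prime_dvd_mult_iff) auto
    moreover have "prime (2 :: nat)" "prime (7 :: nat)" "prime (11 :: nat)" by simp_all
    ultimately have "p = 2 \<or> p = 7 \<or> p = 11" using p(2) primes_dvd_imp_eq by blast
    thus False using p(4) p7 by auto
  qed
  have a0: "(- 264 :: 'k) \<noteq> 0"
  proof -
    have "(264 :: 'k) = 2 ^ 3 * 3 * 11" by simp
    thus ?thesis using nz by (metis mult_eq_0_iff neg_equal_0_iff_equal power_not_zero)
  qed
  have ap: "(- 264 :: 'k) ^ p = - 264" "(1694 :: 'k) ^ p = 1694"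
    using fermat_char_power[OF p(1,2), of "- 264"] fermat_char_power[OF p(1,2), of 1694] by simp_all
  have "coprime i j"
  proof (rule coprimeI)
    fix g assume g: "g dvd i" "g dvd j"
    then obtain x y where xy: "i = g * x" "j = g * y" by (auto elim!: dvdE)
    have gg: "g * (g * norm11 x y) = int p"
      using ij(1) unfolding xy by (simp add: norm11_def algebra_simps power2_eq_square)
    have pp: "prime (int p)" using p(2) by simp
    show "is_unit g"
    proof (rule ccontr)
      assume nu: "\<not> is_unit g"
      have "\<not> is_unit (g * norm11 x y)" using nu dvd_mult_left by blast
      moreover have "irreducible (int p)" using pp by (rule prime_elem_imp_irreducible[OF prime_imp_prime_elem])
      ultimately show False using nu gg Factorial_Ring.irreducibleD by metis
    qed
  qed
  then obtain k l where "superbase (- 264) 1694 \<alpha> i j k l"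
    using superbase_reach[OF disc nz(1) superbase_cm[OF \<alpha> nz]] by blast
  then obtain x1 y1 x2 y2 x3 y3 s t where det: "\<bar>i * l - k * j\<bar> = 1" and
    p1: "mult_pt (- 264) 1694 \<alpha> i j x1 y1" and p2: "mult_pt (- 264) 1694 \<alpha> k l x2 y2" and
    p3: "mult_pt (- 264) 1694 \<alpha> (- i - k) (- j - l) x3 y3" and
    col: "collinear3 (emb [:1694, - 264, 0, 1:]) (emb [:- 264:]) (emb [:1694:]) (x1, y1) (x2, y2) (x3, y3) s t"
    unfolding superbase_def by blast
  define c where "c = of_int k + of_int l * \<alpha>"
  \<comment> \<open>If both elements of the basis reduced to 0, so would its determinant, which is 1
    or -1.\<close>
  have c0: "c \<noteq> 0"
  proof
    assume "c = 0"
    hence "of_int k = - of_int l * \<alpha>" by (simp add: c_def eq_neg_iff_add_eq_0)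
    moreover have "of_int i = - of_int j * \<alpha>" using ij(2) by (simp add: eq_neg_iff_add_eq_0)
    moreover have "of_int (i * l - k * j) = of_int i * of_int l - of_int k * (of_int j :: 'k)" by simp
    ultimately have "of_int (i * l - k * j) = (0 :: 'k)" by simp
    moreover have "i * l - k * j = 1 \<or> i * l - k * j = - 1" using det by linarith
    ultimately show False by (metis neg_equal_0_iff_equal of_int_1 of_int_minus one_neq_zero)
  qed
  have pt1: "curve_pt (- 264) 1694 0 p x1 y1" using p1 ij unfolding mult_pt_def by simp
  have pt2: "curve_pt (- 264) 1694 c (nat (norm11 k l)) x2 y2" using p2 unfolding mult_pt_def c_def .
  have c3: "of_int (- i - k) + of_int (- j - l) * \<alpha> = - c"
    using ij(2) unfolding c_def by (simp add: algebra_simps add_eq_0_iff)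
  have pt3: "curve_pt (- 264) 1694 (- c) (nat (norm11 (- i - k) (- j - l))) x3 y3"
    using p3 unfolding mult_pt_def c3 .
  note fr = frobenius_point[OF p(1-3) ap a0 b0 disc nz(2) pt1]
  have key: "\<exists>e. e ^ 2 = 1 \<and> e * (of_nat (nat (norm11 (- i - k) (- j - l))) - of_nat (nat (norm11 k l))) = c * H"
  proof -
    obtain u2 v2 where q2: "v2 \<noteq> 0" "no_common_root u2 v2" "degree v2 < degree u2" "degree u2 = nat (norm11 k l)"
      "x2 * emb v2 = emb u2" "fls_deriv x2 = emb [:c:] * y2"
      "emb [:1694, - 264, 0, 1:] * y2 ^ 2 = x2 ^ 3 + emb [:- 264:] * x2 + emb [:1694:]"
      using pt2 unfolding curve_pt_def by blast
    obtain u3 v3 where q3: "v3 \<noteq> 0" "no_common_root u3 v3" "degree v3 < degree u3"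
      "degree u3 = nat (norm11 (- i - k) (- j - l))" "x3 * emb v3 = emb u3" "fls_deriv x3 = emb [:- c:] * y3"
      "emb [:1694, - 264, 0, 1:] * y3 ^ 2 = x3 ^ 3 + emb [:- 264:] * x3 + emb [:1694:]"
      using pt3 unfolding curve_pt_def by blast
    have d2: "degree u2 = degree v2 + 1"
      using curve_pt_separable_degree[OF c0 q2(5,1,3,7,6)] .
    have d3: "degree u3 = degree v3 + 1"
      using curve_pt_separable_degree[OF _ q3(5,1,3,7,6)] c0 by simp
    have neg: "emb [:- z:] = - emb [:z:]" for z :: 'k
      by (metis emb_simps(5) minus_pCons minus_zero)
    have m0: "0 < m" using p(3) prime_gt_1_nat[OF p(2)] by simp
    show ?thesis using fr(2)
    proof
      assume y1: "y1 = emb ([:1694, - 264, 0, 1:] ^ m)"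
      have "(of_nat (degree v3) :: 'k) = of_nat (degree v2) + c * coeff ([:1694, - 264, 0, 1:] ^ m) (p - 1)"
        by (rule frobenius_add_degree[OF p(1,3) m0 disc c0 q2(1,2) d2 q2(5,6) q3(1,2,5) _ col[unfolded fr(1) y1]])
          (use q3(6) in \<open>simp add: neg\<close>)
      thus ?thesis unfolding q2(4)[symmetric] q3(4)[symmetric] d2 d3
        by (intro exI[of _ 1]) (simp add: H_def cm_cubic_def)
    next
      assume y1: "y1 = - emb ([:1694, - 264, 0, 1:] ^ m)"
      have col': "collinear3 (emb [:1694, - 264, 0, 1:]) (emb [:- 264:]) (emb [:1694:])
        (emb (monom 1 p), emb ([:1694, - 264, 0, 1:] ^ m)) (x2, - y2) (x3, - y3) (- s) (- t)"
        using collinear3_neg[OF col] unfolding fr(1) y1 by simp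
      have "(of_nat (degree v3) :: 'k) = of_nat (degree v2) + (- c) * coeff ([:1694, - 264, 0, 1:] ^ m) (p - 1)"
        by (rule frobenius_add_degree[OF p(1,3) m0 disc _ q2(1,2) d2 q2(5) _ q3(1,2,5) _ col'])
          (use q2(6) q3(6) c0 in \<open>simp_all add: neg\<close>)
      thus ?thesis unfolding q2(4)[symmetric] q3(4)[symmetric] d2 d3
        by (intro exI[of _ "- 1"]) (simp add: H_def cm_cubic_def)
    qed
  qed
  then obtain e where e: "e ^ 2 = 1"
    "e * (of_nat (nat (norm11 (- i - k) (- j - l))) - of_nat (nat (norm11 k l))) = c * H" by blast
  have "(of_nat (nat (norm11 (- i - k) (- j - l))) :: 'k) - of_nat (nat (norm11 k l))
      = of_int (norm11 (- i - k) (- j - l) - norm11 k l)"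
    using norm11_nonneg by simp
  \<comment> \<open>The mixed term is the polar form of the norm. Since
    \<open>i + j \<alpha>\<close> reduces to 0, its conjugate reduces to the trace
    \<open>2 i + j\<close>, and only \<open>(2 i + j) c\<close> survives.\<close>
  also have "norm11 (- i - k) (- j - l) - norm11 k l = norm11 i j + (2 * i * k + i * l + j * k + 6 * j * l)"
    by (simp add: norm11_def algebra_simps power2_eq_square)
  also have "of_int \<dots> = (of_int (2 * i * k + i * l + j * k + 6 * j * l) :: 'k)"
    unfolding ij(1) using of_nat_CHAR[where ?'a = 'k] p(1) by simp
  also have "\<dots> = of_int (2 * i + j) * c"
  proof -
    define I J K L :: 'k where "I = of_int i" and "J = of_int j" and "K = of_int k" and "L = of_int l"
    have I: "I = - J * \<alpha>" using ij(2) unfolding I_def J_def by (simp add: eq_neg_iff_add_eq_0)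
    have "2 * I * K + I * L + J * K + 6 * J * L = (2 * I + J) * (K + L * \<alpha>) + 2 * J * L * (\<alpha> * \<alpha> - (\<alpha> - 3))"
      unfolding I by (simp add: algebra_simps)
    also have "\<alpha> * \<alpha> - (\<alpha> - 3) = 0" using \<alpha> by simp
    finally show ?thesis by (simp add: c_def I_def J_def K_def L_def)
  qed
  finally have "c * (e * of_int (2 * i + j)) = c * H" using e(2) by (simp add: mult_ac)
  hence "H = e * of_int (2 * i + j)" using c0 by simp
  thus ?thesis unfolding H_def[symmetric] using e(1) by (simp add: power_mult_distrib)
qed

text \<open>Only integrality matters here: the degree of the sum is left unspecified, so a single
  chord suffices. It is a true chord because the abscissa of Frobenius has derivative zero and
  \<open>x\<close> has not.\<close>

lemma frobenius_add_exists:
  fixes c :: "'k::alg_closed_field"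
  assumes p: "CHAR('k) = p" "prime p" "p = 2 * m + 1" "p \<notin> {2, 3, 11}"
    and c0: "c \<noteq> 0" and pt: "curve_pt (- 264) 1694 c h x y"
  shows "\<exists>z. c * coeff (cm_cubic ^ m) (p - 1) = (of_int z :: 'k)"
proof -
  note nz = numeral_char_neq_0[OF p(1,2,4)]
  note disc = cm_disc[OF nz]
  define f :: "'k poly" where "f = [:1694, - 264, 0, 1:]"
  define F where "F = emb f"
  have f0: "f \<noteq> 0" by (simp add: f_def)
  obtain u v where q: "v \<noteq> 0" "no_common_root u v" "degree v < degree u"
      "x * emb v = emb u" "fls_deriv x = emb [:c:] * y"
      "emb [:1694, - 264, 0, 1:] * y ^ 2 = x ^ 3 + emb [:- 264:] * x + emb [:1694:]" "ratfun y"
    using pt unfolding curve_pt_def by blast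
  have d: "degree u = degree v + 1" using curve_pt_separable_degree[OF c0 q(4,1,3,6,5)] .
  have y0: "y \<noteq> 0" using curve_pt_y_nonzero[OF pt] .
  have ap: "(- 264 :: 'k) ^ p = - 264" "(1694 :: 'k) ^ p = 1694"
    using fermat_char_power[OF p(1,2), of "- 264"] fermat_char_power[OF p(1,2), of 1694] by simp_all
  define X where "X = emb (monom 1 p :: 'k poly)"
  define Y where "Y = emb (f ^ m)"
  have oc: "F * Y ^ 2 = X ^ 3 + emb [:- 264:] * X + emb [:1694:]"
    using frobenius_on_curve[OF p(1-3) ap] unfolding F_def f_def X_def Y_def .
  have Y0: "Y \<noteq> 0" unfolding Y_def using f0 by simp
  have dX: "fls_deriv X = 0 * Y"
    using of_nat_CHAR[where ?'a = 'k] p(1) by (simp add: X_def deriv_emb pderiv_monom)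
  have ne: "X \<noteq> x" using dX q(5) c0 y0 by auto
  define l where "l = (y - Y) / (x - X)"
  define xR where "xR = F * l ^ 2 - X - x"
  define yR where "yR = Y + l * (xR - X)"
  have col: "collinear3 F (emb [:- 264:]) (emb [:1694:]) (X, Y) (x, y) (xR, yR) l (Y - l * X)"
    unfolding xR_def yR_def l_def by (rule collinear3_chord[OF oc q(6)[folded f_def, folded F_def] ne])
  have dR: "fls_deriv xR = - (0 + emb [:c:]) * yR"
    by (rule chord_deriv[OF col ne Y0 y0 _ _ dX q(5)]) simp_all
  have "ratfun x" using q(1,4) by (auto simp: ratfun_def)
  hence "ratfun xR" unfolding xR_def l_def F_def X_def Y_def
    using q(7) by (intro ratfun_diff ratfun_mult ratfun_power ratfun_divide ratfun_emb)
  then obtain U V where UV: "V \<noteq> 0" "no_common_root U V" "xR * emb V = emb U" using ratfun_lowest_terms by blast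
  have m0: "0 < m" using p(3) prime_gt_1_nat[OF p(2)] by simp
  have "(of_nat (degree V) :: 'k) = of_nat (degree v) + c * coeff ([:1694, - 264, 0, 1:] ^ m) (p - 1)"
    by (rule frobenius_add_degree[OF p(1,3) m0 disc c0 q(1,2) d q(4,5) UV _ col[unfolded F_def f_def X_def Y_def]])
      (use dR in simp)
  hence "c * coeff (cm_cubic ^ m) (p - 1) = (of_int (int (degree V) - int (degree v)) :: 'k)"
    by (simp add: cm_cubic_def)
  thus ?thesis by blast
qed

lemma half_trace_one:
  fixes s :: "'k::field"
  assumes "s ^ 2 = - 11" "(2 :: 'k) \<noteq> 0"
  shows "((1 - s) / 2) * ((1 - s) / 2) = (1 - s) / 2 - 3"
proof -
  define \<alpha> where "\<alpha> = (1 - s) / 2"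
  have two: "2 * \<alpha> = 1 - s" using assms(2) by (simp add: \<alpha>_def)
  have "2 * 2 * (\<alpha> * \<alpha>) = (2 * \<alpha>) ^ 2" by (simp add: power2_eq_square)
  also have "\<dots> = 2 * (2 * \<alpha>) - 2 * 2 * 3"
    unfolding two using assms(1) by (simp add: algebra_simps power2_eq_square)
  also have "\<dots> = 2 * 2 * (\<alpha> - 3)" by (simp add: algebra_simps)
  finally have "\<alpha> * \<alpha> = \<alpha> - 3" using assms(2) by (metis mult_eq_0_iff mult_left_cancel)
  thus ?thesis by (simp only: \<alpha>_def)
qed

text \<open>As \<open>s = 1 - 2 \<alpha>\<close>, a nonzero \<open>H\<close> would make
  \<open>s\<close> the quotient of the elements \<open>s H\<close> and \<open>H\<close> of the prime
  field, against \<open>s^(p - 1) \<noteq> 1\<close>.\<close>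

lemma hasse_zero_inert:
  fixes s :: "'k::alg_closed_field"
  assumes p: "CHAR('k) = p" "prime p" "p = 2 * m + 1" "p \<notin> {2, 3, 11}"
    and s: "s ^ 2 = - 11" "s ^ (p - 1) \<noteq> 1"
  shows "coeff (cm_cubic ^ m) (p - 1) = (0 :: 'k)"
proof (rule ccontr)
  define H :: 'k where "H = coeff (cm_cubic ^ m) (p - 1)"
  assume "coeff (cm_cubic ^ m) (p - 1) \<noteq> (0 :: 'k)"
  hence H0: "H \<noteq> 0" by (simp add: H_def)
  note nz = numeral_char_neq_0[OF p(1,2,4)]
  define \<alpha> where "\<alpha> = (1 - s) / 2"
  have two: "2 * \<alpha> = 1 - s" using nz(1) by (simp add: \<alpha>_def)
  have \<alpha>: "\<alpha> * \<alpha> = \<alpha> - 3" unfolding \<alpha>_def by (rule half_trace_one[OF s(1) nz(1)])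
  have \<alpha>0: "\<alpha> \<noteq> 0" using \<alpha> nz(2) by auto
  obtain z1 where z1: "H = of_int z1"
    using frobenius_add_exists[OF p _ base_curve_pt] unfolding H_def by auto
  obtain z2 where z2: "\<alpha> * H = of_int z2"
    using frobenius_add_exists[OF p \<alpha>0 isog_curve_pt(1)[OF \<alpha> nz]] unfolding H_def by auto
  have "s * H = of_int (z1 - 2 * z2)"
  proof -
    have "s = 1 - 2 * \<alpha>" using two by simp
    hence "s * H = (1 - 2 * \<alpha>) * H" by (rule arg_cong)
    also have "\<dots> = H - 2 * (\<alpha> * H)" by (simp add: algebra_simps)
    finally have "s * H = H - 2 * (\<alpha> * H)" .
    thus ?thesis unfolding z2 by (simp add: z1)
  qed
  moreover have "s \<noteq> 0" using s(1) nz(3) by auto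
  ultimately have "(s * H) ^ (p - 1) = 1" using fermat_char[OF p(1,2)] H0 by (metis mult_eq_0_iff)
  moreover have "H ^ (p - 1) = 1" using fermat_char[OF p(1,2)] H0 unfolding z1 by blast
  ultimately show False using s(2) by (simp add: power_mult_distrib)
qed

text \<open>Reciprocity combined with Euler's criterion: \<open>(11 - 1) / 2 = 5\<close> is odd, so
  the reciprocity sign \<open>(-1)^m\<close> is the one that turns 11 into -11.\<close>

lemma sqrt_11_inert:
  fixes s :: "'k::field"
  assumes p: "CHAR('k) = p" "prime p" "p = 2 * m + 1" "p \<notin> {2, 3, 11}"
    and L: "Legendre (int p) 11 = - 1" and s: "s ^ 2 = - 11"
  shows "s ^ (p - 1) = - 1"
proof -
  have p2: "2 < p" using p(2,4) prime_gt_1_nat[OF p(2)] by auto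
  have "Legendre (int p) (int 11) * Legendre (int 11) (int p) = (- 1) ^ (((p - 1) div 2) * ((11 - 1) div 2))"
    by (rule Quadratic_Reciprocity) (use p p2 in auto)
  hence "Legendre 11 (int p) = - ((- 1) ^ m)"
    using L p(3) by (cases "even m") auto
  moreover have "[Legendre 11 (int p) = 11 ^ ((p - 1) div 2)] (mod int p)"
    by (rule euler_criterion[OF p(2) p2])
  ultimately have "[- ((- 1) ^ m) = 11 ^ m] (mod int p)" using p(3) by simp
  hence "of_int (- ((- 1) ^ m)) = (of_int (11 ^ m) :: 'k)"
    using of_int_eq_iff_cong_CHAR[where ?'a = 'k] p(1) by blast
  hence e: "- ((- 1) ^ m) = (11 ^ m :: 'k)" by simp
  have "s ^ (p - 1) = (- 11) ^ m" using p(3) s by (simp add: power_mult)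
  also have "\<dots> = (- 1) ^ m * 11 ^ m" by (simp flip: power_mult_distrib)
  also have "\<dots> = - 1" unfolding e[symmetric] by (simp flip: power_mult_distrib)
  finally show ?thesis .
qed

section \<open>The congruence\<close>

text \<open>The fraction need not be reduced, but its denominator in lowest terms divides
  \<open>d\<close>.\<close>

lemma p_integral_of_int_divide:
  assumes "d > 0" "coprime d (int p)"
  shows "of_int z / of_int d \<in> p_integral p"
proof -
  obtain a b where ab: "quotient_of (of_int z / of_int d) = (a, b)" by fastforce
  hence b: "b > 0" "coprime a b" and e: "of_int z / of_int d = (of_int a / of_int b :: rat)"
    using quotient_of_denom_pos quotient_of_coprime quotient_of_div by blast+
  have "of_int (z * b) = (of_int (a * d) :: rat)" using e b(1) assms(1) by (simp add: field_simps)
  hence "z * b = a * d" by (simp only: of_int_eq_iff)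
  hence "b dvd d" using b(2) by (metis coprime_commute coprime_dvd_mult_right_iff dvd_triv_right)
  hence "coprime b (int p)" using coprime_divisors[OF _ dvd_refl assms(2)] by blast
  thus ?thesis using ab by (simp add: p_integral_def)
qed

lemma sum_clear_denominators:
  assumes "(4 :: 'a::field) \<noteq> 0"
  shows "of_int (\<Sum>n<p. int (g n) * 4 ^ (p - 1 - n)) = 4 ^ (p - 1) * (\<Sum>n<p. of_nat (g n) / (4 :: 'a) ^ n)"
  unfolding of_int_sum sum_distrib_left
proof (intro sum.cong refl)
  fix n assume "n \<in> {..<p}"
  hence "(4 :: 'a) ^ (p - 1) = 4 ^ (p - 1 - n) * 4 ^ n" by (simp flip: power_add)
  thus "of_int (int (g n) * 4 ^ (p - 1 - n)) = 4 ^ (p - 1) * (of_nat (g n) / (4 :: 'a) ^ n)"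
    using assms by simp
qed

text \<open>All denominators divide \<open>4^(p - 1)\<close>, which is prime to \<open>p\<close> and
  equals 1 in the field. After clearing them, the equation in the field says that an integer is
  divisible by \<open>p\<close>.\<close>

lemma rat_cong_from_char:
  fixes g :: "nat \<Rightarrow> nat"
  assumes p: "prime p" "p \<noteq> 2" and ch: "CHAR('k::field) = p"
    and eq: "(\<Sum>n<p. of_nat (g n) / 4 ^ n) = (of_int w :: 'k)"
  shows "rat_cong (\<Sum>n<p. of_nat (g n) / 4 ^ n) (of_int w) p"
proof -
  define I where "I = (\<Sum>n<p. int (g n) * 4 ^ (p - 1 - n))"
  have two: "(2 :: 'k) \<noteq> 0"
  proof
    assume "(2 :: 'k) = 0"
    hence "(of_nat 2 :: 'k) = 0" by simp
    hence "p dvd 2" unfolding of_nat_eq_0_iff_char_dvd ch .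
    thus False using p primes_dvd_imp_eq[OF p(1) two_is_prime_nat] by simp
  qed
  hence four: "(4 :: 'k) \<noteq> 0" by (metis mult_2 mult_eq_0_iff numeral_Bit0)
  have "(4 :: 'k) ^ (p - 1) = 2 ^ (p - 1) * 2 ^ (p - 1)" by (simp flip: power_mult_distrib)
  also have "\<dots> = 1" using fermat_char[OF ch p(1), of 2] two by simp
  finally have f4: "(4 :: 'k) ^ (p - 1) = 1" .
  have "(of_int (I - w * 4 ^ (p - 1)) :: 'k) = 0"
    using sum_clear_denominators[OF four, of g p, folded I_def] eq f4 by simp
  hence "int p dvd I - w * 4 ^ (p - 1)" unfolding of_int_eq_0_iff_char_dvd ch .
  then obtain t where t: "I - w * 4 ^ (p - 1) = int p * t" by blast
  have "coprime (2 :: int) (int p)"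
    using p primes_coprime[OF two_is_prime_nat p(1)] by (metis coprime_int_iff of_nat_numeral)
  moreover have "(4 :: int) ^ (p - 1) = 2 ^ (2 * (p - 1))" by (simp add: power_mult)
  ultimately have cop: "coprime ((4 :: int) ^ (p - 1)) (int p)" by simp
  define S where "S = (\<Sum>n<p. of_nat (g n) / (4 :: rat) ^ n)"
  have S: "S = of_int I / of_int (4 ^ (p - 1))" 
    using sum_clear_denominators[where ?'a = rat and g = g and p = p, folded I_def] unfolding S_def by simp
  have "S \<in> p_integral p" unfolding S by (rule p_integral_of_int_divide[OF _ cop]) simp
  moreover have "of_int w \<in> p_integral p" using p_integral_of_int_divide[of 1 p w] by simp
  moreover have "of_int t / of_int (4 ^ (p - 1)) \<in> p_integral p"
    by (rule p_integral_of_int_divide[OF _ cop]) simp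
  moreover have "S - of_int w = of_nat p * (of_int t / of_int (4 ^ (p - 1)))"
  proof -
    have "S - of_int w = of_int (I - w * 4 ^ (p - 1)) / of_int (4 ^ (p - 1))"
      unfolding S by (simp add: field_simps)
    thus ?thesis unfolding t by simp
  qed
  ultimately show ?thesis unfolding rat_cong_def S_def by blast
qed

text \<open>Stated as a predicate of \<open>p\<close>, so that its failure can select a
  prime.\<close>

definition apery_congruence :: "nat \<Rightarrow> bool" where
  "apery_congruence p \<longleftrightarrow>
    (\<forall>x y :: int. 4 * int p = x ^ 2 + 11 * y ^ 2 \<longrightarrow>
       rat_cong (\<Sum>n<p. of_nat ((2 * n choose n) * apery2 n) / 4 ^ n) (of_int (x ^ 2)) p) \<and>
    (Legendre (int p) 11 = - 1 \<longrightarrow>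
       rat_cong (\<Sum>n<p. of_nat ((2 * n choose n) * apery2 n) / 4 ^ n) 0 p)"

lemma apery_congruence_char:
  assumes ch: "CHAR('k::alg_closed_field) = p" and p: "prime p" "p \<notin> {2, 3, 11}"
  shows "apery_congruence p"
proof -
  define m where "m = (p - 1) div 2"
  have "odd p" using p prime_odd_nat prime_gt_1_nat[OF p(1)] by (metis insertCI le_neq_implies_less Suc_leI Suc_1)
  hence pm: "p = 2 * m + 1" unfolding m_def by (auto elim!: oddE)
  note P = ch p(1) pm p(2)
  note nz = numeral_char_neq_0[OF P(1,2,4)]
  have S: "(\<Sum>n<p. of_nat ((2 * n choose n) * apery2 n) / 4 ^ n)
      = (- s * (1 + s) / 1584) ^ (p - 1) * (coeff (cm_cubic ^ m) (p - 1)) ^ 2" if "s ^ 2 = - 11" for s :: 'k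
    using apery_sum_hasse[OF P that] by simp
  have "rat_cong (\<Sum>n<p. of_nat ((2 * n choose n) * apery2 n) / 4 ^ n) (of_int (x ^ 2)) p"
    if xy: "4 * int p = x ^ 2 + 11 * y ^ 2" for x y :: int
  proof -
    have "even (x ^ 2 + 11 * y ^ 2)" unfolding xy[symmetric] by simp
    hence "even (x - y)" by auto
    then obtain i where i: "x - y = 2 * i" by blast
    hence x: "x = 2 * i + y" by simp
    have N: "norm11 i y = int p"
      using xy unfolding x by (simp add: norm11_def algebra_simps power2_eq_square)
    \<comment> \<open>Otherwise \<open>p^2\<close> would divide \<open>4 p\<close>.\<close>
    have y0: "(of_int y :: 'k) \<noteq> 0"
    proof
      assume "(of_int y :: 'k) = 0"
      hence py: "int p dvd y" unfolding of_int_eq_0_iff_char_dvd ch .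
      hence "int p dvd x ^ 2" using xy
        by (metis dvd_add_left_iff dvd_mult dvd_mult2 dvd_triv_right power2_eq_square)
      hence "int p dvd x" using p(1) by (simp add: prime_dvd_power_iff)
      hence "int p * int p dvd x ^ 2 + 11 * y ^ 2"
        using py unfolding power2_eq_square by (intro dvd_add dvd_mult mult_dvd_mono)
      hence "int p * int p dvd int p * 4" unfolding xy[symmetric] by (simp add: mult.commute)
      hence "int p dvd 4" using prime_gt_0_nat[OF p(1)] by simp
      hence "p dvd 4" by (metis of_nat_dvd_iff of_nat_numeral)
      hence "p dvd 2 ^ 2" by simp
      hence "p dvd 2" using p(1) prime_dvd_power by blast
      thus False using p primes_dvd_imp_eq[OF p(1) two_is_prime_nat] by simp
    qed
    \<comment> \<open>This choice of the square root of -11 makes \<open>i + y \<alpha>\<close>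
      reduce to 0. Being a quotient of integers, it also puts \<open>d\<close> into the prime field,
      so that \<open>d^(p - 1) = 1\<close>.\<close>
    define s :: 'k where "s = of_int x / of_int y"
    have sy: "s * of_int y = of_int x" using y0 by (simp add: s_def)
    have "(of_int (x ^ 2 + 11 * y ^ 2) :: 'k) = 0"
      unfolding xy[symmetric] using of_nat_CHAR[where ?'a = 'k] ch by simp
    hence "(s ^ 2 + 11) * of_int y ^ 2 = 0"
      by (simp add: algebra_simps power_mult_distrib flip: sy)
    hence s2: "s ^ 2 = - 11" using y0 by (simp add: eq_neg_iff_add_eq_0)
    define \<alpha> where "\<alpha> = (1 - s) / 2"
    have two: "2 * \<alpha> = 1 - s" using nz(1) by (simp add: \<alpha>_def)
    have \<alpha>: "\<alpha> * \<alpha> = \<alpha> - 3" unfolding \<alpha>_def by (rule half_trace_one[OF s2 nz(1)])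
    have "2 * (of_int i + of_int y * \<alpha>) = of_int (2 * i + y) - s * of_int y"
    proof -
      have "2 * (of_int i + of_int y * \<alpha>) = 2 * of_int i + of_int y * (2 * \<alpha>)" by (simp add: algebra_simps)
      thus ?thesis unfolding two by (simp add: algebra_simps)
    qed
    also have "\<dots> = 0" unfolding sy x by simp
    finally have lin: "of_int i + of_int y * \<alpha> = 0" using nz(1) by (metis mult_eq_0_iff)
    define d where "d = - s * (1 + s) / 1584"
    have "d ^ (p - 1) = 1"
    proof -
      have n1584: "(1584 :: 'k) \<noteq> 0"
      proof -
        have "(1584 :: 'k) = 2 ^ 4 * 3 ^ 2 * 11" by simp
        thus ?thesis using nz by (metis mult_eq_0_iff power_not_zero)
      qed
      have "s \<noteq> 0" using s2 nz(3) by auto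
      moreover have "1 + s \<noteq> 0"
      proof
        assume "1 + s = 0"
        hence "s = - 1" by (simp add: add_eq_0_iff)
        hence "2 * 2 * (3 :: 'k) = 0" using s2 by simp
        thus False using nz by (metis mult_eq_0_iff)
      qed
      ultimately have d0: "d \<noteq> 0" using n1584 by (simp add: d_def)
      have e: "d * of_int (1584 * y ^ 2) = of_int (- x * (y + x))"
      proof -
        have "1584 * d = - s * (1 + s)" using n1584 by (simp add: d_def)
        moreover have "d * of_int (1584 * y ^ 2) = (1584 * d) * of_int y ^ 2" by simp
        ultimately have "d * of_int (1584 * y ^ 2) = - s * (1 + s) * of_int y ^ 2" by (simp only:)
        also have "\<dots> = - (s * of_int y) * (of_int y + s * of_int y)" by (simp add: algebra_simps power2_eq_square)
        finally show ?thesis unfolding sy by simp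
      qed
      have n0: "(of_int (1584 * y ^ 2) :: 'k) \<noteq> 0" using y0 n1584 by simp
      have "(d * of_int (1584 * y ^ 2)) ^ (p - 1) = 1"
        unfolding e by (rule fermat_char[OF P(1,2)]) (use d0 n0 in \<open>simp only: e[symmetric] mult_eq_0_iff; simp\<close>)
      thus ?thesis using fermat_char[OF P(1,2) n0] by (simp add: power_mult_distrib del: of_int_mult of_int_power)
    qed
    hence "(\<Sum>n<p. of_nat ((2 * n choose n) * apery2 n) / 4 ^ n) = (of_int (x ^ 2) :: 'k)"
      using S[OF s2] hasse_square_split[OF P \<alpha> N lin] unfolding d_def x by simp
    from rat_cong_from_char[OF p(1) _ ch this] show ?thesis using p by simp
  qed
  moreover have "rat_cong (\<Sum>n<p. of_nat ((2 * n choose n) * apery2 n) / 4 ^ n) 0 p"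
    if L: "Legendre (int p) 11 = - 1"
  proof -
    obtain s :: 'k where s: "s ^ 2 = - 11" using nth_root_exists[of 2 "- 11 :: 'k"] by auto
    have "s ^ (p - 1) = - 1" by (rule sqrt_11_inert[OF P L s])
    moreover have "(- 1 :: 'k) \<noteq> 1" using nz(1) by (metis add.right_inverse one_add_one)
    ultimately have "coeff (cm_cubic ^ m) (p - 1) = (0 :: 'k)"
      using hasse_zero_inert[OF P s] by simp
    hence "(\<Sum>n<p. of_nat ((2 * n choose n) * apery2 n) / 4 ^ n) = (of_int 0 :: 'k)"
      using S[OF s] by simp
    from rat_cong_from_char[OF p(1) _ ch this] show ?thesis using p by simp
  qed
  ultimately show ?thesis unfolding apery_congruence_def by blast
qed

text \<open>HOL has no types depending on a variable \<open>p\<close>. As a field of characteristic \<open>p\<close> is only needed to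
  refute a counterexample \<open>p\<close> of the theorem, a fixed (hypothetical) counterexample will do.\<close>

definition witness_prime :: nat where
  "witness_prime = (if \<exists>p. prime p \<and> p \<notin> {2, 3, 11} \<and> \<not> apery_congruence p
     then SOME p. prime p \<and> p \<notin> {2, 3, 11} \<and> \<not> apery_congruence p else 5)"

lemma witness_prime_prime: "prime witness_prime" "witness_prime \<notin> {2, 3, 11}"
proof -
  have "prime witness_prime \<and> witness_prime \<notin> {2, 3, 11}"
  proof (cases "\<exists>p. prime p \<and> p \<notin> {2, 3, 11} \<and> \<not> apery_congruence p")
    case True
    from someI_ex[OF this] show ?thesis unfolding witness_prime_def if_P[OF True] by blast
  next
    case False
    show ?thesis unfolding witness_prime_def if_not_P[OF False] by simp
  qed
  thus "prime witness_prime" "witness_prime \<notin> {2, 3, 11}" by auto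
qed

section \<open>The prime field of the hypothetical counterexample\<close>

typedef fp = "{0..<int witness_prime}"
  using prime_gt_0_nat[OF witness_prime_prime(1)] by (intro exI[of _ 0]) simp

setup_lifting type_definition_fp

lemma mod_witness_prime: "x mod int witness_prime \<in> {0..<int witness_prime}"
  using prime_gt_0_nat[OF witness_prime_prime(1)] by simp

instantiation fp :: field
begin

lift_definition zero_fp :: fp is 0
  using mod_witness_prime[of 0] by simp

lift_definition one_fp :: fp is 1
  using prime_gt_1_nat[OF witness_prime_prime(1)] by simp

lift_definition plus_fp :: "fp \<Rightarrow> fp \<Rightarrow> fp" is "\<lambda>x y. (x + y) mod int witness_prime"
  by (rule mod_witness_prime)

lift_definition minus_fp :: "fp \<Rightarrow> fp \<Rightarrow> fp" is "\<lambda>x y. (x - y) mod int witness_prime"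
  by (rule mod_witness_prime)

lift_definition uminus_fp :: "fp \<Rightarrow> fp" is "\<lambda>x. (- x) mod int witness_prime"
  by (rule mod_witness_prime)

lift_definition times_fp :: "fp \<Rightarrow> fp \<Rightarrow> fp" is "\<lambda>x y. (x * y) mod int witness_prime"
  by (rule mod_witness_prime)

text \<open>The inverse by Fermat's little theorem. The exponent is positive since
  \<open>witness_prime\<close> is odd, which gives \<open>inverse 0 = 0\<close>.\<close>

lift_definition inverse_fp :: "fp \<Rightarrow> fp" is "\<lambda>x. x ^ (witness_prime - 2) mod int witness_prime"
  by (rule mod_witness_prime)

definition divide_fp :: "fp \<Rightarrow> fp \<Rightarrow> fp" where "divide_fp x y = x * inverse y"

instance
proof
  fix a b c :: fp
  show "a * b * c = a * (b * c)" by transfer (simp add: mod_simps mult.assoc)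
  show "a * b = b * a" by transfer (simp add: mult.commute)
  show "1 * a = a" by transfer simp
  show "a + b + c = a + (b + c)" by transfer (simp add: mod_simps add.assoc)
  show "a + b = b + a" by transfer (simp add: add.commute)
  show "0 + a = a" by transfer simp
  show "- a + a = 0" by transfer (simp add: mod_simps)
  show "a - b = a + - b" by transfer (simp add: mod_simps)
  show "(a + b) * c = a * c + b * c" by transfer (simp add: mod_simps distrib_right)
  show "(0 :: fp) \<noteq> 1" by transfer simp
  show "a div b = a * inverse b" by (rule divide_fp_def)
  have p2: "2 < witness_prime"
    using witness_prime_prime prime_gt_1_nat[OF witness_prime_prime(1)] by (cases "witness_prime = 2") auto
  show "inverse (0 :: fp) = 0" by transfer (use p2 in \<open>simp add: power_0_left\<close>)
  show "inverse a * a = 1" if "a \<noteq> 0"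
    using that
  proof transfer
    fix x assume x: "x \<in> {0..<int witness_prime}" "x \<noteq> 0"
    hence "\<not> int witness_prime dvd x" using zdvd_not_zless by auto
    hence nd: "\<not> witness_prime dvd nat x" using x by (metis atLeastLessThan_iff int_dvd_int_iff int_nat_eq)
    have "[nat x ^ (witness_prime - 1) = 1] (mod witness_prime)"
      by (rule fermat_theorem[OF witness_prime_prime(1) nd])
    hence "[x ^ (witness_prime - 1) = 1] (mod int witness_prime)"
      using x(1) by (metis (no_types, lifting) atLeastLessThan_iff cong_int_iff int_nat_eq of_nat_1 of_nat_power)
    moreover have "x ^ (witness_prime - 2) * x = x ^ (witness_prime - 1)"
      using p2 by (metis Suc_1 Suc_diff_Suc Suc_lessD One_nat_def power_Suc2)
    ultimately show "x ^ (witness_prime - 2) mod int witness_prime * x mod int witness_prime = 1"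
      using p2 by (simp add: mod_simps cong_def)
  qed
qed

end

lemma CHAR_fp: "CHAR(fp) = witness_prime"
proof (rule CHAR_eqI)
  have r: "Rep_fp (of_nat n) = int n mod int witness_prime" for n
  proof (induction n)
    case 0
    show ?case by (simp add: zero_fp.rep_eq)
  next
    case (Suc n)
    thus ?case by (simp add: plus_fp.rep_eq one_fp.rep_eq mod_simps add.commute)
  qed
  show "(of_nat witness_prime :: fp) = 0"
    using r[of witness_prime] by (metis mod_self Rep_fp_inject zero_fp.rep_eq)
  show "witness_prime dvd n" if "(of_nat n :: fp) = 0" for n
  proof -
    have "int n mod int witness_prime = 0" using r[of n] that by (simp add: zero_fp.rep_eq)
    thus ?thesis by (metis dvd_eq_mod_eq_0 int_dvd_int_iff)
  qed
qed

lemma apery_congruence: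
  assumes "prime p" "p \<notin> {2, 3, 11}"
  shows "apery_congruence p"
proof (rule ccontr)
  assume "\<not> apery_congruence p"
  hence ex: "\<exists>p. prime p \<and> p \<notin> {2, 3, 11} \<and> \<not> apery_congruence p" using assms by blast
  have "\<not> apery_congruence witness_prime"
    using someI_ex[OF ex] unfolding witness_prime_def if_P[OF ex] by blast
  moreover have "CHAR(fp alg_closure) = witness_prime" by (simp add: CHAR_fp)
  ultimately show False using apery_congruence_char[OF _ witness_prime_prime] by blast
qed

theorem theorem4p2:
  fixes p :: nat
  assumes "prime p" and "p \<noteq> 2" and "p \<noteq> 11"
  defines "S \<equiv> (\<Sum>n=0..p - 1. of_nat ((2 * n) choose n) * of_nat (apery2 n) / 4 ^ n) :: rat"
  shows "(\<forall>x y :: int. Legendre (int p) 11 = 1 \<and> 4 * int p = x^2 + 11 * y^2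
            \<longrightarrow> rat_cong S (of_int (x^2)) p)
       \<and> (Legendre (int p) 11 = -1 \<longrightarrow> rat_cong S 0 p)"
proof (cases "p = 3")
  case False
  have "{0..p - 1} = {..<p}" using prime_gt_0_nat[OF assms(1)] by auto
  hence "S = (\<Sum>n<p. of_nat ((2 * n choose n) * apery2 n) / 4 ^ n)" by (simp add: S_def)
  thus ?thesis using apery_congruence[of p] assms(1-3) False by (simp add: apery_congruence_def)
next
  case True
  \<comment> \<open>The prime 3 is checked by hand: \<open>12 = x^2 + 11 y^2\<close> forces
    \<open>x^2 = 1\<close>, and \<open>77/8 - 1 = 3 * 23/8\<close>. The inert case does not arise,
    as 3 is the square of 5 modulo 11.\<close>
  have "apery2 0 = 1" "apery2 1 = 3" "apery2 2 = 19"
    by (simp_all add: apery2_def eval_nat_numeral)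
  hence S: "S = 77 / 8" unfolding S_def True by (simp add: eval_nat_numeral)
  have L: "Legendre (int p) 11 \<noteq> - 1"
  proof -
    have "[5 ^ 2 = 3] (mod (11 :: int))" by (simp add: cong_def)
    hence "QuadRes 11 3" unfolding QuadRes_def by blast
    thus ?thesis by (simp add: Legendre_def True)
  qed
  have "rat_cong S (of_int (x ^ 2)) p" if xy: "4 * int p = x ^ 2 + 11 * y ^ 2" for x y :: int
  proof -
    have "x ^ 2 + 11 * y ^ 2 = 12" using xy True by simp
    moreover have "x ^ 2 \<noteq> 12"
    proof
      assume "x ^ 2 = 12"
      hence "\<bar>x\<bar> ^ 2 = 12" by simp
      moreover have "\<bar>x\<bar> \<le> 3 \<or> 4 \<le> \<bar>x\<bar>" by linarith
      ultimately show False
        using power_mono[of "\<bar>x\<bar>" 3 2] power_mono[of 4 "\<bar>x\<bar>" 2] by auto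
    qed
    moreover have "y ^ 2 = 0 \<or> 1 \<le> y ^ 2" by (smt (verit) zero_le_power2)
    ultimately have "x ^ 2 = 1" using zero_le_power2[of x] by (smt (verit) zero_le_power2 power2_eq_square)
    moreover have "coprime ((2 :: int) ^ 3) (int 3)" by (simp only: coprime_power_left_iff) simp
    hence "77 / 8 \<in> p_integral 3" "1 \<in> p_integral 3" "23 / 8 \<in> p_integral 3"
      using p_integral_of_int_divide[of 8 3 77] p_integral_of_int_divide[of 1 3 1] p_integral_of_int_divide[of 8 3 23]
      by simp_all
    moreover have "77 / 8 - 1 = of_nat 3 * (23 / 8 :: rat)" by simp
    ultimately show ?thesis unfolding rat_cong_def S True by (metis of_int_1)
  qed
  thus ?thesis using L by blast
qed

end
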